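(* Let $\phi:(\mathbb{P}^1)^3\dashrightarrow\mathbb{P}^3$ be a pyramidal trilinear rational map (with $Y_0,Y_1$ the quadric boundary surfaces) whose weights are $w_{ijk}=\alpha_i\beta_j\gamma_k\Delta_{ijk}$ ($0\le i,j,k\le1$) for some $(\alpha_0:\alpha_1)\times(\beta_0:\beta_1)\times(\gamma_0:\gamma_1)\in(\mathbb{P}^1_{\mathbb{R}})^3$. Then $\phi^{-1}$ is given by $$(x_0:x_1:x_2:x_3)\mapsto(\alpha_1\lambda_1\sigma_1:\alpha_0\lambda_0\sigma_0)\times(\beta_1\mu_1\tau_1:\beta_0\mu_0\tau_0)\times(\gamma_1\nu_1\upsilon_1:\gamma_0\nu_0\upsilon_0).$$ Additionally: 1. The base locus of $\phi$ is defined by the ideal $(a_0,b_0,c_0)\cap(h,c_1)$ of $R$. 2. The base locus of $\phi^{-1}$ is $Y_0\cap Y_1=s\cup t\cup C$. 3. $\phi$ blows up the base point $(a_0,b_0,c_0)$ to the plane $\Pi_0$. 4. $\phi$ blows up the base curve $(h,c_1)$ to the cone $Q$.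
   Context: Setting. $\mathbb{P}^n$ is complex and $\mathbb{P}^n_{\mathbb{R}}$ real projective $n$-space; $R=\mathbb{R}[s_0,s_1]\otimes\mathbb{R}[t_0,t_1]\otimes\mathbb{R}[u_0,u_1]$. $\phi:\mathbb{P}^1\times\mathbb{P}^1\times\mathbb{P}^1\dashrightarrow\mathbb{P}^3$ is the trilinear rational map given by $$\mathbf{f}=(f_0,f_1,f_2,f_3)=\sum_{0\le i,j,k\le 1} w_{ijk}\,\mathbf{P}_{ijk}\,s_it_ju_k,$$ with control points $\mathbf{P}_{ijk}=(1,x_{ijk},y_{ijk},z_{ijk})\in\mathbb{R}^4$ (identified with points of $\mathbb{P}^3$) and weights $w_{ijk}\in\mathbb{R}$. $\langle\cdot,\cdot\rangle$ is the usual scalar product. Boundary surfaces. $\Sigma_0$ (resp. $\Sigma_1$) is the closure of the image of $\phi$ restricted to $(s_0:s_1)=(1:0)$ (resp. $(0:1)$). $T_0,T_1$ and $Y_0,Y_1$ are defined in the same way using $(t_0:t_1)$ and $(u_0:u_1)$. So $\mathbf{P}_{ijk}\in\Sigma_i\cap T_j\cap Y_k$. Boundary lines: $s_{jk}$ joins $\mathbf{P}_{0jk},\mathbf{P}_{1jk}$; $t_{ik}$ joins $\mathbf{P}_{i0k},\mathbf{P}_{i1k}$; $u_{ij}$ joins $\mathbf{P}_{ij0},\mathbf{P}_{ij1}$ (images of the corresponding coordinate lines). Each boundary surface is a plane or a quadric; $\sigma_i,\tau_j,\upsilon_k$ denote the (linear or quadratic) forms in $\mathbf{x}=(x_0,\dots,x_3)$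 defining $\Sigma_i,T_j,Y_k$. Standing nondegeneracy assumption: the surfaces $\Sigma_i,T_j,Y_k$ are smooth surfaces, pairwise distinct, and $s_{jk},t_{ik},u_{ij}$ are lines, pairwise distinct. $\phi$ is pyramidal if for one of the three parameters (1) the four boundary lines intersect at a point, and (2) the two boundary surfaces are quadrics. Convention: this parameter is $u$, so the $u_{ij}$ meet at a point $\mathbf{A}$, $Y_0,Y_1$ are quadrics, and $\Sigma_i,T_j$ are planes. Let $s=\Sigma_0\cap\Sigma_1$, $t=T_0\cap T_1$, and let $\Pi_0$ be the plane through $s$ and $t$, defined by $\pi_0=\boldsymbol{\pi}_0\cdot\mathbf{x}^T$ with $\boldsymbol{\pi}_0\in\mathbb{R}^4$. The points $(\lambda_0:\lambda_1),(\mu_0:\mu_1)\in\mathbb{P}^1_{\mathbb{R}}$ are such that $\pi_0=\lambda_0\sigma_0+\lambda_1\sigma_1=\mu_0\tau_0+\mu_1\tau_1$. Set $\Delta_{ijk}=1/\langle\boldsymbol{\pi}_0,\mathbf{P}_{ijk}\rangle$ (well defined). For weights as in the claim, $\phi$ is birational and $C$ is the plane conic with $Y_0\cap Y_1=s\cup t\cup C$ (it meets both $s$ and $t$); $\Pi_1$ is the plane supporting $C$, defined by $\boldsymbol{\pi}_1\cdot\mathbf{x}^T=0$; the pencil of quadrics spanned by $Y_0,Y_1$ contains $\Pi_0\cup\Pi_1$ and the cone (rank-three quadric) $Q$ with apex $\mathbf{A}=s\cap t$ through $C$, and $(\nu_0:\nu_1)\in\mathbb{P}^1_{\mathbb{R}}$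 is such that $Q$ is defined by $q=\nu_0\upsilon_0+\nu_1\upsilon_1$. Put $a_0=\alpha_0s_0+\alpha_1s_1$, $b_0=\beta_0t_0+\beta_1t_1$, $c_1=\gamma_0u_0+\gamma_1u_1$, and let $c_0=c_0(u_0,u_1)$ linear and $h=h(s_0,s_1,t_0,t_1)$ bilinear irreducible be defined by the factorization $\langle\boldsymbol{\pi}_1,\mathbf{f}\rangle=h\,c_0$. $\phi$ blows up a subvariety $Z$ of its base locus (written via its defining ideal) to a surface $S\subset\mathbb{P}^3$ if $S$ is the image in $\mathbb{P}^3$ of the fibre over $Z$ of the closure of the graph of $\phi$ in $(\mathbb{P}^1)^3\times\mathbb{P}^3$. *)

theory Defs
  imports
    "HOL-Analysis.Analysis"
    "HOL-Library.Poly_Mapping"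
    "HOL-Computational_Algebra.Factorial_Ring"
begin

section \<open>Polynomials in several variables\<close>

text \<open>
  \<open>('v, 'a) mpoly\<close> is the polynomial ring with one variable for each element of \<open>'v\<close> and
  coefficients in \<open>'a\<close>: finitely supported maps from monomials (finitely supported exponent
  functions) to coefficients, with the convolution product of \<open>HOL-Library.Poly_Mapping\<close>.
\<close>

type_synonym ('v, 'a) mpoly = "('v \<Rightarrow>\<^sub>0 nat) \<Rightarrow>\<^sub>0 'a"

definition pconst :: "'a::zero \<Rightarrow> ('v, 'a) mpoly" where
  "pconst c = Poly_Mapping.single 0 c"

definition pvar :: "'v \<Rightarrow> ('v, 'a::zero_neq_one) mpoly" where
  "pvar v = Poly_Mapping.single (Poly_Mapping.single v 1) 1"

definition peval :: "('v \<Rightarrow> 'a::comm_semiring_1) \<Rightarrow> ('v, 'a) mpoly \<Rightarrow> 'a" where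
  "peval x p = (\<Sum>m\<in>Poly_Mapping.keys p. Poly_Mapping.lookup p m *
     (\<Prod>v\<in>Poly_Mapping.keys m. x v ^ Poly_Mapping.lookup m v))"

definition cpx :: "('v, real) mpoly \<Rightarrow> ('v, complex) mpoly" where
  "cpx p = Poly_Mapping.map complex_of_real p"

definition partial :: "'v \<Rightarrow> ('v, 'a::comm_semiring_1) mpoly \<Rightarrow> ('v, 'a) mpoly" where
  "partial v p = (\<Sum>m\<in>Poly_Mapping.keys p.
     Poly_Mapping.single (m - Poly_Mapping.single v 1)
       (of_nat (Poly_Mapping.lookup m v) * Poly_Mapping.lookup p m))"

definition ideal_gen :: "('v, 'a::comm_ring_1) mpoly set \<Rightarrow> ('v, 'a) mpoly set" where
  "ideal_gen G = module.span (*) G"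


section \<open>Multiprojective spaces\<close>

text \<open>
  A map \<open>bl :: 'v \<Rightarrow> 'b\<close> sorts the homogeneous coordinates into blocks; it stands for the product,
  over all blocks, of the complex projective spaces with the coordinates of that block. Points are
  given by homogeneous coordinates that are not all zero in any block, and subsets by the sets of
  all their coordinate vectors. The spaces used below are

    \<^item> projective 3-space: coordinates of type \<open>4\<close> (whose elements are 0, 1, 2, 3), one block;
    \<^item> the product of three projective lines: coordinates of type \<open>param \<times> 2\<close> (the elements of
      type \<open>2\<close> are 0, 1), and \<open>bl = fst\<close>;
    \<^item> the product of two multiprojective spaces: a sum type, with \<open>map_sum bl bl'\<close>.
\<close>

definition mpoints :: "('v \<Rightarrow> 'b) \<Rightarrow> ('v \<Rightarrow> complex) set" where
  "mpoints bl = {x. \<forall>b. \<exists>v. bl v = b \<and> x v \<noteq> 0}"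

definition same_point :: "('v \<Rightarrow> 'b) \<Rightarrow> ('v \<Rightarrow> complex) \<Rightarrow> ('v \<Rightarrow> complex) \<Rightarrow> bool" where
  "same_point bl x y \<longleftrightarrow> (\<exists>c. (\<forall>b. c b \<noteq> 0) \<and> (\<forall>v. y v = c (bl v) * x v))"

definition homogeneous :: "('v \<Rightarrow> 'b) \<Rightarrow> ('b \<Rightarrow> nat) \<Rightarrow> ('v, 'a::zero) mpoly \<Rightarrow> bool" where
  "homogeneous bl d p \<longleftrightarrow> (\<forall>m\<in>Poly_Mapping.keys p. \<forall>b.
     (\<Sum>v\<in>{v \<in> Poly_Mapping.keys m. bl v = b}. Poly_Mapping.lookup m v) = d b)"

definition zero_locus :: "('v \<Rightarrow> 'b) \<Rightarrow> ('v, real) mpoly set \<Rightarrow> ('v \<Rightarrow> complex) set" where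
  "zero_locus bl I = {x \<in> mpoints bl. \<forall>p\<in>I. peval x (cpx p) = 0}"

definition zariski_closure :: "('v \<Rightarrow> 'b) \<Rightarrow> ('v \<Rightarrow> complex) set \<Rightarrow> ('v \<Rightarrow> complex) set" where
  "zariski_closure bl X = {x \<in> mpoints bl. \<forall>(p :: ('v, complex) mpoly) d.
     homogeneous bl d p \<longrightarrow> (\<forall>y\<in>X. peval y p = 0) \<longrightarrow> peval x p = 0}"

text \<open>
  Two ideals define the same closed subscheme if and only if their saturations with respect to the
  irrelevant ideal (the intersection of the ideals generated by the coordinates of one block) agree.
\<close>

definition irrelevant_ideal :: "('v \<Rightarrow> 'b) \<Rightarrow> ('v, 'a::comm_ring_1) mpoly set" where
  "irrelevant_ideal bl = (\<Inter>b. ideal_gen {pvar v | v. bl v = b})"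

definition saturation ::
    "('v \<Rightarrow> 'b) \<Rightarrow> ('v, 'a::comm_ring_1) mpoly set \<Rightarrow> ('v, 'a) mpoly set" where
  "saturation bl I = {p. \<forall>g\<in>irrelevant_ideal bl. \<exists>n. g ^ n * p \<in> I}"

definition same_subscheme ::
    "('v \<Rightarrow> 'b) \<Rightarrow> ('v, 'a::comm_ring_1) mpoly set \<Rightarrow> ('v, 'a) mpoly set \<Rightarrow> bool" where
  "same_subscheme bl I J \<longleftrightarrow> saturation bl I = saturation bl J"


section \<open>Rational maps\<close>

text \<open>
  A rational map is represented by one form for each coordinate of the target; within each block of
  the target the forms have the same multidegree and are not all zero.
\<close>

definition ratmap ::
    "('v \<Rightarrow> 'b) \<Rightarrow> ('w \<Rightarrow> 'c) \<Rightarrow> ('w \<Rightarrow> ('v, 'a::zero) mpoly) \<Rightarrow> bool" where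
  "ratmap bl bl' F \<longleftrightarrow> (\<forall>b. (\<exists>d. \<forall>w. bl' w = b \<longrightarrow> homogeneous bl d (F w)) \<and>
     (\<exists>w. bl' w = b \<and> F w \<noteq> 0))"

definition mapply :: "('w \<Rightarrow> ('v, real) mpoly) \<Rightarrow> ('v \<Rightarrow> complex) \<Rightarrow> 'w \<Rightarrow> complex" where
  "mapply F x = (\<lambda>w. peval x (cpx (F w)))"

text \<open>\<open>G \<circ> F\<close> is defined as a rational map and is the identity.\<close>

definition left_inverse_ratmap ::
    "('v \<Rightarrow> 'b) \<Rightarrow> ('w \<Rightarrow> 'c) \<Rightarrow> ('w \<Rightarrow> ('v, real) mpoly) \<Rightarrow> ('v \<Rightarrow> ('w, real) mpoly) \<Rightarrow> bool" where
  "left_inverse_ratmap bl bl' F G \<longleftrightarrow>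
     (\<exists>x\<in>mpoints bl. mapply F x \<in> mpoints bl' \<and> mapply G (mapply F x) \<in> mpoints bl) \<and>
     (\<forall>x\<in>mpoints bl. mapply F x \<in> mpoints bl' \<longrightarrow> mapply G (mapply F x) \<in> mpoints bl \<longrightarrow>
        same_point bl (mapply G (mapply F x)) x)"

text \<open>\<open>F\<close> is birational and \<open>G\<close> represents its inverse.\<close>

definition inverse_ratmap ::
    "('v \<Rightarrow> 'b) \<Rightarrow> ('w \<Rightarrow> 'c) \<Rightarrow> ('w \<Rightarrow> ('v, real) mpoly) \<Rightarrow> ('v \<Rightarrow> ('w, real) mpoly) \<Rightarrow> bool" where
  "inverse_ratmap bl bl' F G \<longleftrightarrow> ratmap bl bl' F \<and> ratmap bl' bl G \<and>
     left_inverse_ratmap bl bl' F G \<and> left_inverse_ratmap bl' bl G F"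

text \<open>
  The points at which the rational map is not defined: no representation \<open>G\<close> of the same rational
  map has a value there. (\<open>F\<close> itself may have superfluous common factors.)
\<close>

definition base_locus ::
    "('v \<Rightarrow> 'b) \<Rightarrow> ('w \<Rightarrow> 'c) \<Rightarrow> ('w \<Rightarrow> ('v, real) mpoly) \<Rightarrow> ('v \<Rightarrow> complex) set" where
  "base_locus bl bl' F = {x \<in> mpoints bl. \<not> (\<exists>G :: 'w \<Rightarrow> ('v, complex) mpoly.
     ratmap bl bl' G \<and>
     (\<forall>w w'. bl' w = bl' w' \<longrightarrow> cpx (F w) * G w' = cpx (F w') * G w) \<and>
     (\<lambda>w. peval x (G w)) \<in> mpoints bl')}"

definition graph ::
    "('v \<Rightarrow> 'b) \<Rightarrow> ('w \<Rightarrow> 'c) \<Rightarrow> ('w \<Rightarrow> ('v, real) mpoly) \<Rightarrow> ('v + 'w \<Rightarrow> complex) set" where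
  "graph bl bl' F = {case_sum x y | x y.
     x \<in> mpoints bl \<and> mapply F x \<in> mpoints bl' \<and> same_point bl' (mapply F x) y}"

text \<open>
  The subvariety defined by the ideal \<open>I\<close> lies in the base locus, and \<open>S\<close> is the image of the fibre
  over it of the closure of the graph.
\<close>

definition blows_up ::
    "('v \<Rightarrow> 'b) \<Rightarrow> ('w \<Rightarrow> 'c) \<Rightarrow> ('w \<Rightarrow> ('v, real) mpoly) \<Rightarrow> ('v, real) mpoly set \<Rightarrow>
      ('w \<Rightarrow> complex) set \<Rightarrow> bool" where
  "blows_up bl bl' F I S \<longleftrightarrow> zero_locus bl I \<subseteq> base_locus bl bl' F \<and>
     S = {y. \<exists>x\<in>zero_locus bl I.
            case_sum x y \<in> zariski_closure (map_sum bl bl') (graph bl bl' F)}"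


section \<open>Subvarieties of projective 3-space\<close>

abbreviation blk3 :: "4 \<Rightarrow> unit" where
  "blk3 \<equiv> (\<lambda>_. ())"

definition linear_form :: "real^4 \<Rightarrow> (4, real) mpoly" where
  "linear_form v = (\<Sum>l\<in>UNIV. pconst (v $ l) * pvar l)"

definition quadratic_form :: "real^4^4 \<Rightarrow> (4, real) mpoly" where
  "quadratic_form M = (\<Sum>l\<in>UNIV. \<Sum>m\<in>UNIV. pconst (M $ l $ m) * pvar l * pvar m)"

definition plane :: "real^4 \<Rightarrow> (4 \<Rightarrow> complex) set" where
  "plane v = zero_locus blk3 {linear_form v}"

definition quadric :: "real^4^4 \<Rightarrow> (4 \<Rightarrow> complex) set" where
  "quadric M = zero_locus blk3 {quadratic_form M}"

definition proj_line :: "real^4 \<Rightarrow> real^4 \<Rightarrow> (4 \<Rightarrow> complex) set" where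
  "proj_line p q = {x \<in> mpoints blk3. \<exists>a b. \<forall>l. x l = a * of_real (p $ l) + b * of_real (q $ l)}"

text \<open>
  A form \<open>F\<close> whose gradient vanishes nowhere on \<open>S\<close> has no multiple factor, so \<open>d\<close> is the degree
  of \<open>S\<close>.
\<close>

definition smooth_surface :: "nat \<Rightarrow> (4 \<Rightarrow> complex) set \<Rightarrow> bool" where
  "smooth_surface d S \<longleftrightarrow> d > 0 \<and> (\<exists>F :: (4, complex) mpoly.
     homogeneous blk3 (\<lambda>_. d) F \<and> S = {x \<in> mpoints blk3. peval x F = 0} \<and>
     (\<forall>x\<in>S. \<exists>l. peval x (partial l F) \<noteq> 0))"

text \<open>\<open>C\<close> is a conic in the plane defined by \<open>v\<close>.\<close>

definition plane_conic :: "real^4 \<Rightarrow> (4 \<Rightarrow> complex) set \<Rightarrow> bool" where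
  "plane_conic v C \<longleftrightarrow> v \<noteq> 0 \<and> (\<exists>K :: (4, complex) mpoly. homogeneous blk3 (\<lambda>_. 2) K \<and>
     (\<exists>x\<in>plane v. peval x K \<noteq> 0) \<and> C = {x \<in> plane v. peval x K = 0})"

text \<open>\<open>S\<close> contains the line joining \<open>A\<close> to any of its points.\<close>

definition cone_with_apex :: "(4 \<Rightarrow> complex) \<Rightarrow> (4 \<Rightarrow> complex) set \<Rightarrow> bool" where
  "cone_with_apex A S \<longleftrightarrow> A \<in> S \<and>
     (\<forall>x\<in>S. \<forall>a b. (\<lambda>l. a * A l + b * x l) \<in> mpoints blk3 \<longrightarrow> (\<lambda>l. a * A l + b * x l) \<in> S)"


section \<open>Trilinear rational maps\<close>

datatype param = Par_s | Par_t | Par_u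

text \<open>The polynomials in the variables \<open>(Par_s, i) = s\<^sub>i\<close>, \<open>(Par_t, j) = t\<^sub>j\<close>, \<open>(Par_u, k) = u\<^sub>k\<close>.\<close>

type_synonym ring_R = "(param \<times> 2, real) mpoly"

abbreviation blk111 :: "param \<times> 2 \<Rightarrow> param" where
  "blk111 \<equiv> fst"

definition trilinear :: "(2 \<Rightarrow> 2 \<Rightarrow> 2 \<Rightarrow> real) \<Rightarrow> (2 \<Rightarrow> 2 \<Rightarrow> 2 \<Rightarrow> real^4) \<Rightarrow> 4 \<Rightarrow> ring_R" where
  "trilinear w P l = (\<Sum>i\<in>UNIV. \<Sum>j\<in>UNIV. \<Sum>k\<in>UNIV.
     pconst (w i j k * P i j k $ l) * pvar (Par_s, i) * pvar (Par_t, j) * pvar (Par_u, k))"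

text \<open>
  The restriction of the parameter \<open>b\<close> to \<open>(1 : 0)\<close> for \<open>i = 0\<close> and to \<open>(0 : 1)\<close> for \<open>i = 1\<close> is
  expressed by the vanishing of the other coordinate.
\<close>

definition boundary_surface ::
    "(2 \<Rightarrow> 2 \<Rightarrow> 2 \<Rightarrow> real) \<Rightarrow> (2 \<Rightarrow> 2 \<Rightarrow> 2 \<Rightarrow> real^4) \<Rightarrow> param \<Rightarrow> 2 \<Rightarrow> (4 \<Rightarrow> complex) set" where
  "boundary_surface w P b i = zariski_closure blk3
     {mapply (trilinear w P) x | x. x \<in> mpoints blk111 \<and> (\<forall>i'. i' \<noteq> i \<longrightarrow> x (b, i') = 0) \<and>
        mapply (trilinear w P) x \<in> mpoints blk3}"

text \<open>The control points joined by the boundary line of parameter \<open>b\<close>: \<open>s\<^sub>j\<^sub>k\<close>, \<open>t\<^sub>i\<^sub>k\<close>, \<open>u\<^sub>i\<^sub>j\<close>.\<close>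

fun boundary_point :: "(2 \<Rightarrow> 2 \<Rightarrow> 2 \<Rightarrow> real^4) \<Rightarrow> param \<Rightarrow> 2 \<Rightarrow> 2 \<Rightarrow> 2 \<Rightarrow> real^4" where
  "boundary_point P Par_s j k e = P e j k"
| "boundary_point P Par_t i k e = P i e k"
| "boundary_point P Par_u i j e = P i j e"

definition boundary_line ::
    "(2 \<Rightarrow> 2 \<Rightarrow> 2 \<Rightarrow> real^4) \<Rightarrow> param \<Rightarrow> 2 \<Rightarrow> 2 \<Rightarrow> (4 \<Rightarrow> complex) set" where
  "boundary_line P b m n = proj_line (boundary_point P b m n 0) (boundary_point P b m n 1)"

text \<open>
  Control points have first coordinate 1, so two of them that differ as vectors are different
  points and do span a line.
\<close>

definition nondegenerate ::
    "(2 \<Rightarrow> 2 \<Rightarrow> 2 \<Rightarrow> real) \<Rightarrow> (2 \<Rightarrow> 2 \<Rightarrow> 2 \<Rightarrow> real^4) \<Rightarrow> bool" where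
  "nondegenerate w P \<longleftrightarrow>
     (\<forall>b i. \<exists>d. smooth_surface d (boundary_surface w P b i)) \<and>
     inj (\<lambda>(b, i). boundary_surface w P b i) \<and>
     (\<forall>b m n. boundary_point P b m n 0 \<noteq> boundary_point P b m n 1) \<and>
     inj (\<lambda>(b, m, n). boundary_line P b m n)"

text \<open>Pyramidal with respect to the parameter \<open>b\<close>, the four boundary lines meeting at \<open>A\<close>.\<close>

definition pyramidal_at ::
    "(2 \<Rightarrow> 2 \<Rightarrow> 2 \<Rightarrow> real) \<Rightarrow> (2 \<Rightarrow> 2 \<Rightarrow> 2 \<Rightarrow> real^4) \<Rightarrow> param \<Rightarrow> (4 \<Rightarrow> complex) \<Rightarrow> bool" where
  "pyramidal_at w P b A \<longleftrightarrow>
     (\<forall>m n. A \<in> boundary_line P b m n) \<and>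
     (\<forall>i. smooth_surface 2 (boundary_surface w P b i))"

text \<open>The linear form with coefficients \<open>c\<close> in the two variables of the parameter \<open>b\<close>.\<close>

definition param_form :: "param \<Rightarrow> real^2 \<Rightarrow> ring_R" where
  "param_form b c = (\<Sum>i\<in>UNIV. pconst (c $ i) * pvar (b, i))"

text \<open>The tuple \<open>(p\<^sub>0 : p\<^sub>1) \<times> (q\<^sub>0 : q\<^sub>1) \<times> (r\<^sub>0 : r\<^sub>1)\<close>.\<close>

fun to_P1_cubed :: "'p \<times> 'p \<Rightarrow> 'p \<times> 'p \<Rightarrow> 'p \<times> 'p \<Rightarrow> param \<times> 2 \<Rightarrow> 'p" where
  "to_P1_cubed p q r (Par_s, i) = (if i = 0 then fst p else snd p)"
| "to_P1_cubed p q r (Par_t, i) = (if i = 0 then fst q else snd q)"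
| "to_P1_cubed p q r (Par_u, i) = (if i = 0 then fst r else snd r)"

end

(*
  The four control points P_ij0 span the space because Y_0 is a smooth quadric, and they can be
  rescaled to a basis e_ij whose sum is a multiple of the apex A.  In the dual coordinates X_ij the
  four planes are X_00 = X_01, X_10 = X_11, X_00 = X_10, X_01 = X_11, the plane Pi_0 is
  X_00 + X_11 = X_01 + X_10, and after absorbing alpha, beta, gamma into the parameters the map reads
    F_ij = eps_ij s_i t_j (u_0 + u_1) - u_1 L,   L = sum eps_ij k_ij s_i t_j,   eps_ij = (-1)^(i+j),
  for four numbers k_ij.  Every claim becomes a polynomial identity in this normal form.  The only
  degenerate values of k_ij are excluded by the smoothness of Y_1 (sum k_ij <> 1) and by the rank of
  the cone (sum k_ij <> 0 and det k <> 0).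

  For the base scheme it is enough that s_i t_j u_k times the ideal (a_0, b_0, c_0) \<inter> (h, c_1)
  lies in the ideal of the F_ij.  A bihomogeneous relation that holds on the graph bounds each fibre
  of its closure from above; the limits of F along lines through a base point bound it from below,
  and two different limits show that the point cannot be removed from the base locus.
*)
theory Submission
  imports Defs
begin

section \<open>Evaluation of polynomials\<close>

text \<open>The scaling of e_ij is dictated by Pi_0: dividing P_ij0 by eps_ij <pi_0, P_ij0> absorbs
  the weights Delta_ij0 and gives pi_0 the value eps_ij at e_ij. As sigma_i vanishes at e_ij, the
  relation pi_0 = lambda_0 sigma_0 + lambda_1 sigma_1 then fixes the scaled plane forms, which
  become differences of two coordinates; the same holds for tau. All of them vanish at A, so A has
  four equal coordinates. The line through P_ij0, P_ij1 and A finally gives P_ij1 as a multiple of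
  e_ij - k_ij E with E = sum e_ij. Arrange the X_ij in a matrix: its determinant defines Y_0, and
  subtracting c from every entry subtracts c (X_00 + X_11 - X_01 - X_10) from the determinant. This
  one identity is behind the equation of Y_1, the cone and the u-component of the inverse. The
  hypotheses speak of point sets, so the forms of Y_0 and Y_1 have to be recovered from the
  surfaces. Each is found only up to a scalar; the two scalars are matched by the cone, which must
  be singular at A.\<close>

definition monom_eval :: "('v \<Rightarrow> 'a::comm_semiring_1) \<Rightarrow> ('v \<Rightarrow>\<^sub>0 nat) \<Rightarrow> 'a" where
  "monom_eval x m = (\<Prod>v\<in>Poly_Mapping.keys m. x v ^ Poly_Mapping.lookup m v)"

lemma monom_eval_superset:
  assumes "finite V" "Poly_Mapping.keys m \<subseteq> V"
  shows "monom_eval x m = (\<Prod>v\<in>V. x v ^ Poly_Mapping.lookup m v)"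
  unfolding monom_eval_def using assms
  by (intro prod.mono_neutral_left) (auto simp: in_keys_iff)

lemma monom_eval_add: "monom_eval x (m + m') = monom_eval x m * monom_eval x m'"
proof -
  let ?V = "Poly_Mapping.keys m \<union> Poly_Mapping.keys m'"
  have "Poly_Mapping.keys (m + m') \<subseteq> ?V"
    by (rule keys_add)
  then show ?thesis
    by (simp add: monom_eval_superset[of ?V] lookup_add power_add prod.distrib)
qed

lemma monom_eval_0 [simp]: "monom_eval x 0 = 1"
  by (simp add: monom_eval_def)

lemma monom_eval_single [simp]: "monom_eval x (Poly_Mapping.single v n) = x v ^ n"
  by (simp add: monom_eval_def)

text \<open>Both \<open>peval\<close> and its composition with \<open>cpx\<close> are instances of evaluation along a
  coefficient homomorphism \<open>\<phi>\<close>.\<close>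

definition eval_hom ::
    "('a::zero \<Rightarrow> 'b::comm_semiring_1) \<Rightarrow> ('v \<Rightarrow> 'b) \<Rightarrow> ('v, 'a) mpoly \<Rightarrow> 'b" where
  "eval_hom \<phi> x p = (\<Sum>m\<in>Poly_Mapping.keys p. \<phi> (Poly_Mapping.lookup p m) * monom_eval x m)"

lemma eval_hom_superset:
  assumes "finite M" "Poly_Mapping.keys p \<subseteq> M" "\<phi> 0 = 0"
  shows "eval_hom \<phi> x p = (\<Sum>m\<in>M. \<phi> (Poly_Mapping.lookup p m) * monom_eval x m)"
  unfolding eval_hom_def using assms
  by (intro sum.mono_neutral_left) (auto simp: in_keys_iff)

lemma eval_hom_single: "\<phi> 0 = 0 \<Longrightarrow> eval_hom \<phi> x (Poly_Mapping.single m c) = \<phi> c * monom_eval x m"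
  by (subst eval_hom_superset[of "{m}"]) auto

lemma eval_hom_0 [simp]: "eval_hom \<phi> x 0 = 0"
  by (simp add: eval_hom_def)

lemma eval_hom_add:
  assumes "\<phi> 0 = 0" "\<And>a b. \<phi> (a + b) = \<phi> a + \<phi> b"
  shows "eval_hom \<phi> x (p + q) = eval_hom \<phi> x p + eval_hom \<phi> x q"
proof -
  let ?M = "Poly_Mapping.keys p \<union> Poly_Mapping.keys q"
  have "Poly_Mapping.keys (p + q) \<subseteq> ?M"
    by (rule keys_add)
  then show ?thesis
    by (simp add: eval_hom_superset[of ?M] assms lookup_add distrib_right sum.distrib)
qed

text \<open>Unlike in \<open>update_induct\<close>, the added monomial need not be new, so for an
  additive function the step is one application of additivity.\<close>

lemma mpoly_induct [case_names zero single_add]: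
  fixes p :: "'m \<Rightarrow>\<^sub>0 'a::comm_monoid_add"
  assumes "P 0" "\<And>p m c. P p \<Longrightarrow> P (Poly_Mapping.single m c + p)"
  shows "P p"
proof (induction p rule: update_induct)
  case const
  then show ?case by (rule assms)
next
  case (update f a b)
  have "Poly_Mapping.update a b f = Poly_Mapping.single a b + f"
    using update(1) by (intro poly_mapping_eqI)
      (auto simp: lookup_update lookup_add lookup_single when_def in_keys_iff)
  then show ?case using assms(2) update(3) by simp
qed

lemma eval_hom_mult:
  fixes \<phi> :: "'a::comm_semiring_1 \<Rightarrow> 'b::comm_semiring_1"
  assumes \<phi>: "\<phi> 0 = 0" "\<And>a b. \<phi> (a + b) = \<phi> a + \<phi> b" "\<And>a b. \<phi> (a * b) = \<phi> a * \<phi> b"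
  shows "eval_hom \<phi> x (p * q) = eval_hom \<phi> x p * eval_hom \<phi> x q"
proof -
  have single: "eval_hom \<phi> x (Poly_Mapping.single m c * q) = \<phi> c * monom_eval x m * eval_hom \<phi> x q"
    for m c
    by (induction q rule: mpoly_induct)
      (simp_all add: distrib_left eval_hom_add \<phi> eval_hom_single mult_single
        monom_eval_add algebra_simps)
  show ?thesis
    by (induction p rule: mpoly_induct)
      (simp_all add: distrib_right eval_hom_add \<phi> single eval_hom_single)
qed

lemma peval_eq_eval_hom: "peval x p = eval_hom (\<lambda>c. c) x p"
  by (simp add: peval_def eval_hom_def monom_eval_def)

lemma keys_cpx [simp]: "Poly_Mapping.keys (cpx p) = Poly_Mapping.keys p"
  by (auto simp: cpx_def in_keys_iff map.rep_eq when_def)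

definition ceval :: "('v \<Rightarrow> complex) \<Rightarrow> ('v, real) mpoly \<Rightarrow> complex" where
  "ceval x p = peval x (cpx p)"

lemma ceval_eq_eval_hom: "ceval x p = eval_hom complex_of_real x p"
  unfolding ceval_def peval_eq_eval_hom eval_hom_def keys_cpx
  by (intro sum.cong) (auto simp: cpx_def map.rep_eq when_def)

lemma peval_0 [simp]: "peval x 0 = 0"
  and peval_add [simp]: "peval x (p + q) = peval x p + peval x q"
  and peval_mult [simp]: "peval x (p * q) = peval x p * peval x q"
  and peval_pconst [simp]: "peval x (pconst c) = c"
  and peval_pvar [simp]: "peval x (pvar v) = x v"
  by (simp_all add: peval_eq_eval_hom eval_hom_add eval_hom_mult pconst_def pvar_def eval_hom_single)

lemma peval_single: "peval x (Poly_Mapping.single m c) = c * monom_eval x m"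
  by (simp add: peval_eq_eval_hom eval_hom_single)

lemma ceval_0 [simp]: "ceval x 0 = 0"
  and ceval_add [simp]: "ceval x (p + q) = ceval x p + ceval x q"
  and ceval_mult [simp]: "ceval x (p * q) = ceval x p * ceval x q"
  and ceval_pconst [simp]: "ceval x (pconst c) = complex_of_real c"
  and ceval_pvar [simp]: "ceval x (pvar v) = x v"
  by (simp_all add: ceval_eq_eval_hom eval_hom_add eval_hom_mult pconst_def pvar_def eval_hom_single)

lemma peval_minus [simp]: "peval x (- p) = - peval x (p :: ('v, 'a::comm_ring_1) mpoly)"
  by (metis add.right_inverse add_eq_0_iff peval_0 peval_add)

lemma peval_diff [simp]: "peval x (p - q) = peval x p - peval x (q :: ('v, 'a::comm_ring_1) mpoly)"
  by (metis peval_add peval_minus add_uminus_conv_diff)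

lemma ceval_minus [simp]: "ceval x (- p) = - ceval x p"
  by (metis add.right_inverse add_eq_0_iff ceval_0 ceval_add)

lemma ceval_diff [simp]: "ceval x (p - q) = ceval x p - ceval x q"
  by (metis ceval_add ceval_minus add_uminus_conv_diff)

lemma peval_sum [simp]: "peval x (sum g I) = (\<Sum>i\<in>I. peval x (g i))"
  by (induction I rule: infinite_finite_induct) auto

lemma ceval_sum [simp]: "ceval x (sum g I) = (\<Sum>i\<in>I. ceval x (g i))"
  by (induction I rule: infinite_finite_induct) auto

lemma tendsto_peval:
  fixes x :: "'v \<Rightarrow> complex"
  assumes "\<And>v. ((\<lambda>t. g t v) \<longlongrightarrow> x v) F"
  shows "((\<lambda>t. peval (g t) p) \<longlongrightarrow> peval x p) F"
  unfolding peval_def by (intro tendsto_intros assms)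

lemma pconst_mult: "pconst (a * b) = pconst a * (pconst b :: ('v, 'a::comm_semiring_1) mpoly)"
  and pconst_add: "pconst (a + b) = pconst a + (pconst b :: ('v, 'a) mpoly)"
  and pconst_1 [simp]: "pconst 1 = (1 :: ('v, 'a) mpoly)"
  and pconst_0 [simp]: "pconst 0 = (0 :: ('v, 'a) mpoly)"
  by (simp_all add: pconst_def mult_single single_add)

lemma pconst_minus: "pconst (- a) = - (pconst a :: ('v, 'a::comm_ring_1) mpoly)"
  and pconst_diff: "pconst (a - b) = pconst a - (pconst b :: ('v, 'a) mpoly)"
  by (simp_all add: pconst_def single_uminus single_diff)

lemma pconst_sum: "pconst (sum g I) = (\<Sum>i\<in>I. pconst (g i) :: ('v, 'a::comm_semiring_1) mpoly)"
  by (induction I rule: infinite_finite_induct) (auto simp: pconst_add)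

section \<open>Homogeneity\<close>

definition block_degree :: "('v \<Rightarrow> 'b) \<Rightarrow> ('v \<Rightarrow>\<^sub>0 nat) \<Rightarrow> 'b \<Rightarrow> nat" where
  "block_degree bl m b = (\<Sum>v\<in>{v \<in> Poly_Mapping.keys m. bl v = b}. Poly_Mapping.lookup m v)"

lemma homogeneous_iff:
  "homogeneous bl d p \<longleftrightarrow> (\<forall>m\<in>Poly_Mapping.keys p. block_degree bl m = d)"
  by (auto simp: homogeneous_def block_degree_def fun_eq_iff)

lemma block_degree_superset:
  assumes "finite V" "Poly_Mapping.keys m \<subseteq> V"
  shows "block_degree bl m b = (\<Sum>v\<in>{v \<in> V. bl v = b}. Poly_Mapping.lookup m v)"
  unfolding block_degree_def using assms
  by (intro sum.mono_neutral_left) (auto simp: in_keys_iff)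

lemma block_degree_add: "block_degree bl (m + m') b = block_degree bl m b + block_degree bl m' b"
proof -
  let ?V = "Poly_Mapping.keys m \<union> Poly_Mapping.keys m'"
  have "Poly_Mapping.keys (m + m') \<subseteq> ?V"
    by (rule keys_add)
  then show ?thesis
    by (simp add: block_degree_superset[of ?V] lookup_add sum.distrib)
qed

lemma homogeneous_mult:
  assumes "homogeneous bl d p" "homogeneous bl d' q"
  shows "homogeneous bl (\<lambda>b. d b + d' b) (p * q)"
  using assms keys_mult[of p q] by (fastforce simp: homogeneous_iff block_degree_add fun_eq_iff)

text \<open>The degree \<open>e\<close> is tied to \<open>d\<close> and \<open>d'\<close> only
  pointwise, so the rule also applies to degrees written as a case distinction on the block.\<close>

lemma homogeneous_mult':
  assumes "homogeneous bl d p" "homogeneous bl d' q" "\<And>b. e b = d b + d' b"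
  shows "homogeneous bl e (p * q)"
proof -
  have "e = (\<lambda>b. d b + d' b)" using assms(3) by auto
  then show ?thesis using homogeneous_mult[OF assms(1,2)] by simp
qed

lemma homogeneous_0 [simp]: "homogeneous bl d 0"
  by (simp add: homogeneous_def)

lemma homogeneous_add:
  assumes "homogeneous bl d p" "homogeneous bl d q"
  shows "homogeneous bl d (p + q)"
  using assms keys_add[of p q] by (fastforce simp: homogeneous_iff)

lemma homogeneous_minus:
  fixes p :: "('v, 'a::ab_group_add) mpoly"
  shows "homogeneous bl d p \<Longrightarrow> homogeneous bl d (- p)"
  by (auto simp: homogeneous_iff in_keys_iff)

lemma homogeneous_diff:
  fixes p q :: "('v, 'a::ab_group_add) mpoly"
  assumes "homogeneous bl d p" "homogeneous bl d q"
  shows "homogeneous bl d (p - q)"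
  using homogeneous_add[OF assms(1) homogeneous_minus[OF assms(2)]] by simp

lemma homogeneous_sum:
  assumes "\<And>i. i \<in> I \<Longrightarrow> homogeneous bl d (g i)"
  shows "homogeneous bl d (sum g I)"
  using assms by (induction I rule: infinite_finite_induct) (auto intro: homogeneous_add)

lemma homogeneous_pconst: "homogeneous bl (\<lambda>_. 0) (pconst c)"
  by (auto simp: homogeneous_iff pconst_def block_degree_def fun_eq_iff)

lemma homogeneous_pconst_mult:
  fixes p :: "('v, 'a::comm_semiring_1) mpoly"
  shows "homogeneous bl d p \<Longrightarrow> homogeneous bl d (pconst c * p)"
  by (rule homogeneous_mult'[OF homogeneous_pconst]) auto

lemma block_degree_single:
  "block_degree bl (Poly_Mapping.single v n) b = (if bl v = b then n else 0)"
proof -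
  have "{va. va = v \<and> bl va = b} = (if bl v = b then {v} else {})" by auto
  then show ?thesis by (subst block_degree_superset[of "{v}"]) auto
qed

lemma homogeneous_pvar: "homogeneous bl (\<lambda>b. if bl v = b then 1 else 0) (pvar v :: ('v, 'a::zero_neq_one) mpoly)"
  by (auto simp: homogeneous_iff pvar_def block_degree_single fun_eq_iff)

lemma homogeneous_cpx [simp]: "homogeneous bl d (cpx p) \<longleftrightarrow> homogeneous bl d p"
  by (simp add: homogeneous_def)

lemma cpx_eq_0_iff [simp]: "cpx p = 0 \<longleftrightarrow> p = 0"
  by (metis keys_cpx keys_zero lookup_zero poly_mapping_eqI not_in_keys_iff_lookup_eq_zero empty_iff)

text \<open>Peeling off one variable of a chosen block at a time leads from a multidegree to
  explicit coefficients.\<close>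

lemma block_degree_pos_split:
  assumes "block_degree bl m b > 0"
  obtains v m' where "bl v = b" "m = Poly_Mapping.single v 1 + m'"
proof -
  have "\<exists>v\<in>{v \<in> Poly_Mapping.keys m. bl v = b}. Poly_Mapping.lookup m v \<noteq> 0"
    using assms unfolding block_degree_def by (metis (no_types, lifting) less_irrefl sum.neutral)
  then obtain v where v: "bl v = b" "Poly_Mapping.lookup m v \<noteq> 0" by auto
  have "m = Poly_Mapping.single v 1 + (m - Poly_Mapping.single v 1)"
    using v by (intro poly_mapping_eqI) (auto simp: lookup_add lookup_minus lookup_single when_def)
  then show ?thesis using v that by blast
qed

lemma block_degree_eq_0:
  assumes "\<And>b. block_degree bl m b = 0"
  shows "m = 0"
proof (rule poly_mapping_eqI)
  fix v
  have "block_degree bl m (bl v) = 0" by (rule assms)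
  then show "Poly_Mapping.lookup m v = Poly_Mapping.lookup 0 v"
    unfolding block_degree_def by (auto simp: in_keys_iff)
qed

lemma mpoly_sum_monomials:
  "p = (\<Sum>m\<in>Poly_Mapping.keys p. Poly_Mapping.single m (Poly_Mapping.lookup p m))"
proof (rule poly_mapping_eqI)
  fix k
  show "Poly_Mapping.lookup p k = Poly_Mapping.lookup
      (\<Sum>m\<in>Poly_Mapping.keys p. Poly_Mapping.single m (Poly_Mapping.lookup p m)) k"
    by (auto simp: lookup_sum lookup_single when_def in_keys_iff sum.delta)
qed

section \<open>Closures, ideals and rational maps\<close>

lemma subset_zariski_closure: "X \<subseteq> mpoints bl \<Longrightarrow> X \<subseteq> zariski_closure bl X"
  unfolding zariski_closure_def by blast

lemma zariski_closureD:
  assumes "x \<in> zariski_closure bl X" "homogeneous bl d p" "\<And>y. y \<in> X \<Longrightarrow> peval y p = 0"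
  shows "peval x p = 0"
  using assms unfolding zariski_closure_def by blast

lemma zariski_closure_subset_zero_locus:
  assumes "X \<subseteq> zero_locus bl G" "\<And>p. p \<in> G \<Longrightarrow> \<exists>d. homogeneous bl d p"
  shows "zariski_closure bl X \<subseteq> zero_locus bl G"
proof
  fix x assume x: "x \<in> zariski_closure bl X"
  have "peval x (cpx p) = 0" if "p \<in> G" for p
  proof -
    obtain d where "homogeneous bl d p" using assms(2) \<open>p \<in> G\<close> by blast
    with x assms(1) \<open>p \<in> G\<close> show ?thesis
      by (intro zariski_closureD[of x bl X d]) (auto simp: zero_locus_def)
  qed
  with x show "x \<in> zero_locus bl G" by (auto simp: zero_locus_def zariski_closure_def)
qed

text \<open>Polynomials are continuous, so every equation of \<open>X\<close> survives in the limit.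
  This is how points of a closure outside of the set itself are reached.\<close>

lemma zariski_closure_limit:
  fixes g :: "complex \<Rightarrow> 'v \<Rightarrow> complex"
  assumes "x \<in> mpoints bl" "\<And>v. ((\<lambda>t. g t v) \<longlongrightarrow> x v) (at 0)"
    and "eventually (\<lambda>t. g t \<in> X) (at 0)"
  shows "x \<in> zariski_closure bl X"
proof -
  have "peval x p = 0" if "\<forall>y\<in>X. peval y p = 0" for p
  proof -
    have "((\<lambda>t. peval (g t) p) \<longlongrightarrow> peval x p) (at 0)"
      by (rule tendsto_peval) (rule assms)
    moreover have "eventually (\<lambda>t. peval (g t) p = 0) (at 0)"
      using assms(3) by eventually_elim (use that in auto)
    ultimately have "((\<lambda>t. 0) \<longlongrightarrow> peval x p) (at (0::complex))"
      using tendsto_cong by fastforce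
    then show ?thesis
      using tendsto_const_iff trivial_limit_at by (metis (no_types))
  qed
  then show ?thesis using assms(1) by (auto simp: zariski_closure_def)
qed

lemma module_mult: "module ((*) :: 'a::comm_ring_1 \<Rightarrow> 'a \<Rightarrow> 'a)"
  by unfold_locales (simp_all add: algebra_simps)

lemma ideal_gen_base: "p \<in> G \<Longrightarrow> p \<in> ideal_gen G"
  and ideal_gen_0: "0 \<in> ideal_gen G"
  and ideal_gen_add: "p \<in> ideal_gen G \<Longrightarrow> q \<in> ideal_gen G \<Longrightarrow> p + q \<in> ideal_gen G"
  and ideal_gen_diff: "p \<in> ideal_gen G \<Longrightarrow> q \<in> ideal_gen G \<Longrightarrow> p - q \<in> ideal_gen G"
  and ideal_gen_mult: "p \<in> ideal_gen G \<Longrightarrow> r * p \<in> ideal_gen G"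
proof -
  show "p \<in> G \<Longrightarrow> p \<in> ideal_gen G" "0 \<in> ideal_gen G"
    "p \<in> ideal_gen G \<Longrightarrow> q \<in> ideal_gen G \<Longrightarrow> p + q \<in> ideal_gen G"
    "p \<in> ideal_gen G \<Longrightarrow> q \<in> ideal_gen G \<Longrightarrow> p - q \<in> ideal_gen G"
    "p \<in> ideal_gen G \<Longrightarrow> r * p \<in> ideal_gen G"
    by (auto simp: ideal_gen_def intro: module.span_base[OF module_mult] module.span_zero[OF module_mult] module.span_add[OF module_mult] module.span_diff[OF module_mult] module.span_scale[OF module_mult])
qed

lemma ideal_gen_sum: "(\<And>i. i \<in> I \<Longrightarrow> g i \<in> ideal_gen G) \<Longrightarrow> sum g I \<in> ideal_gen G"
  by (induction I rule: infinite_finite_induct) (auto intro: ideal_gen_0 ideal_gen_add)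

lemma ideal_gen_induct [consumes 1, case_names zero add gen]:
  assumes "p \<in> ideal_gen G" "P 0" "\<And>p q. P p \<Longrightarrow> P q \<Longrightarrow> P (p + q)" "\<And>r p. p \<in> G \<Longrightarrow> P (r * p)"
  shows "P p"
proof -
  show ?thesis
    using assms(1) unfolding ideal_gen_def
    by (induction rule: module.span_induct_alt[OF module_mult, consumes 1]) (auto intro: assms)
qed

lemma ideal_gen_subset:
  assumes "G \<subseteq> ideal_gen G'"
  shows "ideal_gen G \<subseteq> ideal_gen G'"
proof
  fix p assume "p \<in> ideal_gen G"
  then show "p \<in> ideal_gen G'"
    by (induction rule: ideal_gen_induct) (use assms in \<open>auto intro: ideal_gen_0 ideal_gen_add ideal_gen_mult\<close>)
qed

lemma ideal_gen_insert:
  "p \<in> ideal_gen (insert g G) \<longleftrightarrow> (\<exists>r. p - r * g \<in> ideal_gen G)"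
proof -
  show ?thesis unfolding ideal_gen_def by (simp add: module.span_insert[OF module_mult])
qed

lemma ideal_gen_empty: "ideal_gen {} = {0}"
proof -
  show ?thesis unfolding ideal_gen_def by (simp add: module.span_empty[OF module_mult])
qed

lemma zero_locus_ideal_gen: "zero_locus bl (ideal_gen G) = zero_locus bl G"
proof -
  have "ceval x p = 0" if "\<forall>p\<in>G. ceval x p = 0" "p \<in> ideal_gen G" for x p
    using that(2) by (induction rule: ideal_gen_induct) (use that(1) in auto)
  then show ?thesis
    by (auto simp: zero_locus_def ceval_def[symmetric] intro: ideal_gen_base)
qed

section \<open>Forms of low degree\<close>

lemma all_2: "(\<forall>i::2. Q i) \<longleftrightarrow> Q 0 \<and> Q 1"
proof -
  \<comment> \<open>The library rule quantifies over 1 and 2, and in the type \<open>2\<close> the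
    numeral 2 is 0.\<close>
  have "(2::2) = 0" by simp
  then show ?thesis unfolding forall_2 by (metis (no_types))
qed

lemma two_cases: "(i::2) = 0 \<or> i = 1"
  using all_2[of "\<lambda>i. i = 0 \<or> i = 1"] by simp

lemma UNIV_2_eq: "(UNIV :: 2 set) = {0, 1}"
  using two_cases by auto

lemma sum_UNIV_2: "(\<Sum>i\<in>(UNIV::2 set). g i) = g 0 + g 1"
  by (simp add: UNIV_2_eq)

lemma ex_2: "(\<exists>i::2. Q i) \<longleftrightarrow> Q 0 \<or> Q 1"
  using all_2[of "\<lambda>i. \<not> Q i"] by blast

lemma all_param: "(\<forall>b. Q b) \<longleftrightarrow> Q Par_s \<and> Q Par_t \<and> Q Par_u"
  by (metis param.exhaust)

definition clin :: "real^4 \<Rightarrow> (4 \<Rightarrow> complex) \<Rightarrow> complex" where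
  "clin v x = (\<Sum>l\<in>UNIV. of_real (v $ l) * x l)"

definition cquad :: "real^4^4 \<Rightarrow> (4 \<Rightarrow> complex) \<Rightarrow> complex" where
  "cquad M x = (\<Sum>l\<in>UNIV. \<Sum>m\<in>UNIV. of_real (M $ l $ m) * x l * x m)"

lemma ceval_linear_form [simp]: "ceval x (linear_form v) = clin v x"
  by (simp add: linear_form_def clin_def)

lemma ceval_quadratic_form [simp]: "ceval x (quadratic_form M) = cquad M x"
  by (simp add: quadratic_form_def cquad_def)

lemma homogeneous_linear_form: "homogeneous blk3 (\<lambda>_. 1) (linear_form v)"
  unfolding linear_form_def
  by (intro homogeneous_sum homogeneous_pconst_mult) (use homogeneous_pvar[of blk3] in simp)

lemma homogeneous_quadratic_form: "homogeneous blk3 (\<lambda>_. 2) (quadratic_form M)"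
  unfolding quadratic_form_def
  by (intro homogeneous_sum homogeneous_mult'[where d = "\<lambda>_. 1" and d' = "\<lambda>_. 1"] homogeneous_pconst_mult)
    (use homogeneous_pvar[of blk3] in simp_all)

lemma mem_plane: "x \<in> plane v \<longleftrightarrow> x \<in> mpoints blk3 \<and> clin v x = 0"
  by (simp add: plane_def zero_locus_def ceval_def[symmetric])

lemma mem_quadric: "x \<in> quadric M \<longleftrightarrow> x \<in> mpoints blk3 \<and> cquad M x = 0"
  by (simp add: quadric_def zero_locus_def ceval_def[symmetric])

lemma mpoints_blk3: "x \<in> mpoints blk3 \<longleftrightarrow> x \<noteq> (\<lambda>_. 0)"
  by (auto simp: mpoints_def fun_eq_iff)

lemma mpoints_blk111:
  "x \<in> mpoints blk111 \<longleftrightarrow> (\<forall>b. x (b, 0) \<noteq> 0 \<or> x (b, 1) \<noteq> 0)"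
proof -
  have "(\<exists>v. fst v = b \<and> x v \<noteq> 0) \<longleftrightarrow> (\<exists>i. x (b, i) \<noteq> 0)" for b
    by force
  then show ?thesis by (simp add: mpoints_def ex_2)
qed

text \<open>A form is the sum of its own monomials, all of the right degree. Adding arbitrary
  monomials as in \<open>mpoly_induct\<close> would lose the degree, since terms may cancel.\<close>

lemma homogeneous_induct [consumes 1, case_names zero add single]:
  fixes p :: "('v, 'a::comm_monoid_add) mpoly"
  assumes "homogeneous bl d p" "Q 0" "\<And>p q. Q p \<Longrightarrow> Q q \<Longrightarrow> Q (p + q)"
    and single: "\<And>m c. (\<And>b. block_degree bl m b = d b) \<Longrightarrow> Q (Poly_Mapping.single m c)"
  shows "Q p"
proof -
  have "Q (\<Sum>m\<in>M. Poly_Mapping.single m (Poly_Mapping.lookup p m))" if "M \<subseteq> Poly_Mapping.keys p" for M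
    using finite_subset[OF that finite_keys] that
  proof (induction M)
    case empty
    then show ?case using assms(2) by simp
  next
    case (insert m M)
    have "Q (Poly_Mapping.single m (Poly_Mapping.lookup p m))"
      using insert.prems assms(1) by (intro single) (auto simp: homogeneous_iff)
    with insert show ?case by (simp add: assms(3))
  qed
  then show ?thesis
    using mpoly_sum_monomials[of p] by (metis order_refl)
qed

lemma multidegree_110:
  fixes p :: "(param \<times> 2, 'a::comm_semiring_1) mpoly"
  assumes "homogeneous blk111 (\<lambda>b. if b = Par_u then 0 else 1) p"
  shows "\<exists>c. p = (\<Sum>i\<in>UNIV. \<Sum>j\<in>UNIV. pconst (c i j) * pvar (Par_s, i) * pvar (Par_t, j))"
  using assms
proof (induction rule: homogeneous_induct)
  case zero
  show ?case by (rule exI[of _ "\<lambda>_ _. 0"]) simp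
next
  case (add p q)
  then obtain c d where "p = (\<Sum>i\<in>UNIV. \<Sum>j\<in>UNIV. pconst (c i j) * pvar (Par_s, i) * pvar (Par_t, j))"
    "q = (\<Sum>i\<in>UNIV. \<Sum>j\<in>UNIV. pconst (d i j) * pvar (Par_s, i) * pvar (Par_t, j))" by blast
  then show ?case
    by (intro exI[of _ "\<lambda>i j. c i j + d i j"]) (simp add: pconst_add distrib_right sum.distrib)
next
  case (single m c)
  then have "block_degree blk111 m Par_s > 0" by simp
  then obtain v m' where v: "fst v = Par_s" and m: "m = Poly_Mapping.single v 1 + m'"
    by (rule block_degree_pos_split)
  have "block_degree blk111 m' b = (if b = Par_t then 1 else 0)" for b
    using single[of b] v by (auto simp: m block_degree_add block_degree_single split: if_splits intro: param.exhaust[of b])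
  note d' = this
  then have "block_degree blk111 m' Par_t > 0" by simp
  then obtain v' m'' where v': "fst v' = Par_t" and m': "m' = Poly_Mapping.single v' 1 + m''"
    by (rule block_degree_pos_split)
  have "block_degree blk111 m'' b = 0" for b
    using d'[of b] v' by (auto simp: m' block_degree_add block_degree_single split: if_splits)
  then have "m'' = 0" by (rule block_degree_eq_0)
  obtain i j where vij: "v = (Par_s, i)" "v' = (Par_t, j)" using v v' by (cases v; cases v') auto
  have "Poly_Mapping.single m c = pconst c * pvar (Par_s, i) * pvar (Par_t, j)"
    by (simp add: m m' \<open>m'' = 0\<close> vij pconst_def pvar_def mult_single)
  also have "\<dots> = (\<Sum>i'\<in>UNIV. \<Sum>j'\<in>UNIV. pconst (if i' = i \<and> j' = j then c else 0) * pvar (Par_s, i') * pvar (Par_t, j'))"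
    using two_cases[of i] two_cases[of j] by (auto simp: sum_UNIV_2)
  finally show ?case by (intro exI[of _ "\<lambda>i' j'. if i' = i \<and> j' = j then c else 0"])
qed

lemma multidegree_001:
  fixes p :: "(param \<times> 2, 'a::comm_semiring_1) mpoly"
  assumes "homogeneous blk111 (\<lambda>b. if b = Par_u then 1 else 0) p"
  shows "\<exists>c. p = (\<Sum>i\<in>UNIV. pconst (c i) * pvar (Par_u, i))"
  using assms
proof (induction rule: homogeneous_induct)
  case zero
  show ?case by (rule exI[of _ "\<lambda>_. 0"]) simp
next
  case (add p q)
  then obtain c d where "p = (\<Sum>i\<in>UNIV. pconst (c i) * pvar (Par_u, i))"
    "q = (\<Sum>i\<in>UNIV. pconst (d i) * pvar (Par_u, i))" by blast
  then show ?case
    by (intro exI[of _ "\<lambda>i. c i + d i"]) (simp add: pconst_add distrib_right sum.distrib)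
next
  case (single m c)
  then have "block_degree blk111 m Par_u > 0" by simp
  then obtain v m' where v: "fst v = Par_u" and m: "m = Poly_Mapping.single v 1 + m'"
    by (rule block_degree_pos_split)
  have "block_degree blk111 m' b = 0" for b
    using single[of b] v by (auto simp: m block_degree_add block_degree_single split: if_splits)
  then have "m' = 0" by (rule block_degree_eq_0)
  obtain i where vi: "v = (Par_u, i)" using v by (cases v) auto
  have "Poly_Mapping.single m c = pconst c * pvar (Par_u, i)"
    by (simp add: m \<open>m' = 0\<close> vi pconst_def pvar_def mult_single)
  also have "\<dots> = (\<Sum>i'\<in>UNIV. pconst (if i' = i then c else 0) * pvar (Par_u, i'))"
    using two_cases[of i] by (auto simp: sum_UNIV_2)
  finally show ?case by (intro exI[of _ "\<lambda>i'. if i' = i then c else 0"])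
qed

lemma partial_superset:
  assumes "finite M" "Poly_Mapping.keys p \<subseteq> M"
  shows "partial v p = (\<Sum>m\<in>M. Poly_Mapping.single (m - Poly_Mapping.single v 1)
     (of_nat (Poly_Mapping.lookup m v) * Poly_Mapping.lookup p m))"
  unfolding partial_def using assms
  by (intro sum.mono_neutral_left) (auto simp: in_keys_iff)

lemma partial_add: "partial v (p + q) = partial v p + partial v q"
proof -
  let ?M = "Poly_Mapping.keys p \<union> Poly_Mapping.keys q"
  have "Poly_Mapping.keys (p + q) \<subseteq> ?M"
    by (rule keys_add)
  then show ?thesis
    by (simp add: partial_superset[of ?M] lookup_add single_add distrib_left sum.distrib)
qed

lemma partial_single: "partial v (Poly_Mapping.single m c) =
    Poly_Mapping.single (m - Poly_Mapping.single v 1) (of_nat (Poly_Mapping.lookup m v) * c)"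
  by (subst partial_superset[of "{m}"]) auto

text \<open>The coefficients are not symmetrised: a monomial x_k x_k' goes to the single entry (k,
  k'). This avoids division by two over a semiring and is the reason for the sum
  \<open>a v m + a m v\<close> in the gradient.\<close>

lemma multidegree_2:
  fixes p :: "(4, 'a::comm_semiring_1) mpoly"
  assumes "homogeneous blk3 (\<lambda>_. 2) p"
  shows "\<exists>a. (\<forall>x. peval x p = (\<Sum>l\<in>UNIV. \<Sum>m\<in>UNIV. a l m * x l * x m)) \<and>
     (\<forall>x v. peval x (partial v p) = (\<Sum>m\<in>UNIV. (a v m + a m v) * x m))"
  using assms
proof (induction rule: homogeneous_induct)
  case zero
  show ?case by (rule exI[of _ "\<lambda>_ _. 0"]) (simp add: partial_def)
next
  case (add p q)
  then obtain a b where "(\<forall>x. peval x p = (\<Sum>l\<in>UNIV. \<Sum>m\<in>UNIV. a l m * x l * x m)) \<and>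
     (\<forall>x v. peval x (partial v p) = (\<Sum>m\<in>UNIV. (a v m + a m v) * x m))"
    "(\<forall>x. peval x q = (\<Sum>l\<in>UNIV. \<Sum>m\<in>UNIV. b l m * x l * x m)) \<and>
     (\<forall>x v. peval x (partial v q) = (\<Sum>m\<in>UNIV. (b v m + b m v) * x m))" by blast
  then show ?case
    by (intro exI[of _ "\<lambda>l m. a l m + b l m"]) (simp add: partial_add sum.distrib algebra_simps)
next
  case (single m c)
  then have "block_degree blk3 m () > 0" by simp
  then obtain k m' where m: "m = Poly_Mapping.single k 1 + m'"
    by (rule block_degree_pos_split)
  have d': "block_degree blk3 m' b = 1" for b
    using single[of b] by (simp add: m block_degree_add block_degree_single)
  then have "block_degree blk3 m' () > 0" by simp
  then obtain k' m'' where m': "m' = Poly_Mapping.single k' 1 + m''"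
    by (rule block_degree_pos_split)
  have "block_degree blk3 m'' b = 0" for b
    using d'[of b] by (simp add: m' block_degree_add block_degree_single)
  then have "m'' = 0" by (rule block_degree_eq_0)
  note m = m[unfolded m' \<open>m'' = 0\<close> add_0_right]
  let ?a = "\<lambda>l n. if l = k \<and> n = k' then c else 0"
  have delta: "(\<Sum>l\<in>UNIV. \<Sum>n\<in>UNIV. ?a l n * x l * x n) = c * x k * x k'" for x
  proof -
    have "(\<Sum>n\<in>UNIV. ?a l n * x l * x n) = (if l = k then c * x k * x k' else 0)" for l
      by (cases "l = k") (simp_all add: if_distrib[of "\<lambda>z. z * _"] cong: if_cong)
    then show ?thesis by simp
  qed
  have delta2: "(\<Sum>n\<in>UNIV. (?a v n + ?a n v) * x n)
      = (if v = k then c * x k' else 0) + (if v = k' then c * x k else 0)" for x v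
  proof -
    have "(\<Sum>n\<in>UNIV. ?a v n * x n) = (if v = k then c * x k' else 0)"
      by (cases "v = k") (simp_all add: if_distrib[of "\<lambda>z. z * _"] cong: if_cong)
    moreover have "(\<Sum>n\<in>UNIV. ?a n v * x n) = (if v = k' then c * x k else 0)"
      by (cases "v = k'") (simp_all add: if_distrib[of "\<lambda>z. z * _"] cong: if_cong)
    ultimately show ?thesis by (simp add: distrib_right sum.distrib)
  qed
  show ?case
  proof (rule exI[of _ ?a], intro conjI allI)
    fix x show "peval x (Poly_Mapping.single m c) = (\<Sum>l\<in>UNIV. \<Sum>n\<in>UNIV. ?a l n * x l * x n)"
      unfolding delta by (simp add: m peval_single monom_eval_add mult.assoc)
  next
    fix x v
    \<comment> \<open>For every other \<open>v\<close> the exponent of \<open>v\<close> in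
      \<open>m\<close> is zero, so the factor from the derivative kills the term, whatever the
      truncated difference is.\<close>
    have "m - Poly_Mapping.single v 1 = (if v = k then Poly_Mapping.single k' 1 else Poly_Mapping.single k 1)"
      if "v = k \<or> v = k'"
      using that by (auto simp: m)
    then show "peval x (partial v (Poly_Mapping.single m c)) = (\<Sum>n\<in>UNIV. (?a v n + ?a n v) * x n)"
      unfolding delta2 partial_single peval_single
      by (auto simp: m lookup_add lookup_single when_def algebra_simps)
  qed
qed

text \<open>On every line through a point outside of \<open>plane m\<close> the quadratic form can only vanish on that
  plane, where it therefore vanishes to the second order.\<close>

lemma smooth_quadric_not_in_plane:
  assumes "smooth_surface 2 S" "S \<subseteq> plane m"
  shows "m = 0"
proof (rule ccontr)
  assume "m \<noteq> 0"
  obtain F :: "(4, complex) mpoly" where F: "homogeneous blk3 (\<lambda>_. 2) F"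
    "S = {x \<in> mpoints blk3. peval x F = 0}" "\<forall>x\<in>S. \<exists>l. peval x (partial l F) \<noteq> 0"
    using assms(1) by (auto simp: smooth_surface_def)
  obtain a where a: "\<And>x. peval x F = (\<Sum>l\<in>UNIV. \<Sum>m\<in>UNIV. a l m * x l * x m)"
    "\<And>x v. peval x (partial v F) = (\<Sum>m\<in>UNIV. (a v m + a m v) * x m)"
    using multidegree_2[OF F(1)] by blast
  \<comment> \<open>The polar form of \<open>F\<close>, written through the gradient so that
    smoothness can be applied to it at the end.\<close>
  define B where "B u v = (\<Sum>l\<in>UNIV. v l * peval u (partial l F))" for u v
  have B_eq: "B u v = (\<Sum>l\<in>UNIV. \<Sum>n\<in>UNIV. a l n * (u l * v n + v l * u n))" for u v
  proof -
    have "B u v = (\<Sum>l\<in>UNIV. \<Sum>n\<in>UNIV. a l n * (v l * u n)) + (\<Sum>l\<in>UNIV. \<Sum>n\<in>UNIV. a n l * (u n * v l))"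
      unfolding B_def a(2) by (simp only: sum_distrib_left distrib_right distrib_left sum.distrib ac_simps)
    also have "(\<Sum>l\<in>UNIV. \<Sum>n\<in>UNIV. a n l * (u n * v l)) = (\<Sum>l\<in>UNIV. \<Sum>n\<in>UNIV. a l n * (u l * v n))"
      by (rule sum.swap)
    finally show ?thesis by (simp only: distrib_left sum.distrib add.commute)
  qed
  have F_line: "peval (\<lambda>l. u l + t * v l) F = peval u F + t * B u v + t\<^sup>2 * peval v F" for u v t
  proof -
    have "a l n * (u l + t * v l) * (u n + t * v n) = a l n * u l * u n + t * (a l n * (u l * v n + v l * u n))
      + t\<^sup>2 * (a l n * v l * v n)" for l n
      by (simp add: algebra_simps power2_eq_square)
    then have "peval (\<lambda>l. u l + t * v l) F = (\<Sum>l\<in>UNIV. \<Sum>n\<in>UNIV. a l n * u l * u n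
      + t * (a l n * (u l * v n + v l * u n)) + t\<^sup>2 * (a l n * v l * v n))"
      unfolding a(1) by presburger
    also have "\<dots> = peval u F + t * B u v + t\<^sup>2 * peval v F"
      unfolding a(1) B_eq sum_distrib_left sum.distrib ..
    finally show ?thesis .
  qed
  have in_plane: "clin m x = 0" if "peval x F = 0" for x
  proof (cases "x \<in> mpoints blk3")
    case True
    with that F(2) assms(2) show ?thesis by (auto simp: mem_plane)
  next
    case False
    then have "x = (\<lambda>_. 0)" by (simp add: mpoints_blk3)
    then show ?thesis by (simp add: clin_def)
  qed
  \<comment> \<open>As \<open>m\<close> is real and nonzero, its scalar product with itself is
    positive: \<open>m\<close>, read as a point, lies off its own plane.\<close>
  define v where "v l = complex_of_real (m $ l)" for l
  define N where "N = (\<Sum>l\<in>UNIV. (m $ l)\<^sup>2)"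
  have "N = norm m ^ 2"
    by (simp add: N_def norm_vec_def L2_set_def sum_nonneg)
  then have "N \<noteq> 0" using \<open>m \<noteq> 0\<close> by simp
  have clin_v: "clin m v = of_real N"
    by (simp add: clin_def v_def N_def power2_eq_square)
  have clin_line: "clin m (\<lambda>l. u l + t * v l) = clin m u + t * of_real N" for u t
    unfolding clin_v[symmetric] clin_def
    by (simp add: sum.distrib sum_distrib_left distrib_left mult_ac)
  define c where "c = peval v F"
  have "c \<noteq> 0" using in_plane[of v] clin_v \<open>N \<noteq> 0\<close> by (auto simp: c_def)
  have B_v: "B u v = 0 \<and> peval u F = 0" if u: "clin m u = 0" for u
  proof -
    \<comment> \<open>\<open>r\<close> is a root of the discriminant of F(u + t v) as a quadratic
      polynomial in t. Both of its roots give zeros of \<open>F\<close>, hence points of the plane,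
      so both roots are 0 and the two lower coefficients vanish.\<close>
    define r where "r = csqrt ((B u v)\<^sup>2 - 4 * c * peval u F)"
    have root: "t = 0" if "t = (- B u v + r) / (2 * c) \<or> t = (- B u v - r) / (2 * c)" for t
    proof -
      have "2 * c * t = - B u v + r \<or> 2 * c * t = - B u v - r"
        using that \<open>c \<noteq> 0\<close> by auto
      then have "2 * c * t + B u v = r \<or> 2 * c * t + B u v = - r"
        by (elim disjE) (rule disjI1, algebra, rule disjI2, algebra)
      then have "(2 * c * t + B u v)\<^sup>2 = r\<^sup>2" by (simp add: power2_eq_iff)
      also have "r\<^sup>2 = (B u v)\<^sup>2 - 4 * c * peval u F"
        by (simp add: r_def)
      finally have "4 * c * (peval u F + t * B u v + t\<^sup>2 * c) = 0"
        by (simp add: algebra_simps power2_eq_square)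
      then have "peval (\<lambda>l. u l + t * v l) F = 0"
        using \<open>c \<noteq> 0\<close> by (simp add: F_line c_def)
      then show ?thesis
        using in_plane clin_line[of u t] u \<open>N \<noteq> 0\<close> by auto
    qed
    have "- B u v + r = 0" "- B u v - r = 0"
      using root[of "(- B u v + r) / (2 * c)"] root[of "(- B u v - r) / (2 * c)"] \<open>c \<noteq> 0\<close> by auto
    then have "B u v = 0" "r = 0" by (auto simp: eq_neg_iff_add_eq_0)
    then have "4 * c * peval u F = 0" by (simp add: r_def)
    with \<open>B u v = 0\<close> \<open>c \<noteq> 0\<close> show ?thesis by simp
  qed
  obtain u where u: "u \<noteq> (\<lambda>_. 0)" "clin m u = 0"
  proof (cases "m $ 0 = 0")
    case True
    let ?u = "\<lambda>l::4. if l = 0 then 1 else 0 :: complex"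
    have "?u 0 \<noteq> 0" by simp
    then have "?u \<noteq> (\<lambda>_. 0)" by metis
    moreover have "clin m ?u = 0" using True
      by (simp add: clin_def mult_delta_right)
    ultimately show ?thesis by (rule that)
  next
    case False
    let ?u = "\<lambda>l::4. (if l = 0 then of_real (m $ 1) else 0) + (if l = 1 then - of_real (m $ 0) else 0 :: complex)"
    have "?u 1 \<noteq> 0" using False by simp
    then have "?u \<noteq> (\<lambda>_. 0)" using fun_cong[of ?u "\<lambda>_. 0" 1] by blast
    moreover have "clin m ?u = 0"
      by (simp add: clin_def distrib_left sum.distrib mult_delta_right)
    ultimately show ?thesis by (rule that)
  qed
  have "u \<in> S" using u B_v[OF u(2)] by (simp add: F(2) mpoints_blk3)
  then obtain k where k: "peval u (partial k F) \<noteq> 0" using F(3) by blast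
  \<comment> \<open>\<open>e\<close> is the k-th unit vector projected to the plane along
    \<open>v\<close>. Since \<open>F\<close> vanishes on the whole plane, \<open>B u e\<close> is 0;
    together with \<open>B u v = 0\<close> this makes the k-th partial derivative vanish at
    \<open>u\<close>.\<close>
  define t where "t = complex_of_real (m $ k / N)"
  define e where "e l = (if l = k then 1 else 0 :: complex) + (- t) * v l" for l
  have "clin m (\<lambda>l. if l = k then 1 else 0) = of_real (m $ k)"
    by (simp add: clin_def mult_delta_right)
  then have e: "clin m e = 0"
    unfolding e_def clin_line using \<open>N \<noteq> 0\<close> by (simp add: t_def)
  have "clin m (\<lambda>l. u l + 1 * e l) = 0"
    using u(2) e unfolding clin_def by (simp add: distrib_left sum.distrib)
  then have "B u e = 0"
    using F_line[of u 1 e] B_v[of "\<lambda>l. u l + 1 * e l"] B_v[OF u(2)] B_v[OF e] by simp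
  moreover have "B u e = peval u (partial k F) - t * B u v"
    unfolding B_def e_def
  proof -
    have "((if l = k then 1 else 0) + - t * v l) * peval u (partial l F) =
        (if l = k then peval u (partial l F) else 0) - t * (v l * peval u (partial l F))" for l
      by (simp add: algebra_simps)
    then show "(\<Sum>l\<in>UNIV. ((if l = k then 1 else 0) + - t * v l) * peval u (partial l F)) =
        peval u (partial k F) - t * (\<Sum>l\<in>UNIV. v l * peval u (partial l F))"
      by (simp add: sum_subtractf sum_distrib_left)
  qed
  ultimately show False using k B_v[OF u(2)] by simp
qed

lemma irrelevant_mult:
  assumes "g \<in> ideal_gen {pvar v | v. bl v = b}" "\<And>v. bl v = b \<Longrightarrow> pvar v * r \<in> ideal_gen G"
  shows "g * r \<in> ideal_gen G"
  using assms(1)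
proof (induction rule: ideal_gen_induct)
  case (gen c p)
  then obtain v where "p = pvar v" "bl v = b" by blast
  then have "c * (p * r) \<in> ideal_gen G" using assms(2) ideal_gen_mult by blast
  then show ?case by (simp only: mult.assoc)
qed (auto simp: distrib_right intro: ideal_gen_0 ideal_gen_add)

text \<open>An element \<open>g\<close> of the irrelevant ideal lies in the ideals of all three
  blocks, so its cube is a combination of the products s_i t_j u_k. Three further powers of
  \<open>g\<close> therefore carry \<open>J\<close> into the ideal.\<close>

lemma same_subscheme_if_trilinear_multiples:
  fixes J :: "(param \<times> 2, 'a::comm_ring_1) mpoly set"
  assumes "ideal_gen G \<subseteq> J"
    and J: "\<And>p i j k. p \<in> J \<Longrightarrow> pvar (Par_s, i) * pvar (Par_t, j) * pvar (Par_u, k) * p \<in> ideal_gen G"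
  shows "same_subscheme blk111 (ideal_gen G) J"
  unfolding same_subscheme_def
proof
  show "saturation blk111 (ideal_gen G) \<subseteq> saturation blk111 J"
    using assms(1) by (fastforce simp: saturation_def)
  show "saturation blk111 J \<subseteq> saturation blk111 (ideal_gen G)"
    unfolding saturation_def
  proof (safe)
    fix p g :: "(param \<times> 2, 'a) mpoly" assume *: "\<forall>g\<in>irrelevant_ideal blk111. \<exists>n. g ^ n * p \<in> J"
      and g: "g \<in> irrelevant_ideal blk111"
    then obtain n where n: "g ^ n * p \<in> J" by blast
    have gb: "g \<in> ideal_gen {pvar v |v. fst v = b}" for b
      using g by (auto simp: irrelevant_ideal_def)
    have "g * (g * (g * (g ^ n * p))) \<in> ideal_gen G"
    proof (rule irrelevant_mult[OF gb[of Par_s]])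
      fix v :: "param \<times> 2" assume v: "fst v = Par_s"
      have "g * (g * (pvar v * (g ^ n * p))) \<in> ideal_gen G"
      proof (rule irrelevant_mult[OF gb[of Par_t]])
        fix v' :: "param \<times> 2" assume v': "fst v' = Par_t"
        have "g * (pvar v' * (pvar v * (g ^ n * p))) \<in> ideal_gen G"
        proof (rule irrelevant_mult[OF gb[of Par_u]])
          fix v'' :: "param \<times> 2" assume v'': "fst v'' = Par_u"
          obtain i j k where "v = (Par_s, i)" "v' = (Par_t, j)" "v'' = (Par_u, k)"
            using v v' v'' by (metis prod.collapse)
          then show "pvar v'' * (pvar v' * (pvar v * (g ^ n * p))) \<in> ideal_gen G"
            using J[OF n, of i j k] by (simp only: mult_ac)
        qed
        then show "pvar v' * (g * (pvar v * (g ^ n * p))) \<in> ideal_gen G" by (simp only: mult_ac)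
      qed
      then show "pvar v * (g * (g * (g ^ n * p))) \<in> ideal_gen G" by (simp only: mult_ac)
    qed
    then have "g ^ (n + 3) * p \<in> ideal_gen G"
      by (simp only: power_add power3_eq_cube mult_ac)
    then show "\<exists>n. g ^ n * p \<in> ideal_gen G" by blast
  qed
qed

section \<open>Limits along curves\<close>

lemma eventually_linear_neq_0:
  fixes a b :: complex
  assumes "b \<noteq> 0"
  shows "eventually (\<lambda>t. a + t * b \<noteq> 0) (at 0)"
proof -
  have "eventually (\<lambda>t. t \<noteq> - a / b) (at 0)"
    by (rule eventually_neq_at_within)
  then show ?thesis
    by eventually_elim (use assms in \<open>auto simp: field_simps add_eq_0_iff\<close>)
qed

lemma eventually_quadratic_neq_0:
  fixes a b c :: complex
  assumes "c \<noteq> 0"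
  shows "eventually (\<lambda>t. a + t * b + t\<^sup>2 * c \<noteq> 0) (at 0)"
proof -
  define r where "r = csqrt (b\<^sup>2 - 4 * a * c)"
  have r: "r\<^sup>2 = b\<^sup>2 - 4 * a * c" by (simp add: r_def)
  have "eventually (\<lambda>t. (b - r) + t * (2 * c) \<noteq> 0 \<and> (b + r) + t * (2 * c) \<noteq> 0) (at 0)"
    using assms by (intro eventually_conj eventually_linear_neq_0) auto
  then show ?thesis
  proof eventually_elim
    case (elim t)
    have "4 * c * (a + t * b + t\<^sup>2 * c) = ((b - r) + t * (2 * c)) * ((b + r) + t * (2 * c))"
      using r by algebra
    also have "\<dots> \<noteq> 0" using elim by simp
    finally show ?case by auto
  qed
qed

lemma eventually_mpoints_blk111:
  assumes "x \<in> mpoints blk111" "\<And>v. ((\<lambda>t. g t v) \<longlongrightarrow> x v) F"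
  shows "eventually (\<lambda>t. g t \<in> mpoints blk111) F"
proof -
  have "eventually (\<lambda>t. g t (b, 0) \<noteq> 0 \<or> g t (b, 1) \<noteq> 0) F" for b
  proof -
    from assms(1) obtain i where "x (b, i) \<noteq> 0" "i = 0 \<or> i = 1" by (auto simp: mpoints_blk111)
    then show ?thesis using tendsto_imp_eventually_ne[OF assms(2), of "(b, i)" 0]
      by (auto elim!: eventually_mono)
  qed
  then show ?thesis
    by (simp add: mpoints_blk111 all_param eventually_conj_iff)
qed

lemma mpoints_sum:
  "case_sum x y \<in> mpoints (map_sum bl bl') \<longleftrightarrow> x \<in> mpoints bl \<and> y \<in> mpoints bl'"
proof -
  have "(\<forall>b. \<exists>v. map_sum bl bl' v = b \<and> case_sum x y v \<noteq> 0) \<longleftrightarrow>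
      (\<forall>b. \<exists>v. map_sum bl bl' v = Inl b \<and> case_sum x y v \<noteq> 0) \<and>
      (\<forall>b. \<exists>v. map_sum bl bl' v = Inr b \<and> case_sum x y v \<noteq> 0)"
    by (metis sum.exhaust)
  then show ?thesis by (simp add: mpoints_def split_sum_ex)
qed

text \<open>At a base point F(g t) tends to 0, so its projective limit is read off from F(g t) / t;
  the graph contains all multiples of a value. That \<open>y\<close> is nonzero keeps
  \<open>g t\<close> in the domain of the map for small t.\<close>

lemma graph_closure_limit:
  fixes F :: "4 \<Rightarrow> ring_R"
  assumes "x \<in> mpoints blk111" "y \<in> mpoints blk3"
    and g: "\<And>v. ((\<lambda>t. g t v) \<longlongrightarrow> x v) (at 0)"
    and y: "\<And>l. ((\<lambda>t. mapply F (g t) l / t) \<longlongrightarrow> y l) (at 0)"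
  shows "case_sum x y \<in> zariski_closure (map_sum blk111 blk3) (graph blk111 blk3 F)"
proof (rule zariski_closure_limit)
  show "case_sum x y \<in> mpoints (map_sum blk111 blk3)"
    using assms by (simp add: mpoints_sum)
  show "((\<lambda>t. case_sum (g t) (\<lambda>l. mapply F (g t) l / t) v) \<longlongrightarrow> case_sum x y v) (at 0)" for v
    using g y by (cases v) auto
  obtain l where "y l \<noteq> 0" using assms(2) by (auto simp: mpoints_def)
  then have "eventually (\<lambda>t. mapply F (g t) l / t \<noteq> 0) (at 0)"
    using y tendsto_imp_eventually_ne by blast
  with eventually_mpoints_blk111[OF assms(1) g]
  show "eventually (\<lambda>t. case_sum (g t) (\<lambda>l. mapply F (g t) l / t) \<in> graph blk111 blk3 F) (at 0)"
  proof eventually_elim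
    case (elim t)
    then have "t \<noteq> 0" by auto
    have "mapply F (g t) \<in> mpoints blk3" using elim by (auto simp: mpoints_def)
    moreover have "same_point blk3 (mapply F (g t)) (\<lambda>l. mapply F (g t) l / t)"
      using \<open>t \<noteq> 0\<close> unfolding same_point_def by (intro exI[of _ "\<lambda>_. 1 / t"]) auto
    ultimately show ?case using elim(1) unfolding graph_def by blast
  qed
qed

text \<open>A representative \<open>G\<close> with a value at \<open>x\<close> is proportional to
  \<open>F\<close> along both curves. In the limit that value would be proportional to
  \<open>y\<close> and to \<open>y'\<close>.\<close>

lemma base_locus_if_two_directions:
  fixes F :: "4 \<Rightarrow> ring_R"
  assumes x: "x \<in> mpoints blk111"
    and g: "\<And>v. ((\<lambda>t. g t v) \<longlongrightarrow> x v) (at 0)" "\<And>l. ((\<lambda>t. mapply F (g t) l / t) \<longlongrightarrow> y l) (at 0)"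
    and g': "\<And>v. ((\<lambda>t. g' t v) \<longlongrightarrow> x v) (at 0)" "\<And>l. ((\<lambda>t. mapply F (g' t) l / t) \<longlongrightarrow> y' l) (at 0)"
    and indep: "\<exists>l m. y l * y' m \<noteq> y m * y' l"
  shows "x \<in> base_locus blk111 blk3 F"
proof -
  have "False" if G: "\<forall>w w'. cpx (F w) * G w' = cpx (F w') * G w"
    and nz: "(\<lambda>w. peval x (G w)) \<in> mpoints blk3" for G :: "4 \<Rightarrow> (param \<times> 2, complex) mpoly"
  proof -
    have proportional: "y w * peval x (G w') = y w' * peval x (G w)"
      if "\<And>v. ((\<lambda>t. g t v) \<longlongrightarrow> x v) (at 0)" "\<And>l. ((\<lambda>t. mapply F (g t) l / t) \<longlongrightarrow> y l) (at 0)"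
      for y g w w'
    proof -
      have lim: "((\<lambda>t. mapply F (g t) w / t * peval (g t) (G w')) \<longlongrightarrow> y w * peval x (G w')) (at 0)" for w w'
        by (intro tendsto_mult that tendsto_peval)
      have eq: "mapply F (g t) w * peval (g t) (G w') = mapply F (g t) w' * peval (g t) (G w)" for t
        unfolding mapply_def using arg_cong[OF G[rule_format, of w w'], of "peval (g t)"] by simp
      show ?thesis
        using lim[of w w'] lim[of w' w] unfolding times_divide_eq_left eq
        by (rule tendsto_unique[OF trivial_limit_at])
    qed
    obtain z where z: "peval x (G z) \<noteq> 0" using nz by (auto simp: mpoints_def)
    obtain l m where "y l * y' m \<noteq> y m * y' l" using indep by blast
    moreover have "y l * y' m * (peval x (G z))\<^sup>2 = y m * y' l * (peval x (G z))\<^sup>2"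
      using proportional[OF g, of l z] proportional[OF g, of m z] proportional[OF g', of l z] proportional[OF g', of m z]
      by (simp add: power2_eq_square) algebra
    ultimately show False using z by simp
  qed
  then show ?thesis using x unfolding base_locus_def by blast
qed

section \<open>The normal form\<close>

text \<open>The ring is left open because the sign occurs among reals, complex numbers and
  polynomials.\<close>

definition sg :: "2 \<Rightarrow> 2 \<Rightarrow> 'c::ring_1" where "sg i j = (if i = j then 1 else - 1)"

lemma sg_simps [simp]: "sg 0 0 = 1" "sg 0 1 = - 1" "sg 1 0 = - 1" "sg 1 1 = 1"
  by (simp_all add: sg_def)

text \<open>Dual bases indexed by pairs identify the space with 2 x 2 matrices. The matrices of rank
  one then form a Segre quadric, the zero set of the determinant \<open>q0\<close>.\<close>

locale frame =
  fixes e X :: "2 \<Rightarrow> 2 \<Rightarrow> real^4"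
  assumes dual: "X i j \<bullet> e i' j' = (if i = i' \<and> j = j' then 1 else 0)"
    and basis: "v = (\<Sum>i\<in>UNIV. \<Sum>j\<in>UNIV. (X i j \<bullet> v) *\<^sub>R e i j)"
begin

definition crd :: "2 \<Rightarrow> 2 \<Rightarrow> (4 \<Rightarrow> complex) \<Rightarrow> complex" where "crd i j y = clin (X i j) y"

definition pnt :: "(2 \<Rightarrow> 2 \<Rightarrow> complex) \<Rightarrow> 4 \<Rightarrow> complex" where
  "pnt N l = (\<Sum>i\<in>UNIV. \<Sum>j\<in>UNIV. N i j * of_real (e i j $ l))"

lemma crd_pnt [simp]: "crd i j (pnt N) = N i j"
proof -
  have "crd i j (pnt N) = (\<Sum>i'\<in>UNIV. \<Sum>j'\<in>UNIV. N i' j' * of_real (X i j \<bullet> e i' j'))"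
    by (simp add: crd_def clin_def pnt_def sum_UNIV_2 inner_vec_def distrib_left sum.distrib
        sum_distrib_left mult_ac)
  then show ?thesis
    using two_cases[of i] two_cases[of j] by (auto simp: sum_UNIV_2 dual)
qed

lemma pnt_crd [simp]: "pnt (\<lambda>i j. crd i j y) = y"
proof
  fix l
  have ax: "(\<Sum>i\<in>UNIV. \<Sum>j\<in>UNIV. X i j $ m * e i j $ l) = (if l = m then 1 else 0)" for m
  proof -
    have "axis m 1 $ l = (\<Sum>i\<in>UNIV. \<Sum>j\<in>UNIV. (X i j \<bullet> axis m 1) *\<^sub>R e i j) $ l"
      using basis[of "axis m 1"] by (rule arg_cong)
    also have "\<dots> = (\<Sum>i\<in>UNIV. \<Sum>j\<in>UNIV. X i j $ m * e i j $ l)"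
      by (simp add: inner_axis)
    finally show ?thesis by (simp add: axis_def)
  qed
  have "pnt (\<lambda>i j. crd i j y) l = (\<Sum>m\<in>UNIV. of_real (\<Sum>i\<in>UNIV. \<Sum>j\<in>UNIV. X i j $ m * e i j $ l) * y m)"
    by (simp add: crd_def clin_def pnt_def sum_UNIV_2 distrib_right distrib_left sum.distrib
        sum_distrib_left mult_ac)
  also have "\<dots> = y l"
    unfolding ax by (simp add: mult_delta_left if_distrib[of complex_of_real] cong: if_cong)
  finally show "pnt (\<lambda>i j. crd i j y) l = y l" .
qed

lemma crd_scale [simp]: "crd i j (\<lambda>l. c * y l) = c * crd i j y"
  by (simp add: crd_def clin_def sum_distrib_left mult_ac)

lemma crd_eqI: "(\<And>i j. crd i j y = crd i j z) \<Longrightarrow> y = z"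
  using pnt_crd[of y] pnt_crd[of z] by (metis (no_types, lifting) ext)

lemma crd_zero [simp]: "crd i j (\<lambda>_. 0) = 0"
  by (simp add: crd_def clin_def)

lemma mpoints_crd: "y \<in> mpoints blk3 \<longleftrightarrow> (\<exists>i j. crd i j y \<noteq> 0)"
  unfolding mpoints_blk3 by (metis crd_eqI crd_zero)

lemma vec_eq_dual: "v = (\<Sum>i\<in>UNIV. \<Sum>j\<in>UNIV. (v \<bullet> e i j) *\<^sub>R X i j)"
proof -
  have "v \<bullet> u = (\<Sum>i\<in>UNIV. \<Sum>j\<in>UNIV. (v \<bullet> e i j) *\<^sub>R X i j) \<bullet> u" for u
  proof -
    have "v \<bullet> u = v \<bullet> (\<Sum>i\<in>UNIV. \<Sum>j\<in>UNIV. (X i j \<bullet> u) *\<^sub>R e i j)" using basis[of u] by simp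
    then show ?thesis by (simp add: inner_sum_right inner_sum_left mult.commute)
  qed
  then have all: "\<forall>u. v \<bullet> u = (\<Sum>i\<in>UNIV. \<Sum>j\<in>UNIV. (v \<bullet> e i j) *\<^sub>R X i j) \<bullet> u" ..
  from iffD1[OF vector_eq_rdot all] show ?thesis .
qed

definition q0 :: "(4 \<Rightarrow> complex) \<Rightarrow> complex" where "q0 y = crd 0 0 y * crd 1 1 y - crd 0 1 y * crd 1 0 y"
definition p0 :: "(4 \<Rightarrow> complex) \<Rightarrow> complex" where "p0 y = crd 0 0 y + crd 1 1 y - crd 0 1 y - crd 1 0 y"

end

text \<open>The vectors \<open>e i j\<close> are multiples of the control points \<open>P i j 0\<close> whose sum is the apex \<open>A\<close>, and
  \<open>P i j 1\<close> is proportional to \<open>e i j - k i j A\<close>.\<close>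

locale pyramid_frame = frame +
  fixes k :: "2 \<Rightarrow> 2 \<Rightarrow> real" and \<alpha> \<beta> \<gamma> :: "real^2"
  assumes \<alpha>_nz: "\<alpha> $ i \<noteq> 0" and \<beta>_nz: "\<beta> $ i \<noteq> 0" and \<gamma>_nz: "\<gamma> $ i \<noteq> 0"
    and k_nz: "k i j \<noteq> 0"
    and K_neq_1: "k 0 0 + k 0 1 + k 1 0 + k 1 1 \<noteq> 1"
begin

abbreviation kc :: "2 \<Rightarrow> 2 \<Rightarrow> complex" where "kc i j \<equiv> complex_of_real (k i j)"

abbreviation Kr :: real where "Kr \<equiv> k 0 0 + k 0 1 + k 1 0 + k 1 1"

definition K :: complex where "K = kc 0 0 + kc 0 1 + kc 1 0 + kc 1 1"

text \<open>The covector with value \<open>k i j\<close> at \<open>e i j\<close>, that is, the real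
  covector of the form \<open>kk\<close>.\<close>

definition kvec :: "real^4" where
  "kvec = k 0 0 *\<^sub>R X 0 0 + k 0 1 *\<^sub>R X 0 1 + k 1 0 *\<^sub>R X 1 0 + k 1 1 *\<^sub>R X 1 1"

text \<open>The parameters are rescaled to absorb \<open>\<alpha>\<close>, \<open>\<beta>\<close> and \<open>\<gamma>\<close>.\<close>

definition SS :: "(param \<times> 2 \<Rightarrow> complex) \<Rightarrow> 2 \<Rightarrow> complex" where "SS x i = of_real (\<alpha> $ i) * x (Par_s, i)"
definition TT :: "(param \<times> 2 \<Rightarrow> complex) \<Rightarrow> 2 \<Rightarrow> complex" where "TT x i = of_real (\<beta> $ i) * x (Par_t, i)"
definition UU :: "(param \<times> 2 \<Rightarrow> complex) \<Rightarrow> 2 \<Rightarrow> complex" where "UU x i = of_real (\<gamma> $ i) * x (Par_u, i)"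

definition cpt :: "(2 \<Rightarrow> complex) \<Rightarrow> (2 \<Rightarrow> complex) \<Rightarrow> (2 \<Rightarrow> complex) \<Rightarrow> param \<times> 2 \<Rightarrow> complex" where
  "cpt S T U = (\<lambda>(b, i). case b of Par_s \<Rightarrow> S i / of_real (\<alpha> $ i) | Par_t \<Rightarrow> T i / of_real (\<beta> $ i)
     | Par_u \<Rightarrow> U i / of_real (\<gamma> $ i))"

lemma SS_cpt [simp]: "SS (cpt S T U) = S" and TT_cpt [simp]: "TT (cpt S T U) = T"
  and UU_cpt [simp]: "UU (cpt S T U) = U"
  by (auto simp: SS_def TT_def UU_def cpt_def \<alpha>_nz \<beta>_nz \<gamma>_nz)

lemma cpt_SS [simp]: "cpt (SS x) (TT x) (UU x) = x"
  by (auto simp: SS_def TT_def UU_def cpt_def \<alpha>_nz \<beta>_nz \<gamma>_nz fun_eq_iff split: param.split)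

lemma mpoints_SS: "x \<in> mpoints blk111 \<longleftrightarrow>
    (SS x 0 \<noteq> 0 \<or> SS x 1 \<noteq> 0) \<and> (TT x 0 \<noteq> 0 \<or> TT x 1 \<noteq> 0) \<and> (UU x 0 \<noteq> 0 \<or> UU x 1 \<noteq> 0)"
  by (auto simp: mpoints_blk111 all_param SS_def TT_def UU_def \<alpha>_nz \<beta>_nz \<gamma>_nz)

lemma tendsto_cpt:
  assumes "\<And>i. ((\<lambda>t. S t i) \<longlongrightarrow> S' i) F" "\<And>i. ((\<lambda>t. T t i) \<longlongrightarrow> T' i) F" "\<And>i. ((\<lambda>t. U t i) \<longlongrightarrow> U' i) F"
  shows "((\<lambda>t. cpt (S t) (T t) (U t) v) \<longlongrightarrow> cpt S' T' U' v) F"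
  using assms by (cases v; cases "fst v") (auto simp: cpt_def \<alpha>_nz \<beta>_nz \<gamma>_nz intro!: tendsto_divide tendsto_const)

lemma of_real_K: "of_real (1 - Kr) = 1 - K" by (simp add: K_def)

lemma one_minus_K_nz: "1 - K \<noteq> 0"
  unfolding of_real_K[symmetric] of_real_eq_0_iff using K_neq_1 by simp

definition LL :: "(2 \<Rightarrow> complex) \<Rightarrow> (2 \<Rightarrow> complex) \<Rightarrow> complex" where
  "LL S T = kc 0 0 * S 0 * T 0 - kc 0 1 * S 0 * T 1 - kc 1 0 * S 1 * T 0 + kc 1 1 * S 1 * T 1"

definition FF :: "(2 \<Rightarrow> complex) \<Rightarrow> (2 \<Rightarrow> complex) \<Rightarrow> (2 \<Rightarrow> complex) \<Rightarrow> 2 \<Rightarrow> 2 \<Rightarrow> complex" where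
  "FF S T U i j = sg i j * S i * T j * (U 0 + U 1) - U 1 * LL S T"

text \<open>In the coordinates \<open>crd\<close>, the forms \<open>p0\<close>, \<open>kk\<close>, \<open>q0\<close>, \<open>q1\<close> and \<open>qc\<close> define \<open>\<Pi>\<^sub>0\<close>, \<open>\<Pi>\<^sub>1\<close>, \<open>Y\<^sub>0\<close>, \<open>Y\<^sub>1\<close> and
  the cone \<open>Q\<close>, and \<open>(S', T', U')\<close> is the inverse of \<open>FF\<close>.\<close>

definition kk :: "(4 \<Rightarrow> complex) \<Rightarrow> complex" where
  "kk y = kc 0 0 * crd 0 0 y + kc 0 1 * crd 0 1 y + kc 1 0 * crd 1 0 y + kc 1 1 * crd 1 1 y"
definition q1 :: "(4 \<Rightarrow> complex) \<Rightarrow> complex" where "q1 y = (1 - K) * q0 y + kk y * p0 y"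
definition qc :: "(4 \<Rightarrow> complex) \<Rightarrow> complex" where "qc y = K * q0 y - kk y * p0 y"

definition S' :: "(4 \<Rightarrow> complex) \<Rightarrow> 2 \<Rightarrow> complex" where
  "S' y i = (if i = 0 then crd 0 0 y - crd 0 1 y else crd 1 1 y - crd 1 0 y)"
definition T' :: "(4 \<Rightarrow> complex) \<Rightarrow> 2 \<Rightarrow> complex" where
  "T' y i = (if i = 0 then crd 0 0 y - crd 1 0 y else crd 1 1 y - crd 0 1 y)"
definition U' :: "(4 \<Rightarrow> complex) \<Rightarrow> 2 \<Rightarrow> complex" where
  "U' y i = (if i = 0 then - q1 y else q0 y)"

lemma S'_FF: "S' (pnt (FF S T U)) i = (T 0 + T 1) * (U 0 + U 1) * S i"
  using two_cases[of i] by (auto simp: S'_def FF_def algebra_simps)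

lemma T'_FF: "T' (pnt (FF S T U)) i = (S 0 + S 1) * (U 0 + U 1) * T i"
  using two_cases[of i] by (auto simp: T'_def FF_def algebra_simps)

lemma p0_FF: "p0 (pnt (FF S T U)) = (S 0 + S 1) * (T 0 + T 1) * (U 0 + U 1)"
  by (simp add: p0_def FF_def algebra_simps)

lemma kk_FF: "kk (pnt (FF S T U)) = LL S T * (U 0 + U 1 - K * U 1)"
  by (simp add: kk_def FF_def LL_def K_def algebra_simps)

text \<open>The coordinates form a rank one matrix N minus the constant c = U_1 L in every entry,
  and det(N - c) = det N - c p0(N) with det N = 0.\<close>

lemma q0_FF: "q0 (pnt (FF S T U)) = - (U 0 + U 1) * (S 0 + S 1) * (T 0 + T 1) * LL S T * U 1"
  unfolding q0_def crd_pnt FF_def sg_simps by algebra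

lemma q1_FF: "q1 (pnt (FF S T U)) = (U 0 + U 1) * (S 0 + S 1) * (T 0 + T 1) * LL S T * U 0"
  unfolding q1_def p0_FF kk_FF q0_FF by algebra

text \<open>With signs, \<open>S'\<close> times \<open>T'\<close> gives p0 X_ij - q0, while the two
  components of \<open>U'\<close> add up to qc and L takes the value - qc. The terms q0 qc cancel
  and the common factor qc p0 remains.\<close>

lemma FF_inverse: "FF (S' y) (T' y) (U' y) i j = qc y * p0 y * crd i j y"
proof -
  define a b c d where "a = crd 0 0 y" "b = crd 0 1 y" "c = crd 1 0 y" "d = crd 1 1 y"
  note abcd = this
  have L: "LL (S' y) (T' y) = - qc y"
    unfolding LL_def S'_def T'_def qc_def q0_def kk_def p0_def K_def abcd[symmetric] by simp algebra
  have "U' y 0 + U' y 1 = qc y" by (simp add: U'_def q1_def qc_def algebra_simps)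
  moreover have "sg i j * S' y i * T' y j = p0 y * crd i j y - q0 y"
    using two_cases[of i] two_cases[of j]
    by (auto simp: S'_def T'_def p0_def q0_def algebra_simps)
  moreover have "U' y 1 = q0 y" by (simp add: U'_def)
  ultimately show ?thesis unfolding FF_def L by (simp only: ring_distribs) (simp add: mult_ac)
qed

lemma LL_S'_T': "LL (S' y) (T' y) = - qc y"
  unfolding LL_def S'_def T'_def qc_def q0_def kk_def p0_def K_def by simp algebra

lemma FF_scale: "FF (\<lambda>i. a * S i) (\<lambda>i. b * T i) (\<lambda>i. c * U i) i j = a * b * c * FF S T U i j"
  by (simp add: FF_def LL_def algebra_simps)

lemma pnt_scale: "pnt (\<lambda>i j. c * N i j) = (\<lambda>l. c * pnt N l)"
  by (auto simp: pnt_def sum_distrib_left mult_ac)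

definition Sp :: "2 \<Rightarrow> ring_R" where "Sp i = pconst (\<alpha> $ i) * pvar (Par_s, i)"
definition Tp :: "2 \<Rightarrow> ring_R" where "Tp i = pconst (\<beta> $ i) * pvar (Par_t, i)"
definition Up :: "2 \<Rightarrow> ring_R" where "Up i = pconst (\<gamma> $ i) * pvar (Par_u, i)"
definition Lp :: ring_R where
  "Lp = pconst (k 0 0) * Sp 0 * Tp 0 - pconst (k 0 1) * Sp 0 * Tp 1
      - pconst (k 1 0) * Sp 1 * Tp 0 + pconst (k 1 1) * Sp 1 * Tp 1"
definition Fp :: "2 \<Rightarrow> 2 \<Rightarrow> ring_R" where
  "Fp i j = sg i j * Sp i * Tp j * (Up 0 + Up 1) - Up 1 * Lp"
definition fp :: "4 \<Rightarrow> ring_R" where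
  "fp l = (\<Sum>i\<in>UNIV. \<Sum>j\<in>UNIV. pconst (e i j $ l) * Fp i j)"

lemma ceval_Sp [simp]: "ceval x (Sp i) = SS x i" and ceval_Tp [simp]: "ceval x (Tp i) = TT x i"
  and ceval_Up [simp]: "ceval x (Up i) = UU x i"
  by (simp_all add: Sp_def Tp_def Up_def SS_def TT_def UU_def)

lemma ceval_Lp [simp]: "ceval x Lp = LL (SS x) (TT x)"
  by (simp add: Lp_def LL_def)

lemma ceval_Fp [simp]: "ceval x (Fp i j) = FF (SS x) (TT x) (UU x) i j"
proof -
  have "ceval x 1 = 1" by (metis ceval_pconst of_real_1 pconst_1)
  then show ?thesis by (simp add: Fp_def FF_def sg_def)
qed

lemma mapply_fp: "mapply fp x = pnt (FF (SS x) (TT x) (UU x))"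
  by (auto simp: mapply_def fp_def pnt_def ceval_def[symmetric] mult_ac)

end

text \<open>Kept apart from \<open>pyramid_frame\<close> because both conditions come from the rank
  of the cone, in \<open>pencil\<close>, which works in the weaker locale.\<close>

locale pyramid = pyramid_frame +
  assumes K_nz: "k 0 0 + k 0 1 + k 1 0 + k 1 1 \<noteq> 0"
    and det: "k 0 0 * k 1 1 - k 0 1 * k 1 0 \<noteq> 0"
begin

lemma K_neq: "K \<noteq> 0" "1 - K \<noteq> 0"
proof -
  have "K = complex_of_real Kr" by (simp add: K_def)
  then show "K \<noteq> 0" using K_nz by (metis of_real_eq_0_iff)
qed (rule one_minus_K_nz)

lemma kc_det: "kc 0 0 * kc 1 1 - kc 0 1 * kc 1 0 \<noteq> 0"
  using det by (metis of_real_diff of_real_eq_0_iff of_real_mult)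

end

lemma rank_one_2x2:
  fixes a b c d :: complex
  assumes "a * d = b * c"
  obtains x0 x1 y0 y1 where "a = x0 * y0" "b = x0 * y1" "c = x1 * y0" "d = x1 * y1"
proof -
  consider "a \<noteq> 0" | "a = 0" "b \<noteq> 0" | "a = 0" "b = 0" by blast
  then show ?thesis
  proof cases
    case 1
    then show ?thesis using assms that[of a 1 "b / a" c] by (auto simp: field_simps)
  next
    case 2
    then show ?thesis using assms that[of b 0 1 d] by auto
  next
    case 3
    then show ?thesis using that[of 0 c d 1] by auto
  qed
qed

text \<open>The elements \<open>\<epsilon> * s * t * (U0 + U1) - U1 * L\<close> of \<open>I\<close> are the coordinates of the map in the normal
  form, with \<open>s = Sp i\<close>, \<open>t = Tp j\<close> and the sign \<open>\<epsilon> = sg i j\<close>; \<open>U0 + (1 - K) * U1\<close> is proportional to \<open>c\<^sub>0\<close>.\<close>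

lemma trilinear_multiple_in_ideal:
  fixes U0 U1 :: "'r::comm_ring_1"
  assumes I_add: "\<And>p q. p \<in> I \<Longrightarrow> q \<in> I \<Longrightarrow> p + q \<in> I" and I_mult: "\<And>p r. p \<in> I \<Longrightarrow> r * p \<in> I"
    and K: "K' * K = 1"
    and I: "L * U1 * a \<in> I" "L * U1 * b \<in> I" "L * (U0 + (1 - K) * U1) \<in> I"
    and F: "\<epsilon> * s * t * (U0 + U1) - U1 * L \<in> I" and \<epsilon>: "\<epsilon> * \<epsilon> = 1"
    and AB: "K * (s * t) - \<epsilon> * L = a * A + b * B"
    and p: "p = a * x + b * y + (U0 + (1 - K) * U1) * z" "p = (U0 + U1) * r + L * m"
  shows "s * t * U0 * p \<in> I" "s * t * U1 * p \<in> I"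
proof -
  define c where "c = U0 + (1 - K) * U1"
  \<comment> \<open>Modulo the generator, s t (U0 + U1) becomes \<epsilon> U1 L, so s t U1 p is
    reduced to L U1 V. Since p and K s t - \<epsilon> L lie in (a, b, c), so does K V; here K is a
    unit, and L U1 carries a, b and c into \<open>I\<close>.\<close>
  define V where "V = \<epsilon> * (U1 * r) + s * t * m"
  have "K * V = \<epsilon> * p - \<epsilon> * r * c + m * (K * (s * t) - \<epsilon> * L)"
    unfolding V_def p(2) c_def by (simp add: algebra_simps)
  also have "\<dots> = a * (\<epsilon> * x + m * A) + b * (\<epsilon> * y + m * B) + c * (\<epsilon> * z - \<epsilon> * r)"
    unfolding AB p(1) c_def[symmetric] by (simp add: algebra_simps)
  finally have KV: "K * V = a * (\<epsilon> * x + m * A) + b * (\<epsilon> * y + m * B) + c * (\<epsilon> * z - \<epsilon> * r)" .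
  have "L * U1 * V = (K' * K) * (L * U1 * V)"
    using K by simp
  also have "\<dots> = K' * (L * U1 * (K * V))"
    by (simp only: mult_ac)
  also have "\<dots> = K' * ((\<epsilon> * x + m * A) * (L * U1 * a) + (\<epsilon> * y + m * B) * (L * U1 * b) +
      (\<epsilon> * z - \<epsilon> * r) * U1 * (L * c))"
    unfolding KV by (simp add: algebra_simps)
  also have "\<dots> \<in> I"
    by (rule I_mult, rule I_add, rule I_add, rule I_mult[OF I(1)], rule I_mult[OF I(2)],
        rule I_mult[OF I(3)[folded c_def]])
  finally have V: "L * U1 * V \<in> I" .
  have \<epsilon>2: "\<epsilon> * (\<epsilon> * w) = w" for w
    using \<epsilon> by (simp flip: mult.assoc)
  have "s * t * U1 * p = (\<epsilon> * U1 * r) * (\<epsilon> * s * t * (U0 + U1) - U1 * L) + L * U1 * V"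
    unfolding p(2) V_def by (simp add: algebra_simps \<epsilon>2)
  also have "\<dots> \<in> I" by (intro I_add I_mult F V)
  finally show "s * t * U1 * p \<in> I" .
  \<comment> \<open>The substitution U0 = c + (K - 1) U1 splits L U0 V into a multiple of L c and
    one of L U1 V.\<close>
  have "s * t * U0 * p = (\<epsilon> * U0 * r) * (\<epsilon> * s * t * (U0 + U1) - U1 * L) +
      (V * (L * c) + (K - 1) * (L * U1 * V))"
    unfolding p(2) V_def c_def by (simp add: algebra_simps \<epsilon>2)
  also have "\<dots> \<in> I" by (intro I_add I_mult F V I(3)[folded c_def])
  finally show "s * t * U0 * p \<in> I" .
qed

context pyramid
begin

abbreviation ap :: ring_R where "ap \<equiv> Sp 0 + Sp 1"
abbreviation bp :: ring_R where "bp \<equiv> Tp 0 + Tp 1"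
abbreviation c1p :: ring_R where "c1p \<equiv> Up 0 + Up 1"
abbreviation c0p :: ring_R where "c0p \<equiv> Up 0 + pconst (1 - Kr) * Up 1"

subsection \<open>The base ideal\<close>

lemma Fp_fp: "Fp i j = (\<Sum>l\<in>UNIV. pconst (X i j $ l) * fp l)"
proof -
  have "(\<Sum>l\<in>UNIV. pconst (X i j $ l) * fp l) =
      (\<Sum>i'\<in>UNIV. \<Sum>j'\<in>UNIV. pconst (X i j \<bullet> e i' j') * Fp i' j')"
    by (simp add: fp_def sum_UNIV_2 inner_vec_def pconst_sum pconst_mult distrib_left sum.distrib
        sum_distrib_left mult_ac)
  also have "\<dots> = Fp i j"
    using two_cases[of i] two_cases[of j] by (auto simp: sum_UNIV_2 dual)
  finally show ?thesis ..
qed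

lemma Fp_in_ideal: "Fp i j \<in> ideal_gen (range fp)"
  unfolding Fp_fp by (intro ideal_gen_sum ideal_gen_mult ideal_gen_base) auto

lemma fp_in_ideal:
  assumes "\<And>i j. Fp i j \<in> ideal_gen G"
  shows "ideal_gen (range fp) \<subseteq> ideal_gen G"
  by (rule ideal_gen_subset) (auto simp: fp_def intro!: ideal_gen_sum ideal_gen_mult assms)

lemma mem_ideal_gen_3: "p \<in> ideal_gen {x, y, z} \<longleftrightarrow> (\<exists>a b c. p = x * a + y * b + z * c)"
  unfolding ideal_gen_insert ideal_gen_empty
  by (simp add: algebra_simps)

lemma mem_ideal_gen_2: "p \<in> ideal_gen {x, y} \<longleftrightarrow> (\<exists>a b. p = x * a + y * b)"
  unfolding ideal_gen_insert ideal_gen_empty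
  by (simp add: algebra_simps)

definition Kp :: ring_R where "Kp = pconst Kr"

lemma Kp_eq: "Kp = pconst (k 0 0) + pconst (k 0 1) + pconst (k 1 0) + pconst (k 1 1)"
  by (simp add: Kp_def pconst_add)

lemma c0p_eq: "c0p = Up 0 + (1 - Kp) * Up 1"
  by (simp add: Kp_def pconst_diff)

text \<open>Modulo \<open>ap\<close> and \<open>bp\<close> the four signed products S_i T_j agree,
  and L is K times any of them. The factors 1 and - 1 stay visible to match the evaluated
  \<open>sg i j\<close>.\<close>

lemma Kp_Lp:
  "Kp * (Sp 0 * Tp 0) - 1 * Lp = ap * (pconst (k 1 0) * Tp 0 - pconst (k 1 1) * Tp 1)
    + bp * (pconst (k 0 1) * Sp 0 + pconst (k 1 1) * Sp 0)"
  "Kp * (Sp 0 * Tp 1) - (- 1) * Lp = ap * (pconst (k 1 1) * Tp 1 - pconst (k 1 0) * Tp 0)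
    + bp * (pconst (k 0 0) * Sp 0 + pconst (k 1 0) * Sp 0)"
  "Kp * (Sp 1 * Tp 0) - (- 1) * Lp = ap * (pconst (k 0 0) * Tp 0 + pconst (k 0 1) * Tp 0)
    + bp * (pconst (k 1 1) * Sp 1 - pconst (k 0 1) * Sp 0)"
  "Kp * (Sp 1 * Tp 1) - 1 * Lp = ap * (pconst (k 0 0) * Tp 1 + pconst (k 0 1) * Tp 1)
    + bp * (pconst (k 1 0) * Sp 1 - pconst (k 0 0) * Sp 0)"
  unfolding Lp_def Kp_eq by (simp_all add: algebra_simps)

lemma Kp_Lp_ex: "\<exists>A B. Kp * (Sp i * Tp j) - sg i j * Lp = ap * A + bp * B"
proof -
  have "\<exists>A B. Kp * (Sp 0 * Tp 0) - sg 0 0 * Lp = ap * A + bp * B"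
    "\<exists>A B. Kp * (Sp 0 * Tp 1) - sg 0 1 * Lp = ap * A + bp * B"
    "\<exists>A B. Kp * (Sp 1 * Tp 0) - sg 1 0 * Lp = ap * A + bp * B"
    "\<exists>A B. Kp * (Sp 1 * Tp 1) - sg 1 1 * Lp = ap * A + bp * B"
    unfolding sg_simps by (intro exI, rule Kp_Lp)+
  then show ?thesis using two_cases[of i] two_cases[of j] by (elim disjE; hypsubst)
qed

lemma ideal_fp_subset: "ideal_gen (range fp) \<subseteq> ideal_gen {ap, bp, c0p} \<inter> ideal_gen {Lp, c1p}"
proof (intro Int_greatest fp_in_ideal)
  fix i j
  have "Fp i j = Lp * (- Up 1) + c1p * (sg i j * Sp i * Tp j)"
    by (simp add: Fp_def algebra_simps)
  then show "Fp i j \<in> ideal_gen {Lp, c1p}" unfolding mem_ideal_gen_2 by blast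
  obtain A B where AB: "Kp * (Sp i * Tp j) - sg i j * Lp = ap * A + bp * B"
    using Kp_Lp_ex[of i j] by blast
  have sg: "sg i j * (sg i j * w) = (w :: ring_R)" for w by (simp add: sg_def)
  \<comment> \<open>Here U_0 + U_1 is replaced by c_0 + K U_1.\<close>
  have "Fp i j = sg i j * Up 1 * (Kp * (Sp i * Tp j) - sg i j * Lp) + c0p * (sg i j * Sp i * Tp j)"
    unfolding Fp_def c0p_eq by (simp add: algebra_simps sg)
  also have "\<dots> = ap * (sg i j * Up 1 * A) + bp * (sg i j * Up 1 * B) + c0p * (sg i j * Sp i * Tp j)"
    unfolding AB by (simp add: algebra_simps)
  finally show "Fp i j \<in> ideal_gen {ap, bp, c0p}" unfolding mem_ideal_gen_3 by blast
qed

lemma base_scheme: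
  "same_subscheme blk111 (ideal_gen (range fp)) (ideal_gen {ap, bp, c0p} \<inter> ideal_gen {Lp, c1p})"
proof (rule same_subscheme_if_trilinear_multiples[OF ideal_fp_subset])
  fix p i j l
  let ?I = "ideal_gen (range fp)"
  assume "p \<in> ideal_gen {ap, bp, c0p} \<inter> ideal_gen {Lp, c1p}"
  then obtain x y z r m where p: "p = ap * x + bp * y + (Up 0 + (1 - Kp) * Up 1) * z" "p = c1p * r + Lp * m"
    unfolding mem_ideal_gen_3 mem_ideal_gen_2 Int_iff c0p_eq by (metis add.commute)
  note F = Fp_in_ideal
  \<comment> \<open>In the difference of two coordinates the term U_1 L cancels.\<close>
  have I_b: "Sp 0 * (bp * c1p) \<in> ?I"
    using ideal_gen_diff[OF F[of 0 0] F[of 0 1]] by (simp add: Fp_def algebra_simps)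
  have I_a: "Tp 0 * (ap * c1p) \<in> ?I"
    using ideal_gen_diff[OF F[of 0 0] F[of 1 0]] by (simp add: Fp_def algebra_simps)
  \<comment> \<open>With weights k_ij the leading terms add up to L (U_0 + U_1) and the others to -
    K U_1 L.\<close>
  have "Lp * (Up 0 + (1 - Kp) * Up 1) = pconst (k 0 0) * Fp 0 0 + pconst (k 0 1) * Fp 0 1
      + pconst (k 1 0) * Fp 1 0 + pconst (k 1 1) * Fp 1 1"
    unfolding Fp_def Kp_eq Lp_def by (simp add: algebra_simps)
  also have "\<dots> \<in> ?I" by (intro ideal_gen_add ideal_gen_mult F)
  finally have I_c: "Lp * (Up 0 + (1 - Kp) * Up 1) \<in> ?I" .
  have "Lp * Up 1 * ap = Sp 0 * (Tp 0 * (ap * c1p)) - ap * Fp 0 0"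
    by (simp add: Fp_def algebra_simps)
  also have "\<dots> \<in> ?I" by (intro ideal_gen_diff ideal_gen_mult F I_a)
  finally have I_La: "Lp * Up 1 * ap \<in> ?I" .
  have "Lp * Up 1 * bp = Tp 0 * (Sp 0 * (bp * c1p)) - bp * Fp 0 0"
    by (simp add: Fp_def algebra_simps)
  also have "\<dots> \<in> ?I" by (intro ideal_gen_diff ideal_gen_mult F I_b)
  finally have I_Lb: "Lp * Up 1 * bp \<in> ?I" .
  obtain A B where AB: "Kp * (Sp i * Tp j) - sg i j * Lp = ap * A + bp * B"
    using Kp_Lp_ex[of i j] by blast
  have "pconst (1 / Kr) * Kp = 1"
    unfolding Kp_def pconst_mult[symmetric] using K_nz by simp
  from trilinear_multiple_in_ideal[OF ideal_gen_add ideal_gen_mult this I_La I_Lb I_c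
      F[of i j, unfolded Fp_def] _ AB p]
  have "Sp i * Tp j * Up l * p \<in> ?I" using two_cases[of l] by (auto simp: sg_def)
  then have "pconst (1 / (\<alpha> $ i * \<beta> $ j * \<gamma> $ l)) * (Sp i * Tp j * Up l * p) \<in> ?I"
    by (rule ideal_gen_mult)
  also have "pconst (1 / (\<alpha> $ i * \<beta> $ j * \<gamma> $ l)) * (Sp i * Tp j * Up l * p) =
      pconst (1 / (\<alpha> $ i * \<beta> $ j * \<gamma> $ l) * \<alpha> $ i * \<beta> $ j * \<gamma> $ l) *
      (pvar (Par_s, i) * pvar (Par_t, j) * pvar (Par_u, l) * p)"
    unfolding Sp_def Tp_def Up_def pconst_mult by (simp only: mult_ac)
  also have "1 / (\<alpha> $ i * \<beta> $ j * \<gamma> $ l) * \<alpha> $ i * \<beta> $ j * \<gamma> $ l = 1"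
    using \<alpha>_nz[of i] \<beta>_nz[of j] \<gamma>_nz[of l] by (simp add: field_simps)
  finally show "pvar (Par_s, i) * pvar (Par_t, j) * pvar (Par_u, l) * p \<in> ?I" by simp
qed

subsection \<open>The factors of the pullback of the plane of the conic\<close>

lemma peval_Sp: "peval x (Sp i) = \<alpha> $ i * x (Par_s, i)" and peval_Tp: "peval x (Tp i) = \<beta> $ i * x (Par_t, i)"
  and peval_Up: "peval x (Up i) = \<gamma> $ i * x (Par_u, i)"
  by (simp_all add: Sp_def Tp_def Up_def)

text \<open>Both sides are a form in s, t times a form in u. The unit points \<open>x i j l\<close>
  pick out single coefficients, and comparing them makes the corresponding factors
  proportional.\<close>

lemma factors:
  assumes hc: "h * c = pconst a * (Lp * c0p)" and "a \<noteq> 0"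
    and "homogeneous blk111 (\<lambda>b. if b = Par_u then 0 else 1) h"
    and "homogeneous blk111 (\<lambda>b. if b = Par_u then 1 else 0) c"
  obtains d d' where "d \<noteq> 0" "d' \<noteq> 0" "h = pconst d * Lp" "c = pconst d' * c0p"
proof -
  obtain h' where h': "h = (\<Sum>i\<in>UNIV. \<Sum>j\<in>UNIV. pconst (h' i j) * pvar (Par_s, i) * pvar (Par_t, j))"
    using multidegree_110[OF assms(3)] by blast
  obtain c' where c': "c = (\<Sum>i\<in>UNIV. pconst (c' i) * pvar (Par_u, i))"
    using multidegree_001[OF assms(4)] by blast
  define x where "x i j l = (\<lambda>(b, m). if m = (case b of Par_s \<Rightarrow> i | Par_t \<Rightarrow> j | Par_u \<Rightarrow> l) then 1 else 0 :: real)"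
    for i j l :: 2
  have h_eval: "peval (x i j l) h = h' i j" and c_eval: "peval (x i j l) c = c' l"
    and L_eval: "peval (x i j l) Lp = sg i j * k i j * \<alpha> $ i * \<beta> $ j"
    and c0_eval: "peval (x i j l) c0p = (if l = 0 then 1 else 1 - Kr) * \<gamma> $ l" for i j l
    using two_cases[of i] two_cases[of j] two_cases[of l]
    by (auto simp: h' c' Lp_def sum_UNIV_2 x_def peval_Sp peval_Tp peval_Up)
  have eq: "h' i j * c' l = a * (sg i j * k i j * \<alpha> $ i * \<beta> $ j) * ((if l = 0 then 1 else 1 - Kr) * \<gamma> $ l)" for i j l
    using arg_cong[OF hc, of "peval (x i j l)"] by (simp add: h_eval c_eval L_eval c0_eval del: peval_add)
  define d where "d = a * \<gamma> $ 0 / c' 0"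
  have "c' 0 \<noteq> 0" using eq[of 0 0 0] \<open>a \<noteq> 0\<close> \<alpha>_nz \<beta>_nz \<gamma>_nz k_nz by auto
  then have h'': "h' i j = d * (sg i j * k i j * \<alpha> $ i * \<beta> $ j)" for i j
    using eq[of i j 0] by (simp add: d_def field_simps)
  have "d \<noteq> 0" using \<open>c' 0 \<noteq> 0\<close> \<open>a \<noteq> 0\<close> \<gamma>_nz by (simp add: d_def)
  have c'': "c' l = a / d * ((if l = 0 then 1 else 1 - Kr) * \<gamma> $ l)" for l
    using eq[of 0 0 l] \<open>d \<noteq> 0\<close> \<alpha>_nz[of 0] \<beta>_nz[of 0] k_nz[of 0 0] by (simp add: h'' field_simps)
  show ?thesis
  proof (rule that)
    show "d \<noteq> 0" "a / d \<noteq> 0" using \<open>d \<noteq> 0\<close> \<open>a \<noteq> 0\<close> by auto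
    show "h = pconst d * Lp"
      unfolding h' h'' by (simp add: sum_UNIV_2 Lp_def Sp_def Tp_def pconst_mult pconst_minus algebra_simps)
    show "c = pconst (a / d) * c0p"
      unfolding c' c'' pconst_mult by (simp only: sum_UNIV_2 Up_def distrib_left mult_ac) simp
  qed
qed

end

lemma ideal_gen_unit_mult:
  assumes "u * u' = 1"
  shows "ideal_gen (insert (u * g) G) = ideal_gen (insert g G)"
proof (intro subset_antisym ideal_gen_subset)
  show "insert (u * g) G \<subseteq> ideal_gen (insert g G)"
    using ideal_gen_base ideal_gen_mult by (metis insert_iff subsetI)
  have "g = u' * (u * g)" using assms by (metis mult.assoc mult.commute mult_1)
  then have "g \<in> ideal_gen (insert (u * g) G)"
    using ideal_gen_mult[OF ideal_gen_base[of "u * g" "insert (u * g) G"], of u'] by (simp only: insertI1)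
  then show "insert g G \<subseteq> ideal_gen (insert (u * g) G)"
    by (auto intro: ideal_gen_base)
qed

section \<open>Relations on the closure of the graph and limits along lines\<close>

lemma clin_diff: "clin (v - w) y = clin v y - clin w y"
  and clin_add: "clin (v + w) y = clin v y + clin w y"
  and clin_scaleR: "clin (c *\<^sub>R v) y = of_real c * clin v y"
  and clin_scale: "clin v (\<lambda>l. z * y l) = z * clin v y"
  by (simp_all add: clin_def sum_subtractf sum.distrib sum_distrib_left algebra_simps)

lemma homogeneous_pvar': "bl v = b \<Longrightarrow> homogeneous bl (\<lambda>b'. if b' = b then 1 else 0) (pvar v)"
  using homogeneous_pvar[of bl v] by (simp add: eq_commute)

text \<open>Cleared of denominators, "the parameter is the ratio of two planes of a pencil" is a
  polynomial equation, linear in the parameter \<open>b\<close> and in \<open>y\<close>. It passes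
  from the graph to its closure and so still holds over base points.\<close>

lemma bilinear_relation_on_closure:
  fixes F :: "4 \<Rightarrow> ring_R"
  assumes "case_sum x y \<in> zariski_closure (map_sum blk111 blk3) (graph blk111 blk3 F)"
    and rel: "\<And>x. of_real r * x (b, 0) * clin v (mapply F x) = of_real r' * x (b, 1) * clin v' (mapply F x)"
  shows "of_real r * x (b, 0) * clin v y = of_real r' * x (b, 1) * clin v' y"
proof -
  define lin where "lin v = (\<Sum>l\<in>UNIV. pconst (complex_of_real (v $ l)) * pvar (Inr l) :: (param \<times> 2 + 4, complex) mpoly)"
    for v :: "real^4"
  define p :: "(param \<times> 2 + 4, complex) mpoly" where
    "p = pconst (of_real r) * pvar (Inl (b, 0)) * lin v - pconst (of_real r') * pvar (Inl (b, 1)) * lin v'"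
  have p: "peval (case_sum x y) p = of_real r * x (b, 0) * clin v y - of_real r' * x (b, 1) * clin v' y" for x y
    by (simp add: p_def lin_def clin_def)
  have lin: "homogeneous (map_sum blk111 blk3) (\<lambda>b. if b = Inr () then 1 else 0) (lin v)" for v
    unfolding lin_def by (intro homogeneous_sum homogeneous_pconst_mult homogeneous_pvar') simp
  have "homogeneous (map_sum blk111 blk3) (\<lambda>b'. if b' = Inl b \<or> b' = Inr () then 1 else 0) p"
    unfolding p_def
    by (intro homogeneous_diff homogeneous_mult'[OF homogeneous_pconst_mult[OF homogeneous_pvar'] lin]) auto
  then have "peval (case_sum x y) p = 0"
  proof (rule zariski_closureD[OF assms(1)])
    fix z assume "z \<in> graph blk111 blk3 F"
    then obtain x' y' where z: "z = case_sum x' y'" and "same_point blk3 (mapply F x') y'"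
      unfolding graph_def by auto
    then obtain c where "y' = (\<lambda>l. c * mapply F x' l)" unfolding same_point_def by auto
    then have "peval z p = c * (of_real r * x' (b, 0) * clin v (mapply F x')
        - of_real r' * x' (b, 1) * clin v' (mapply F x'))"
      unfolding z p by (simp add: clin_scale algebra_simps)
    then show "peval z p = 0" unfolding rel by simp
  qed
  then show ?thesis unfolding p by simp
qed

lemma (in pyramid_frame) clin_kvec: "clin kvec y = kk y"
  by (simp add: kvec_def kk_def crd_def clin_add clin_scaleR)

context pyramid
begin

lemma S'_clin: "S' y 0 = clin (X 0 0 - X 0 1) y" "S' y 1 = clin (X 1 1 - X 1 0) y"
  and T'_clin: "T' y 0 = clin (X 0 0 - X 1 0) y" "T' y 1 = clin (X 1 1 - X 0 1) y"
  by (simp_all add: S'_def T'_def crd_def clin_diff)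

lemma closure_relation_S:
  assumes "case_sum x y \<in> zariski_closure (map_sum blk111 blk3) (graph blk111 blk3 fp)"
  shows "SS x 0 * S' y 1 = SS x 1 * S' y 0"
  using bilinear_relation_on_closure[OF assms, of "\<alpha> $ 0" Par_s "X 1 1 - X 1 0" "\<alpha> $ 1" "X 0 0 - X 0 1"]
  unfolding S'_clin[symmetric] mapply_fp S'_FF by (simp add: SS_def mult_ac)

lemma closure_relation_T:
  assumes "case_sum x y \<in> zariski_closure (map_sum blk111 blk3) (graph blk111 blk3 fp)"
  shows "TT x 0 * T' y 1 = TT x 1 * T' y 0"
  using bilinear_relation_on_closure[OF assms, of "\<beta> $ 0" Par_t "X 1 1 - X 0 1" "\<beta> $ 1" "X 0 0 - X 1 0"]
  unfolding T'_clin[symmetric] mapply_fp T'_FF by (simp add: TT_def mult_ac)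

lemma closure_mpoints:
  assumes "case_sum x y \<in> zariski_closure (map_sum blk111 blk3) (graph blk111 blk3 fp)"
  shows "x \<in> mpoints blk111" "y \<in> mpoints blk3"
  using assms mpoints_sum[of x y blk111 blk3] by (auto simp: zariski_closure_def)

text \<open>The derivative of \<open>FF\<close> at (S, T, U) in the direction (dS, dT, dU).\<close>

definition dFF :: "(2 \<Rightarrow> complex) \<Rightarrow> (2 \<Rightarrow> complex) \<Rightarrow> (2 \<Rightarrow> complex) \<Rightarrow>
    (2 \<Rightarrow> complex) \<Rightarrow> (2 \<Rightarrow> complex) \<Rightarrow> (2 \<Rightarrow> complex) \<Rightarrow> 2 \<Rightarrow> 2 \<Rightarrow> complex" where
  "dFF S T U dS dT dU i j = sg i j * (dS i * T j + S i * dT j) * (U 0 + U 1) + sg i j * S i * T j * (dU 0 + dU 1)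
     - dU 1 * LL S T - U 1 * (LL dS T + LL S dT)"

definition line :: "(2 \<Rightarrow> complex) \<Rightarrow> (2 \<Rightarrow> complex) \<Rightarrow> complex \<Rightarrow> 2 \<Rightarrow> complex" where
  "line S dS t i = S i + t * dS i"

lemma tendsto_line: "((\<lambda>t. line S dS t i) \<longlongrightarrow> S i) (at 0)"
proof -
  have "((\<lambda>t. S i + t * dS i) \<longlongrightarrow> S i + 0 * dS i) (at 0)" by (intro tendsto_intros)
  then show ?thesis by (simp add: line_def)
qed

lemma cpt_line_limit: "((\<lambda>t. cpt (line S dS t) (line T dT t) (line U dU t) v) \<longlongrightarrow> cpt S T U v) (at 0)"
  by (intro tendsto_cpt tendsto_line)

text \<open>At a zero of \<open>FF\<close> the quotient by t is a difference quotient.\<close>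

lemma FF_line_limit:
  assumes "\<And>i j. FF S T U i j = 0"
  shows "((\<lambda>t. mapply fp (cpt (line S dS t) (line T dT t) (line U dU t)) l / t)
    \<longlongrightarrow> pnt (dFF S T U dS dT dU) l) (at 0)"
proof -
  have "((\<lambda>t. FF (line S dS t) (line T dT t) (line U dU t) i j / t) \<longlongrightarrow> dFF S T U dS dT dU i j) (at 0)" for i j
  proof -
    have "((\<lambda>t. FF (line S dS t) (line T dT t) (line U dU t) i j) has_field_derivative
        dFF S T U dS dT dU i j) (at 0)"
      unfolding FF_def LL_def line_def
      by (rule derivative_eq_intros refl)+ (simp add: dFF_def LL_def algebra_simps)
    moreover have "FF (line S dS 0) (line T dT 0) (line U dU 0) i j = 0"
      using assms[of i j] by (simp add: FF_def LL_def line_def)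
    ultimately show ?thesis by (simp add: has_field_derivative_iff)
  qed
  note lim = this
  have eq: "mapply fp (cpt (line S dS t) (line T dT t) (line U dU t)) l / t
      = (\<Sum>i\<in>UNIV. \<Sum>j\<in>UNIV. (FF (line S dS t) (line T dT t) (line U dU t) i j / t) * of_real (e i j $ l))" for t
    by (simp add: mapply_fp pnt_def sum_divide_distrib)
  show ?thesis
    unfolding eq pnt_def[of "dFF S T U dS dT dU"]
    by (intro tendsto_sum tendsto_mult tendsto_const lim)
qed

lemma in_graph_closure:
  assumes "x \<in> mpoints blk111" "y \<in> mpoints blk3" "\<And>i j. FF (SS x) (TT x) (UU x) i j = 0"
    and "\<And>i j. crd i j y = dFF (SS x) (TT x) (UU x) dS dT dU i j"
  shows "case_sum x y \<in> zariski_closure (map_sum blk111 blk3) (graph blk111 blk3 fp)"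
proof (rule graph_closure_limit[OF assms(1,2)])
  have y: "y = pnt (dFF (SS x) (TT x) (UU x) dS dT dU)" by (rule crd_eqI) (simp add: assms)
  show "((\<lambda>t. mapply fp (cpt (line (SS x) dS t) (line (TT x) dT t) (line (UU x) dU t)) l / t) \<longlongrightarrow> y l) (at 0)" for l
    unfolding y by (rule FF_line_limit[OF assms(3)])
  show "((\<lambda>t. cpt (line (SS x) dS t) (line (TT x) dT t) (line (UU x) dU t) v) \<longlongrightarrow> x v) (at 0)" for v
    using cpt_line_limit[of "SS x" dS "TT x" dT "UU x" dU v] by simp
qed

lemma in_base_locus:
  assumes "x \<in> mpoints blk111" "\<And>i j. FF (SS x) (TT x) (UU x) i j = 0"
    and "dFF (SS x) (TT x) (UU x) dS dT dU i j * dFF (SS x) (TT x) (UU x) dS' dT' dU' i' j' \<noteq>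
      dFF (SS x) (TT x) (UU x) dS dT dU i' j' * dFF (SS x) (TT x) (UU x) dS' dT' dU' i j"
  shows "x \<in> base_locus blk111 blk3 fp"
proof -
  let ?V = "dFF (SS x) (TT x) (UU x) dS dT dU" and ?V' = "dFF (SS x) (TT x) (UU x) dS' dT' dU'"
  have x: "((\<lambda>t. cpt (line (SS x) dS t) (line (TT x) dT t) (line (UU x) dU t) v) \<longlongrightarrow> x v) (at 0)" for dS dT dU v
    using cpt_line_limit[of "SS x" dS "TT x" dT "UU x" dU v] by simp
  note y = FF_line_limit[OF assms(2)]
  \<comment> \<open>The given minor is one in the frame coordinates. If all minors vanished in the
    original coordinates, applying \<open>crd\<close> in each of the two arguments would make it
    vanish too.\<close>
  have "\<exists>l m. pnt ?V l * pnt ?V' m \<noteq> pnt ?V m * pnt ?V' l"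
  proof (rule ccontr)
    assume "\<not> ?thesis"
    then have eq: "pnt ?V l * pnt ?V' m = pnt ?V m * pnt ?V' l" for l m by blast
    have "crd i j (\<lambda>l. pnt ?V' m * pnt ?V l) = crd i j (\<lambda>l. pnt ?V m * pnt ?V' l)" for m
      using eq[of _ m] by (simp add: mult.commute)
    then have "pnt ?V' m * ?V i j = pnt ?V m * ?V' i j" for m by simp
    then have "crd i' j' (\<lambda>m. ?V i j * pnt ?V' m) = crd i' j' (\<lambda>m. ?V' i j * pnt ?V m)"
      by (simp only: mult.commute)
    then have "?V i j * ?V' i' j' = ?V i' j' * ?V' i j" by (simp add: mult.commute)
    with assms(3) show False by simp
  qed
  from base_locus_if_two_directions[OF assms(1) x y x y this] show ?thesis .
qed

subsection \<open>The blow-up of the base point\<close>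

lemma blows_up_point:
  assumes pa: "\<And>x. ceval x pa = SS x 0 + SS x 1" and pb: "\<And>x. ceval x pb = TT x 0 + TT x 1"
    and pc: "\<And>x. ceval x pc = d * (UU x 0 + (1 - K) * UU x 1)" "d \<noteq> 0"
  shows "blows_up blk111 blk3 fp (ideal_gen {pa, pb, pc}) {y \<in> mpoints blk3. p0 y = 0}"
proof -
  define Z where "Z = zero_locus blk111 (ideal_gen {pa, pb, pc})"
  have Z: "x \<in> Z \<longleftrightarrow> x \<in> mpoints blk111 \<and> SS x 1 = - SS x 0 \<and> TT x 1 = - TT x 0 \<and> UU x 0 = (K - 1) * UU x 1" for x
    unfolding Z_def zero_locus_ideal_gen
  proof -
    have "UU x 0 + (1 - K) * UU x 1 = UU x 0 - (K - 1) * UU x 1"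
      by (simp add: algebra_simps)
    then show "x \<in> zero_locus blk111 {pa, pb, pc} \<longleftrightarrow> x \<in> mpoints blk111 \<and> SS x 1 = - SS x 0 \<and>
        TT x 1 = - TT x 0 \<and> UU x 0 = (K - 1) * UU x 1"
      using pc(2) by (auto simp: zero_locus_def ceval_def[symmetric] pa pb pc(1) add_eq_0_iff)
  qed
  have nz: "SS x 0 \<noteq> 0" "TT x 0 \<noteq> 0" "UU x 1 \<noteq> 0" if "x \<in> Z" for x
    using that by (auto simp: Z mpoints_SS)
  have LL: "LL (SS x) (TT x) = K * SS x 0 * TT x 0" if "x \<in> Z" for x
    using that by (simp add: Z LL_def K_def algebra_simps)
  have sg: "sg i j * SS x i * TT x j = SS x 0 * TT x 0" if "x \<in> Z" for x i j
    using that two_cases[of i] two_cases[of j] by (auto simp: Z)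
  have UU: "UU x 0 + UU x 1 = K * UU x 1" if "x \<in> Z" for x
    using that by (simp add: Z algebra_simps)
  have FF: "FF (SS x) (TT x) (UU x) i j = 0" if "x \<in> Z" for x i j
    unfolding FF_def using that by (simp add: LL sg UU)
  have "Z \<subseteq> base_locus blk111 blk3 fp"
  proof
    fix x assume x: "x \<in> Z"
    \<comment> \<open>The sums of the first row and of the first column of k: the derivatives of L
      in S_0 and T_0 at this point, up to the factors T_0 and S_0.\<close>
    define u u' where "u = kc 0 0 + kc 0 1" and "u' = kc 0 0 + kc 1 0"
    let ?dS = "\<lambda>i::2. if i = 0 then 1 else 0 :: complex" and ?z = "\<lambda>_::2. 0 :: complex"
    define V where "V = dFF (SS x) (TT x) (UU x) ?dS ?z ?z"
    define V' where "V' = dFF (SS x) (TT x) (UU x) ?z ?dS ?z"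
    have T1: "TT x 1 = - TT x 0" "SS x 1 = - SS x 0" using x by (auto simp: Z)
    have V: "V 0 0 = UU x 1 * TT x 0 * (K - u)" "V 0 1 = UU x 1 * TT x 0 * (K - u)"
      "V 1 0 = - (UU x 1 * TT x 0 * u)" "V 1 1 = - (UU x 1 * TT x 0 * u)"
      using UU[OF x] T1 by (simp_all add: V_def dFF_def LL_def u_def algebra_simps)
    have V': "V' 0 0 = UU x 1 * SS x 0 * (K - u')" "V' 1 0 = UU x 1 * SS x 0 * (K - u')"
      "V' 0 1 = - (UU x 1 * SS x 0 * u')" "V' 1 1 = - (UU x 1 * SS x 0 * u')"
      using UU[OF x] T1 by (simp_all add: V'_def dFF_def LL_def u'_def algebra_simps)
    \<comment> \<open>\<open>V\<close> is constant along rows and \<open>V'\<close> along columns.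
      The two minors give (K - u) K and u K, which add up to the square of K.\<close>
    have "V 0 0 * V' 0 1 \<noteq> V 0 1 * V' 0 0 \<or> V 1 0 * V' 1 1 \<noteq> V 1 1 * V' 1 0"
    proof (rule ccontr)
      assume "\<not> ?thesis"
      then have eq: "V 0 0 * V' 0 1 = V 0 1 * V' 0 0" "V 1 0 * V' 1 1 = V 1 1 * V' 1 0" by auto
      have "(UU x 1 * TT x 0) * (UU x 1 * SS x 0) * ((K - u) * K) = 0"
        using eq(1) unfolding V V' by algebra
      moreover have "(UU x 1 * TT x 0) * (UU x 1 * SS x 0) * (u * K) = 0"
        using eq(2) unfolding V V' by algebra
      ultimately have "(K - u) * K = 0" "u * K = 0" using nz[OF x] by auto
      then show False using nz[OF x] K_neq(1) by auto
    qed
    then obtain i j i' j' where "V i j * V' i' j' \<noteq> V i' j' * V' i j" by blast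
    from in_base_locus[OF _ FF[OF x] this[unfolded V_def V'_def]] x
    show "x \<in> base_locus blk111 blk3 fp" by (simp add: Z)
  qed
  moreover have "p0 y = 0" if y: "x \<in> Z" "case_sum x y \<in> zariski_closure (map_sum blk111 blk3) (graph blk111 blk3 fp)" for x y
  proof -
    \<comment> \<open>At the base point S_1 = - S_0, so the relation on the closure says that the
      sum of the two components of \<open>S'\<close> vanishes; this sum is p0.\<close>
    have "SS x 0 * (S' y 0 + S' y 1) = 0"
      using closure_relation_S[OF y(2)] y(1) by (simp add: Z algebra_simps)
    moreover have "p0 y = S' y 0 + S' y 1" by (simp add: S'_def p0_def)
    ultimately show ?thesis using nz[OF y(1)] by simp
  qed
  moreover have "\<exists>x\<in>Z. case_sum x y \<in> zariski_closure (map_sum blk111 blk3) (graph blk111 blk3 fp)"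
    if y: "y \<in> mpoints blk3" "p0 y = 0" for y
  proof -
    define x where "x = cpt (\<lambda>i. if i = 0 then 1 else - 1) (\<lambda>i. if i = 0 then 1 else - 1) (\<lambda>i. if i = 0 then K - 1 else 1)"
    have x: "x \<in> Z" by (simp add: Z x_def mpoints_SS)
    have y11: "crd 1 1 y = crd 0 1 y + crd 1 0 y - crd 0 0 y"
      using y(2) unfolding p0_def by algebra
    \<comment> \<open>At this point S_i and T_j are 1 or - 1 and the sign is S_i T_j, so the
      derivative is K (S_i dS_i + T_j dT_j) once \<open>dU\<close> cancels the terms common to all
      coordinates. Matrices that are a row term plus a column term are those with p0 = 0; the choice
      dT_0 = 0 fixes the decomposition.\<close>
    define dS where "dS i = (if i = 0 then crd 0 0 y / K else - crd 1 0 y / K)" for i :: 2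
    define dT where "dT i = (if i = 0 then 0 else (crd 0 0 y - crd 0 1 y) / K)" for i :: 2
    have d: "K * dS 0 = crd 0 0 y" "K * dS 1 = - crd 1 0 y" "dT 0 = 0" "K * dT 1 = crd 0 0 y - crd 0 1 y"
      using K_neq(1) by (auto simp: dS_def dT_def)
    define dU where "dU i = (if i = 0 then LL dS (TT x) + LL (SS x) dT else 0)" for i :: 2
    have "crd i j y = dFF (SS x) (TT x) (UU x) dS dT dU i j" for i j
    proof -
      have "dFF (SS x) (TT x) (UU x) dS dT dU i j = sg i j * (K * dS i * TT x j + SS x i * (K * dT j))"
        using two_cases[of i] two_cases[of j]
        by (auto simp: dFF_def x_def dU_def algebra_simps)
      also have "\<dots> = crd i j y"
        using two_cases[of i] two_cases[of j]
        by (auto simp: x_def d y11)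
      finally show ?thesis ..
    qed
    then have "case_sum x y \<in> zariski_closure (map_sum blk111 blk3) (graph blk111 blk3 fp)"
      using x Z by (intro in_graph_closure[where dS = dS and dT = dT and dU = dU] FF y) auto
    with x show ?thesis by blast
  qed
  ultimately show ?thesis
    unfolding blows_up_def Z_def[symmetric] using closure_mpoints by blast
qed

subsection \<open>The blow-up of the base curve\<close>

text \<open>The bilinear form L is nondegenerate because det k is nonzero, so a nonzero T leaves a
  nonzero linear form in S.\<close>

lemma LL_surj:
  assumes "T 0 \<noteq> 0 \<or> T 1 \<noteq> 0"
  obtains dS where "LL dS T = c"
proof -
  define l0 l1 where "l0 = kc 0 0 * T 0 - kc 0 1 * T 1" and "l1 = kc 1 1 * T 1 - kc 1 0 * T 0"
  have LL: "LL dS T = dS 0 * l0 + dS 1 * l1" for dS by (simp add: LL_def l0_def l1_def algebra_simps)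
  have "l0 \<noteq> 0 \<or> l1 \<noteq> 0"
  proof (rule ccontr)
    assume "\<not> ?thesis"
    moreover have "(kc 0 0 * kc 1 1 - kc 0 1 * kc 1 0) * T 0 = kc 1 1 * l0 + kc 0 1 * l1"
      "(kc 0 0 * kc 1 1 - kc 0 1 * kc 1 0) * T 1 = kc 1 0 * l0 + kc 0 0 * l1"
      by (simp_all add: l0_def l1_def algebra_simps)
    ultimately show False using assms kc_det by simp
  qed
  then show ?thesis
  proof
    assume "l0 \<noteq> 0" then show ?thesis by (intro that[of "\<lambda>i. if i = 0 then c / l0 else 0"]) (simp add: LL)
  next
    assume "l1 \<noteq> 0" then show ?thesis by (intro that[of "\<lambda>i. if i = 0 then 0 else c / l1"]) (simp add: LL)
  qed
qed

lemma rank_one_sg: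
  assumes "N 0 0 * N 1 1 = N 0 1 * N 1 (0::2)"
  obtains S T :: "2 \<Rightarrow> complex" where "\<And>i j. N i j = sg i j * S i * T j"
proof -
  obtain x0 x1 y0 y1 where N: "N 0 0 = x0 * y0" "N 0 1 = x0 * y1" "N 1 0 = x1 * y0" "N 1 1 = x1 * y1"
    by (rule rank_one_2x2[OF assms])
  show ?thesis
  proof (rule that[of "\<lambda>i. if i = 0 then x0 else - x1" "\<lambda>i. if i = 0 then y0 else - y1"])
    show "N i j = sg i j * (if i = 0 then x0 else - x1) * (if j = 0 then y0 else - y1)" for i j
      using two_cases[of i] two_cases[of j] N by auto
  qed
qed

text \<open>The cone is the pullback of the curve L = 0 along (S', T'), as L takes the value - qc
  there.\<close>

lemma qc_0_if_proportional:
  assumes S: "S 0 \<noteq> 0 \<or> S 1 \<noteq> 0" "S 0 * S' y 1 = S 1 * S' y 0"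
    and T: "T 0 \<noteq> 0 \<or> T 1 \<noteq> 0" "T 0 * T' y 1 = T 1 * T' y 0" and LL: "LL S T = 0"
  shows "qc y = 0"
proof -
  obtain a where a: "S' y 0 = a * S 0" "S' y 1 = a * S 1"
    using S by (cases "S 0 = 0") (auto simp: field_simps intro: that[of "S' y 1 / S 1"] that[of "S' y 0 / S 0"])
  obtain b where b: "T' y 0 = b * T 0" "T' y 1 = b * T 1"
    using T by (cases "T 0 = 0") (auto simp: field_simps intro: that[of "T' y 1 / T 1"] that[of "T' y 0 / T 0"])
  have "LL (S' y) (T' y) = a * b * LL S T"
    by (simp add: LL_def a b algebra_simps)
  then show ?thesis using LL by (simp add: LL_S'_T')
qed

lemma blows_up_curve:
  assumes ph: "\<And>x. ceval x ph = d * LL (SS x) (TT x)" "d \<noteq> 0" and pc: "\<And>x. ceval x pc = UU x 0 + UU x 1"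
  shows "blows_up blk111 blk3 fp (ideal_gen {ph, pc}) {y \<in> mpoints blk3. qc y = 0}"
proof -
  define Z where "Z = zero_locus blk111 (ideal_gen {ph, pc})"
  have Z: "x \<in> Z \<longleftrightarrow> x \<in> mpoints blk111 \<and> LL (SS x) (TT x) = 0 \<and> UU x 0 = - UU x 1" for x
    unfolding Z_def zero_locus_ideal_gen
    using ph(2) by (auto simp: zero_locus_def ceval_def[symmetric] ph(1) pc eq_neg_iff_add_eq_0)
  have FF: "FF (SS x) (TT x) (UU x) i j = 0" if "x \<in> Z" for x i j
    unfolding FF_def using that by (simp add: Z)
  have dFF: "dFF (SS x) (TT x) (UU x) dS dT dU i j = sg i j * SS x i * TT x j * (dU 0 + dU 1)
     - UU x 1 * (LL dS (TT x) + LL (SS x) dT)" if "x \<in> Z" for x dS dT dU i j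
    using that by (simp add: Z dFF_def)
  let ?z = "\<lambda>_::2. 0 :: complex" and ?dU = "\<lambda>i::2. if i = 0 then 1 else 0 :: complex"
  have LL0 [simp]: "LL ?z T = 0" "LL S ?z = 0" for S T by (simp_all add: LL_def)
  have "Z \<subseteq> base_locus blk111 blk3 fp"
  proof
    fix x assume x: "x \<in> Z"
    then have nz: "SS x 0 \<noteq> 0 \<or> SS x 1 \<noteq> 0" "TT x 0 \<noteq> 0 \<or> TT x 1 \<noteq> 0" "UU x 1 \<noteq> 0" by (auto simp: Z mpoints_SS)
    \<comment> \<open>Moving u gives the signed products S_i T_j, and moving S with this
      \<open>dS\<close> gives the apex, all of whose coordinates are 1. If the two were
      proportional, all entries of \<open>V\<close> would be equal and L = 0 would read K V_00 =
      0.\<close>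
    obtain dS where dS: "LL dS (TT x) = - 1 / UU x 1" using LL_surj[OF nz(2)] by blast
    define V where "V = dFF (SS x) (TT x) (UU x) ?z ?z ?dU"
    define V' where "V' = dFF (SS x) (TT x) (UU x) dS ?z ?z"
    have V: "V i j = sg i j * SS x i * TT x j" for i j by (simp add: V_def dFF[OF x])
    have V': "V' i j = 1" for i j using nz by (simp add: V'_def dFF[OF x] dS)
    have "\<exists>i j i' j'. V i j * V' i' j' \<noteq> V i' j' * V' i j"
    proof (rule ccontr)
      assume "\<not> ?thesis"
      then have eq: "V i j = V 0 0" for i j unfolding V' by simp
      have "LL (SS x) (TT x) = kc 0 0 * V 0 0 + kc 0 1 * V 0 1 + kc 1 0 * V 1 0 + kc 1 1 * V 1 1"
        by (simp add: V LL_def algebra_simps)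
      also have "\<dots> = K * V 0 0" by (simp add: eq[of 0 1] eq[of 1] K_def algebra_simps)
      finally have "V 0 0 = 0" using x K_neq by (simp add: Z)
      then have "SS x i * TT x j = 0" for i j using eq[of i j] V[of i j] by (auto simp: sg_def split: if_splits)
      with nz show False by (metis mult_eq_0_iff)
    qed
    then obtain i j i' j' where "V i j * V' i' j' \<noteq> V i' j' * V' i j" by blast
    from in_base_locus[OF _ FF[OF x] this[unfolded V_def V'_def]] x
    show "x \<in> base_locus blk111 blk3 fp" by (simp add: Z)
  qed
  moreover have "qc y = 0"
    if y: "x \<in> Z" "case_sum x y \<in> zariski_closure (map_sum blk111 blk3) (graph blk111 blk3 fp)" for x y
    using y(1) closure_relation_S[OF y(2)] closure_relation_T[OF y(2)]
    by (intro qc_0_if_proportional[of "SS x" y "TT x"]) (auto simp: Z mpoints_SS)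
  moreover have "\<exists>x\<in>Z. case_sum x y \<in> zariski_closure (map_sum blk111 blk3) (graph blk111 blk3 fp)"
    if y: "y \<in> mpoints blk3" "qc y = 0" for y
  proof -
    \<comment> \<open>Subtracting c projects \<open>y\<close> from the apex to the plane kk = 0. On
      the cone the projected matrix \<open>N\<close> has determinant zero, hence rank at most
      one.\<close>
    define c where "c = kk y / K"
    define N where "N i j = crd i j y - c" for i j
    have Kc: "K * c = kk y" using K_neq by (simp add: c_def)
    have kN: "kc 0 0 * N 0 0 + kc 0 1 * N 0 1 + kc 1 0 * N 1 0 + kc 1 1 * N 1 1 = 0"
      using Kc by (simp add: N_def kk_def K_def algebra_simps)
    have "K * (N 0 0 * N 1 1 - N 0 1 * N 1 0) = K * q0 y - (K * c) * p0 y"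
      by (simp add: N_def q0_def p0_def algebra_simps)
    also have "\<dots> = 0" using y(2) by (simp add: Kc qc_def)
    finally have "N 0 0 * N 1 1 = N 0 1 * N 1 0" using K_neq by simp
    then obtain S T where N: "\<And>i j. N i j = sg i j * S i * T j" by (rule rank_one_sg) blast
    have LL: "LL S T = 0" using kN unfolding N by (simp add: LL_def algebra_simps)
    have "\<exists>S' T' r. (S' 0 \<noteq> 0 \<or> S' 1 \<noteq> 0) \<and> (T' 0 \<noteq> 0 \<or> T' 1 \<noteq> 0) \<and> LL S' T' = 0 \<and>
      (\<forall>i j. N i j = r * (sg i j * S' i * T' j))"
    proof (cases "N = (\<lambda>_ _. 0)")
      \<comment> \<open>Here \<open>y\<close> is the apex, and any point of the curve will do; (k_10
        : k_00) x (1 : 0) is one.\<close>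
      case True
      then show ?thesis
        by (intro exI[of _ "\<lambda>i. if i = 0 then kc 1 0 else kc 0 0"] exI[of _ "\<lambda>i. if i = 0 then 1 else 0"] exI[of _ 0])
          (auto simp: LL_def k_nz)
    next
      case False
      then obtain i j where "S i \<noteq> 0" "T j \<noteq> 0" unfolding fun_eq_iff N by auto
      then have "(S 0 \<noteq> 0 \<or> S 1 \<noteq> 0) \<and> (T 0 \<noteq> 0 \<or> T 1 \<noteq> 0)"
        using two_cases[of i] two_cases[of j] by auto
      then show ?thesis
        using LL by (intro exI[of _ S] exI[of _ T] exI[of _ 1]) (simp add: N)
    qed
    then obtain S T r where nz: "S 0 \<noteq> 0 \<or> S 1 \<noteq> 0" "T 0 \<noteq> 0 \<or> T 1 \<noteq> 0"
      and LL: "LL S T = 0" and N: "\<And>i j. N i j = r * (sg i j * S i * T j)" by blast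
    define x where "x = cpt S T (\<lambda>i. if i = 0 then 1 else - 1)"
    have x: "x \<in> Z" using nz LL by (simp add: Z x_def mpoints_SS)
    obtain dS where dS: "LL dS T = c" using LL_surj[OF nz(2)] by blast
    have "crd i j y = dFF (SS x) (TT x) (UU x) dS ?z (\<lambda>i. if i = 0 then r else 0) i j" for i j
      unfolding dFF[OF x] using N[of i j] by (simp add: x_def dS N_def algebra_simps)
    then have "case_sum x y \<in> zariski_closure (map_sum blk111 blk3) (graph blk111 blk3 fp)"
      using x Z by (intro in_graph_closure[where dS = dS and dT = ?z and dU = "\<lambda>i. if i = 0 then r else 0"] FF y) auto
    with x show ?thesis by blast
  qed
  ultimately show ?thesis
    unfolding blows_up_def Z_def[symmetric] using closure_mpoints by blast
qed

section \<open>Multidegrees and the inverse map\<close>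

lemma homogeneous_Sp: "homogeneous blk111 (\<lambda>b. if b = Par_s then 1 else 0) (Sp i)"
  and homogeneous_Tp: "homogeneous blk111 (\<lambda>b. if b = Par_t then 1 else 0) (Tp i)"
  and homogeneous_Up: "homogeneous blk111 (\<lambda>b. if b = Par_u then 1 else 0) (Up i)"
  unfolding Sp_def Tp_def Up_def by (intro homogeneous_pconst_mult homogeneous_pvar'; simp)+

lemma homogeneous_Sp_Tp: "homogeneous blk111 (\<lambda>b. if b = Par_u then 0 else 1) (pconst c * Sp i * Tp j)"
  by (rule homogeneous_mult'[OF homogeneous_pconst_mult[OF homogeneous_Sp] homogeneous_Tp])
    (metis (full_types) add_0 add_0_right param.distinct param.exhaust)

lemma homogeneous_Lp: "homogeneous blk111 (\<lambda>b. if b = Par_u then 0 else 1) Lp"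
  unfolding Lp_def by (intro homogeneous_add homogeneous_diff homogeneous_Sp_Tp)

lemma homogeneous_fp: "homogeneous blk111 (\<lambda>_. 1) (fp l)"
proof -
  have "sg i j = (pconst (sg i j) :: ring_R)" for i j by (simp add: sg_def pconst_minus)
  then have "homogeneous blk111 (\<lambda>b. if b = Par_u then 0 else 1) (sg i j * Sp i * Tp j)" for i j
    using homogeneous_Sp_Tp by metis
  then have "homogeneous blk111 (\<lambda>_. 1) (sg i j * Sp i * Tp j * (Up 0 + Up 1))" for i j
    by (rule homogeneous_mult'[OF _ homogeneous_add[OF homogeneous_Up homogeneous_Up]]) simp
  moreover have "homogeneous blk111 (\<lambda>_. 1) (Up 1 * Lp)"
    by (rule homogeneous_mult'[OF homogeneous_Up homogeneous_Lp]) simp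
  ultimately show ?thesis
    unfolding fp_def Fp_def by (intro homogeneous_sum homogeneous_pconst_mult homogeneous_diff)
qed

end

text \<open>\<open>\<theta>\<close> is the common scalar of the two quadratic forms in the pencil.
  The crossed indices of \<alpha>, \<beta> and \<gamma> disappear after rescaling: both components
  of a block acquire the same factor, such as \<alpha>_0 \<alpha>_1.\<close>

locale pyramid_inverse = pyramid +
  fixes \<psi> :: "param \<times> 2 \<Rightarrow> (4, real) mpoly" and \<theta> :: real
  assumes \<theta>_nz: "\<theta> \<noteq> 0"
    and \<psi>_s: "mapply \<psi> y (Par_s, 0) = of_real (\<alpha> $ 1) * S' y 0" "mapply \<psi> y (Par_s, 1) = of_real (\<alpha> $ 0) * S' y 1"
    and \<psi>_t: "mapply \<psi> y (Par_t, 0) = of_real (\<beta> $ 1) * T' y 0" "mapply \<psi> y (Par_t, 1) = of_real (\<beta> $ 0) * T' y 1"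
    and \<psi>_u: "mapply \<psi> y (Par_u, 0) = of_real (\<gamma> $ 1 * \<theta>) * U' y 0" "mapply \<psi> y (Par_u, 1) = of_real (\<gamma> $ 0 * \<theta>) * U' y 1"
    and \<psi>_homogeneous: "homogeneous blk3 (\<lambda>_. if b = Par_u then 2 else 1) (\<psi> (b, i))"
begin

lemma mpoints_\<psi>: "mapply \<psi> y \<in> mpoints blk111 \<longleftrightarrow>
    (S' y 0 \<noteq> 0 \<or> S' y 1 \<noteq> 0) \<and> (T' y 0 \<noteq> 0 \<or> T' y 1 \<noteq> 0) \<and> (U' y 0 \<noteq> 0 \<or> U' y 1 \<noteq> 0)"
  by (auto simp: mpoints_blk111 all_param \<psi>_s \<psi>_t \<psi>_u \<alpha>_nz \<beta>_nz \<gamma>_nz \<theta>_nz)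

definition factor :: "(param \<times> 2 \<Rightarrow> complex) \<Rightarrow> param \<Rightarrow> complex" where
  "factor x b = (case b of
      Par_s \<Rightarrow> of_real (\<alpha> $ 0 * \<alpha> $ 1) * ((TT x 0 + TT x 1) * (UU x 0 + UU x 1))
    | Par_t \<Rightarrow> of_real (\<beta> $ 0 * \<beta> $ 1) * ((SS x 0 + SS x 1) * (UU x 0 + UU x 1))
    | Par_u \<Rightarrow> - of_real (\<gamma> $ 0 * \<gamma> $ 1 * \<theta>) * ((UU x 0 + UU x 1) * (SS x 0 + SS x 1) * (TT x 0 + TT x 1) * LL (SS x) (TT x)))"

lemma \<psi>_fp: "mapply \<psi> (mapply fp x) (b, i) = factor x b * x (b, i)"
proof -
  have "U' (mapply fp x) j = - ((UU x 0 + UU x 1) * (SS x 0 + SS x 1) * (TT x 0 + TT x 1) * LL (SS x) (TT x)) * UU x j" for j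
    using two_cases[of j] by (auto simp: U'_def mapply_fp q0_FF q1_FF algebra_simps)
  then show ?thesis
    using two_cases[of i]
    by (cases b) (auto simp: \<psi>_s \<psi>_t \<psi>_u mapply_fp S'_FF T'_FF factor_def SS_def TT_def UU_def)
qed

lemma fp_\<psi>: "mapply fp (mapply \<psi> y) =
    (\<lambda>l. of_real (\<alpha> $ 0 * \<alpha> $ 1 * \<beta> $ 0 * \<beta> $ 1 * \<gamma> $ 0 * \<gamma> $ 1 * \<theta>) * (qc y * p0 y) * y l)"
proof -
  have "SS (mapply \<psi> y) = (\<lambda>i. of_real (\<alpha> $ 0 * \<alpha> $ 1) * S' y i)"
    "TT (mapply \<psi> y) = (\<lambda>i. of_real (\<beta> $ 0 * \<beta> $ 1) * T' y i)"
    "UU (mapply \<psi> y) = (\<lambda>i. of_real (\<gamma> $ 0 * \<gamma> $ 1 * \<theta>) * U' y i)"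
    unfolding fun_eq_iff all_2 by (simp_all add: SS_def TT_def UU_def \<psi>_s \<psi>_t \<psi>_u)
  then have "mapply fp (mapply \<psi> y) = pnt (\<lambda>i j. of_real (\<alpha> $ 0 * \<alpha> $ 1) * of_real (\<beta> $ 0 * \<beta> $ 1) *
      of_real (\<gamma> $ 0 * \<gamma> $ 1 * \<theta>) * (qc y * p0 y) * crd i j y)"
    unfolding mapply_fp by (intro arg_cong[of _ _ pnt] ext) (simp only: FF_scale FF_inverse mult.assoc)
  also have "\<dots> = (\<lambda>l. of_real (\<alpha> $ 0 * \<alpha> $ 1) * of_real (\<beta> $ 0 * \<beta> $ 1) *
      of_real (\<gamma> $ 0 * \<gamma> $ 1 * \<theta>) * (qc y * p0 y) * y l)"
    unfolding pnt_scale pnt_crd ..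
  finally show ?thesis by (simp add: mult.assoc)
qed

text \<open>The vertex (1 : 0) x (1 : 0) x (1 : 0) in the rescaled parameters. Its image is
  \<open>e 0 0\<close>, and it witnesses that both composites are defined somewhere.\<close>

definition x0 :: "param \<times> 2 \<Rightarrow> complex" where
  "x0 = cpt (\<lambda>i. if i = 0 then 1 else 0) (\<lambda>i. if i = 0 then 1 else 0) (\<lambda>i. if i = 0 then 1 else 0)"

lemma x0: "x0 \<in> mpoints blk111" "mapply fp x0 \<in> mpoints blk3" "factor x0 b \<noteq> 0"
proof -
  show "x0 \<in> mpoints blk111" by (simp add: x0_def mpoints_SS)
  have "FF (SS x0) (TT x0) (UU x0) 0 0 = 1" by (simp add: x0_def FF_def LL_def)
  then show "mapply fp x0 \<in> mpoints blk3" unfolding mapply_fp mpoints_crd by (metis crd_pnt zero_neq_one)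
  show "factor x0 b \<noteq> 0"
    by (cases b) (auto simp: factor_def x0_def LL_def \<alpha>_nz \<beta>_nz \<gamma>_nz \<theta>_nz k_nz)
qed

lemma mpoints_factor: "mapply \<psi> (mapply fp x) \<in> mpoints blk111 \<longleftrightarrow> x \<in> mpoints blk111 \<and> (\<forall>b. factor x b \<noteq> 0)"
  by (auto simp: mpoints_blk111 \<psi>_fp)

lemma ratmap_fp: "ratmap blk111 blk3 fp"
proof -
  obtain l where "mapply fp x0 l \<noteq> 0" using x0(2) by (auto simp: mpoints_def)
  then have "fp l \<noteq> 0" by (auto simp: mapply_def ceval_def[symmetric])
  have "\<exists>d. \<forall>w. homogeneous blk111 d (fp w)"
    using homogeneous_fp by (intro exI[of _ "\<lambda>_. 1"] allI)
  with \<open>fp l \<noteq> 0\<close> show ?thesis unfolding ratmap_def by auto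
qed

lemma ratmap_\<psi>: "ratmap blk3 blk111 \<psi>"
  unfolding ratmap_def
proof (intro allI conjI)
  fix b
  show "\<exists>d. \<forall>w. fst w = b \<longrightarrow> homogeneous blk3 d (\<psi> w)"
    using \<psi>_homogeneous by (metis prod.collapse)
  have "mapply \<psi> (mapply fp x0) \<in> mpoints blk111"
    using x0 by (simp add: mpoints_factor)
  then obtain w where "fst w = b" "mapply \<psi> (mapply fp x0) w \<noteq> 0" unfolding mpoints_def by blast
  then have "fst w = b \<and> \<psi> w \<noteq> 0" by (auto simp: mapply_def ceval_def[symmetric])
  then show "\<exists>w. fst w = b \<and> \<psi> w \<noteq> 0" by (rule exI)
qed

lemma inverse: "inverse_ratmap blk111 blk3 fp \<psi>"
proof -
  have "left_inverse_ratmap blk111 blk3 fp \<psi>"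
    unfolding left_inverse_ratmap_def
  proof (intro conjI ballI impI)
    show "\<exists>x\<in>mpoints blk111. mapply fp x \<in> mpoints blk3 \<and> mapply \<psi> (mapply fp x) \<in> mpoints blk111"
      using x0 mpoints_factor by blast
    fix x assume "mapply \<psi> (mapply fp x) \<in> mpoints blk111"
    then have "\<forall>b. factor x b \<noteq> 0" by (simp add: mpoints_factor)
    then show "same_point blk111 (mapply \<psi> (mapply fp x)) x"
      unfolding same_point_def by (intro exI[of _ "\<lambda>b. 1 / factor x b"]) (auto simp: \<psi>_fp)
  qed
  moreover have "left_inverse_ratmap blk3 blk111 \<psi> fp"
    unfolding left_inverse_ratmap_def
  proof (intro conjI ballI impI)
    let ?y = "mapply fp x0"
    have \<psi>y: "mapply \<psi> ?y \<in> mpoints blk111" using x0 by (simp add: mpoints_factor)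
    moreover have "qc ?y * p0 ?y \<noteq> 0"
      by (simp add: qc_def q0_FF kk_FF p0_FF mapply_fp x0_def LL_def k_nz)
    moreover obtain l where "?y l \<noteq> 0" using x0(2) by (auto simp: mpoints_def)
    ultimately have "mapply fp (mapply \<psi> ?y) l \<noteq> 0"
      unfolding fp_\<psi> by (simp add: \<alpha>_nz \<beta>_nz \<gamma>_nz \<theta>_nz)
    then have "mapply fp (mapply \<psi> ?y) \<in> mpoints blk3" by (auto simp: mpoints_def)
    with \<psi>y x0(2) show "\<exists>y\<in>mpoints blk3. mapply \<psi> y \<in> mpoints blk111 \<and> mapply fp (mapply \<psi> y) \<in> mpoints blk3"
      by blast
    fix y assume "mapply fp (mapply \<psi> y) \<in> mpoints blk3"
    then have "\<exists>l. of_real (\<alpha> $ 0 * \<alpha> $ 1 * \<beta> $ 0 * \<beta> $ 1 * \<gamma> $ 0 * \<gamma> $ 1 * \<theta>) * (qc y * p0 y) * y l \<noteq> 0"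
      unfolding fp_\<psi> by (auto simp: mpoints_def)
    then have "of_real (\<alpha> $ 0 * \<alpha> $ 1 * \<beta> $ 0 * \<beta> $ 1 * \<gamma> $ 0 * \<gamma> $ 1 * \<theta>) * (qc y * p0 y) \<noteq> 0"
      by fastforce
    then show "same_point blk3 (mapply fp (mapply \<psi> y)) y"
      unfolding same_point_def fp_\<psi>
      by (intro exI[of _ "\<lambda>_. 1 / (of_real (\<alpha> $ 0 * \<alpha> $ 1 * \<beta> $ 0 * \<beta> $ 1 * \<gamma> $ 0 * \<gamma> $ 1 * \<theta>) * (qc y * p0 y))"]) simp
  qed
  ultimately show ?thesis
    unfolding inverse_ratmap_def using ratmap_fp ratmap_\<psi> by blast
qed

end

context pyramid
begin

subsection \<open>The intersection of the two quadrics\<close>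

text \<open>On Pi_0 the determinant reduces to - S'_0 T'_0, and S'_1 = - S'_0, T'_1 = - T'_0: the
  plane section of Y_0 splits into the lines s and t.\<close>

lemma S'_T'_zero: "q0 y = 0 \<and> p0 y = 0 \<longleftrightarrow> (S' y 0 = 0 \<and> S' y 1 = 0) \<or> (T' y 0 = 0 \<and> T' y 1 = 0)"
proof -
  have q0: "q0 y = crd 0 0 y * p0 y - S' y 0 * T' y 0"
    by (simp add: q0_def S'_def T'_def p0_def algebra_simps)
  have "p0 y = S' y 0 + S' y 1" "p0 y = T' y 0 + T' y 1"
    by (simp_all add: p0_def S'_def T'_def)
  with q0 show ?thesis by (auto simp: add_eq_0_iff)
qed

lemma q0_rank_one:
  assumes "q0 y = 0"
  obtains S T where "y = pnt (FF S T (\<lambda>i. if i = 0 then 1 else 0))"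
proof -
  have "crd 0 0 y * crd 1 1 y = crd 0 1 y * crd 1 0 y" using assms by (simp add: q0_def)
  from rank_one_sg[of "\<lambda>i j. crd i j y", OF this] obtain S T where ST: "\<And>i j. crd i j y = sg i j * S i * T j"
    by blast
  show ?thesis by (rule that[of S T], rule crd_eqI) (simp add: FF_def ST)
qed

lemma q1_rank_one:
  assumes "q1 y = 0"
  obtains S T where "y = pnt (FF S T (\<lambda>i. if i = 0 then 0 else 1))"
proof -
  \<comment> \<open>If X_ij is a signed product S_i T_j minus c with c = L(S, T), then applying
    \<open>kk\<close> gives kk y = (1 - K) c, which determines c from \<open>y\<close>.\<close>
  define c where "c = kk y / (1 - K)"
  have c: "(1 - K) * c = kk y" using K_neq by (simp add: c_def)
  define N where "N i j = crd i j y + c" for i j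
  have "(1 - K) * (N 0 0 * N 1 1 - N 0 1 * N 1 0) = (1 - K) * q0 y + ((1 - K) * c) * p0 y"
    by (simp add: N_def q0_def p0_def algebra_simps)
  also have "\<dots> = 0" using assms unfolding c by (simp add: q1_def)
  finally have "N 0 0 * N 1 1 = N 0 1 * N 1 0" using K_neq by simp
  from rank_one_sg[OF this] obtain S T where ST: "\<And>i j. N i j = sg i j * S i * T j" by blast
  have "LL S T = kc 0 0 * N 0 0 + kc 0 1 * N 0 1 + kc 1 0 * N 1 0 + kc 1 1 * N 1 1"
    by (simp add: LL_def ST algebra_simps)
  also have "\<dots> = kk y + K * c" by (simp add: N_def kk_def K_def algebra_simps)
  also have "\<dots> = c" unfolding c[symmetric] by (simp add: algebra_simps)
  finally have "LL S T = c" .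
  then have "crd i j y = FF S T (\<lambda>i. if i = 0 then 0 else 1) i j" for i j
    using ST[of i j] by (simp add: FF_def N_def algebra_simps)
  then show ?thesis by (intro that[of S T] crd_eqI) simp
qed

lemma tendsto_pnt_FF:
  assumes "\<And>i. ((\<lambda>t. S t i) \<longlongrightarrow> S0 i) F" "\<And>i. ((\<lambda>t. T t i) \<longlongrightarrow> T0 i) F"
  shows "((\<lambda>t. pnt (FF (S t) (T t) U) l) \<longlongrightarrow> pnt (FF S0 T0 U) l) F"
  unfolding pnt_def FF_def LL_def by (intro tendsto_intros assms)

text \<open>Moving \<open>S 0\<close> and \<open>T 0\<close> linearly gives a curve on the quadric \<open>{q0 = 0}\<close> (for \<open>U 1 = 0\<close>) or
  \<open>{q1 = 0}\<close> (for \<open>U 0 = 0\<close>) along which the other form is a nonzero polynomial in the parameter.\<close>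

lemma vanishing_on_quadric:
  fixes G :: "(4, complex) mpoly"
  assumes G: "\<And>z. q0 z * q1 z = 0 \<Longrightarrow> g z \<noteq> 0 \<Longrightarrow> peval z G = 0"
    and g: "\<And>S T. g (pnt (FF S T U)) = c * ((S 0 + S 1) * (T 0 + T 1) * LL S T)" "c \<noteq> 0"
    and U: "U 0 = 0 \<or> U 1 = 0"
  shows "peval (pnt (FF S T U)) G = 0"
proof -
  define d where "d i = (if i = 0 then 1 else 0 :: complex)" for i :: 2
  define z where "z t = pnt (FF (line S d t) (line T d t) U)" for t
  have z_lim: "((\<lambda>t. z t l) \<longlongrightarrow> pnt (FF S T U) l) (at 0)" for l
    unfolding z_def by (intro tendsto_pnt_FF tendsto_line)
  have "eventually (\<lambda>t. (S 0 + S 1) + t * 1 \<noteq> 0) (at 0)" "eventually (\<lambda>t. (T 0 + T 1) + t * 1 \<noteq> 0) (at 0)"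
    "eventually (\<lambda>t. LL S T + t * (kc 0 0 * T 0 - kc 0 1 * T 1 + kc 0 0 * S 0 - kc 1 0 * S 1) + t\<^sup>2 * kc 0 0 \<noteq> 0) (at 0)"
    by (intro eventually_linear_neq_0 eventually_quadratic_neq_0; simp add: k_nz)+
  then have z_0: "eventually (\<lambda>t. peval (z t) G = 0) (at 0)"
  proof eventually_elim
    case (elim t)
    have "LL (line S d t) (line T d t) = LL S T + t * (kc 0 0 * T 0 - kc 0 1 * T 1 + kc 0 0 * S 0 - kc 1 0 * S 1) + t\<^sup>2 * kc 0 0"
      by (simp add: LL_def line_def d_def algebra_simps power2_eq_square)
    with elim have "g (z t) \<noteq> 0"
      unfolding z_def g(1) using g(2) by (simp add: line_def d_def add_ac)
    moreover have "q0 (z t) * q1 (z t) = 0" unfolding z_def q0_FF q1_FF using U by auto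
    ultimately show ?case by (intro G)
  qed
  have "((\<lambda>t. peval (z t) G) \<longlongrightarrow> peval (pnt (FF S T U)) G) (at 0)"
    by (rule tendsto_peval) (rule z_lim)
  then have "((\<lambda>t. 0) \<longlongrightarrow> peval (pnt (FF S T U)) G) (at (0::complex))"
    by (rule iffD1[OF tendsto_cong[OF z_0]])
  from tendsto_unique[OF trivial_limit_at this tendsto_const] show ?thesis .
qed

end

section \<open>The base locus of the inverse\<close>

context pyramid_inverse
begin

text \<open>Off the intersection \<open>\<psi>\<close> itself has a value. On it, the u-components
  of any representative \<open>G\<close> satisfy - \<gamma>_1 q1 G_1 = \<gamma>_0 q0 G_0, so G_1
  vanishes where q0 = 0 and q1 is nonzero, and by density at \<open>y\<close>; symmetrically for
  G_0.\<close>

lemma base_locus_\<psi>: "base_locus blk3 blk111 \<psi> = {y \<in> mpoints blk3. q0 y = 0 \<and> q1 y = 0}"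
proof (intro subset_antisym subsetI)
  fix y assume y: "y \<in> base_locus blk3 blk111 \<psi>"
  then have "y \<in> mpoints blk3" by (simp add: base_locus_def)
  moreover have "q0 y = 0 \<and> q1 y = 0"
  proof (rule ccontr)
    assume neq: "\<not> (q0 y = 0 \<and> q1 y = 0)"
    \<comment> \<open>If q0 and p0 vanish then so does q1; hence the linear components of
      \<open>\<psi>\<close> have no common zero in a block off the intersection.\<close>
    then have "\<not> (q0 y = 0 \<and> p0 y = 0)" by (auto simp: q1_def)
    with neq have "mapply \<psi> y \<in> mpoints blk111"
      unfolding mpoints_\<psi> S'_T'_zero by (auto simp: U'_def)
    moreover have "ratmap blk3 blk111 (\<lambda>w. cpx (\<psi> w))"
      using ratmap_\<psi> by (simp add: ratmap_def)
    ultimately show False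
      using y unfolding base_locus_def mapply_def by (auto dest!: spec[of _ "\<lambda>w. cpx (\<psi> w)"] simp: mult.commute)
  qed
  ultimately show "y \<in> {y \<in> mpoints blk3. q0 y = 0 \<and> q1 y = 0}" by simp
next
  fix y assume y: "y \<in> {y \<in> mpoints blk3. q0 y = 0 \<and> q1 y = 0}"
  have False
    if G: "\<forall>w w'. fst w = fst w' \<longrightarrow> cpx (\<psi> w) * G w' = cpx (\<psi> w') * G w"
      and nz: "(\<lambda>w. peval y (G w)) \<in> mpoints blk111" for G :: "param \<times> 2 \<Rightarrow> (4, complex) mpoly"
  proof -
    have eq: "- of_real (\<gamma> $ 1) * q1 z * peval z (G (Par_u, 1)) = of_real (\<gamma> $ 0) * q0 z * peval z (G (Par_u, 0))" for z
    proof -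
      have "mapply \<psi> z (Par_u, 0) * peval z (G (Par_u, 1)) = mapply \<psi> z (Par_u, 1) * peval z (G (Par_u, 0))"
        unfolding mapply_def using arg_cong[OF G[rule_format, of "(Par_u, 0)" "(Par_u, 1)"], of "peval z"] by simp
      then have "of_real \<theta> * (- of_real (\<gamma> $ 1) * q1 z * peval z (G (Par_u, 1))) =
          of_real \<theta> * (of_real (\<gamma> $ 0) * q0 z * peval z (G (Par_u, 0)))"
        by (simp add: \<psi>_u U'_def mult_ac)
      then show ?thesis using \<theta>_nz by (simp only: mult_cancel_left of_real_eq_0_iff) auto
    qed
    have "peval y (G (Par_u, 1)) = 0"
    proof -
      obtain S T where ST: "y = pnt (FF S T (\<lambda>i. if i = 0 then 1 else 0))" using q0_rank_one y by blast
      show ?thesis unfolding ST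
      proof (rule vanishing_on_quadric[where g = q1 and c = 1])
        show "peval z (G (Par_u, 1)) = 0" if "q0 z * q1 z = 0" "q1 z \<noteq> 0" for z
          using eq[of z] that \<gamma>_nz by simp
      qed (simp_all add: q1_FF)
    qed
    moreover have "peval y (G (Par_u, 0)) = 0"
    proof -
      obtain S T where ST: "y = pnt (FF S T (\<lambda>i. if i = 0 then 0 else 1))" using q1_rank_one y by blast
      show ?thesis unfolding ST
      proof (rule vanishing_on_quadric[where g = q0 and c = "- 1"])
        show "peval z (G (Par_u, 0)) = 0" if "q0 z * q1 z = 0" "q0 z \<noteq> 0" for z
          using eq[of z] that \<gamma>_nz by simp
      qed (simp_all add: q0_FF algebra_simps)
    qed
    ultimately show False using nz by (auto simp: mpoints_blk111)
  qed
  then show "y \<in> base_locus blk3 blk111 \<psi>" using y unfolding base_locus_def by blast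
qed

end

section \<open>The residual conic and its plane\<close>

context pyramid
begin

definition conic :: "(4 \<Rightarrow> complex) set" where "conic = {y \<in> mpoints blk3. q0 y = 0 \<and> kk y = 0}"

text \<open>The solution S of L(S, T) = 0 for given T, unique up to a factor as det k is nonzero. It
  parametrises the conic by T.\<close>

definition conic_param :: "(2 \<Rightarrow> complex) \<Rightarrow> 2 \<Rightarrow> complex" where
  "conic_param T i = (if i = 0 then kc 1 0 * T 0 - kc 1 1 * T 1 else kc 0 0 * T 0 - kc 0 1 * T 1)"

lemma LL_conic_param: "LL (\<lambda>i. c * conic_param T i) T = 0"
  by (simp add: LL_def conic_param_def algebra_simps)

lemma conic_param_nz:
  assumes "T 0 \<noteq> 0 \<or> T 1 \<noteq> 0"
  shows "conic_param T 0 \<noteq> 0 \<or> conic_param T 1 \<noteq> 0"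
proof (rule ccontr)
  assume "\<not> ?thesis"
  moreover have "(kc 0 0 * kc 1 1 - kc 0 1 * kc 1 0) * T 0 = kc 1 1 * conic_param T 1 - kc 0 1 * conic_param T 0"
    "(kc 0 0 * kc 1 1 - kc 0 1 * kc 1 0) * T 1 = kc 1 0 * conic_param T 1 - kc 0 0 * conic_param T 0"
    by (simp_all add: conic_param_def algebra_simps)
  ultimately show False using assms kc_det by simp
qed

abbreviation cpnt :: "complex \<Rightarrow> (2 \<Rightarrow> complex) \<Rightarrow> 4 \<Rightarrow> complex" where
  "cpnt c T \<equiv> pnt (FF (\<lambda>i. c * conic_param T i) T (\<lambda>i. if i = 0 then 1 else 0))"

lemma crd_cpnt: "crd i j (cpnt c T) = sg i j * (c * conic_param T i) * T j"
  by (simp add: FF_def)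

lemma cpnt_conic:
  assumes "c \<noteq> 0" "T 0 \<noteq> 0 \<or> T 1 \<noteq> 0"
  shows "cpnt c T \<in> conic"
proof -
  from assms(2) obtain j where j: "T j \<noteq> 0" by blast
  from conic_param_nz[OF assms(2)] obtain i where i: "conic_param T i \<noteq> 0" by blast
  have "crd i j (cpnt c T) \<noteq> 0" unfolding crd_cpnt using i j assms(1) by (simp add: sg_def)
  then have "cpnt c T \<in> mpoints blk3" unfolding mpoints_crd by blast
  then show ?thesis by (simp add: conic_def q0_FF kk_FF LL_conic_param)
qed

lemma conic_eq_cpnt:
  assumes "y \<in> conic"
  obtains c T where "c \<noteq> 0" "T 0 \<noteq> 0 \<or> T 1 \<noteq> 0" "y = cpnt c T"
proof -
  have y: "q0 y = 0" "kk y = 0" "y \<in> mpoints blk3" using assms by (auto simp: conic_def)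
  obtain S T where ST: "y = pnt (FF S T (\<lambda>i. if i = 0 then 1 else 0))" using q0_rank_one[OF y(1)] by blast
  have "LL S T = 0" using y(2) by (simp add: ST kk_FF)
  then have eq: "S 0 * conic_param T 1 = S 1 * conic_param T 0"
    by (simp add: LL_def conic_param_def algebra_simps)
  have crd: "crd i j y = sg i j * S i * T j" for i j unfolding ST by (simp add: FF_def)
  from y(3) obtain i j where "crd i j y \<noteq> 0" unfolding mpoints_crd by blast
  then have S: "S 0 \<noteq> 0 \<or> S 1 \<noteq> 0" and T: "T 0 \<noteq> 0 \<or> T 1 \<noteq> 0"
    using two_cases[of i] two_cases[of j] unfolding crd by auto
  have "\<exists>c. S 0 = c * conic_param T 0 \<and> S 1 = c * conic_param T 1"
  proof (cases "conic_param T 0 = 0")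
    case True
    then have "conic_param T 1 \<noteq> 0" using conic_param_nz[OF T] by blast
    then show ?thesis using eq True by (intro exI[of _ "S 1 / conic_param T 1"]) auto
  next
    case False
    then show ?thesis using eq by (intro exI[of _ "S 0 / conic_param T 0"]) (auto simp: field_simps)
  qed
  then obtain c where c: "S 0 = c * conic_param T 0" "S 1 = c * conic_param T 1" by blast
  have "S = (\<lambda>i. c * conic_param T i)" unfolding fun_eq_iff all_2 using c by blast
  moreover have "c \<noteq> 0" using S c by auto
  ultimately show ?thesis using that T ST by blast
qed

lemma conic_closure:
  assumes "W = {y \<in> mpoints blk3. q0 y = 0 \<and> kk y * p0 y = 0} - {y. q0 y = 0 \<and> p0 y = 0}"
  shows "zariski_closure blk3 W = conic"
proof
  define qp where "qp = linear_form (X 0 0) * linear_form (X 1 1) - linear_form (X 0 1) * linear_form (X 1 0)"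
  define kp where "kp = linear_form (k 0 0 *\<^sub>R X 0 0 + k 0 1 *\<^sub>R X 0 1 + k 1 0 *\<^sub>R X 1 0 + k 1 1 *\<^sub>R X 1 1)"
  have "homogeneous blk3 (\<lambda>_. 2) qp" unfolding qp_def
    by (intro homogeneous_diff homogeneous_mult'[OF homogeneous_linear_form homogeneous_linear_form]) simp_all
  moreover have "homogeneous blk3 (\<lambda>_. 1) kp" unfolding kp_def by (rule homogeneous_linear_form)
  moreover have conic: "conic = zero_locus blk3 {qp, kp}"
    by (auto simp: conic_def zero_locus_def ceval_def[symmetric] qp_def kp_def q0_def kk_def crd_def clin_add clin_scaleR)
  moreover have "W \<subseteq> conic" unfolding assms conic_def by auto
  ultimately show "zariski_closure blk3 W \<subseteq> conic"
    unfolding conic by (intro zariski_closure_subset_zero_locus) auto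
  show "conic \<subseteq> zariski_closure blk3 W"
  proof
    fix y assume "y \<in> conic"
    then obtain c T where c: "c \<noteq> 0" and T: "T 0 \<noteq> 0 \<or> T 1 \<noteq> 0" and y: "y = cpnt c T" by (rule conic_eq_cpnt)
    \<comment> \<open>Along the conic p0 is, up to the factor c, a product of two linear forms in T.
      The direction must avoid the zeros of both, so that nearby points of the conic leave Pi_0; the
      second form is not zero since its coefficients are, up to sign, summands of K.\<close>
    have dT_ex: "\<exists>dT. dT 0 + dT 1 \<noteq> 0 \<and> l0 * dT 0 - l1 * dT (1::2) \<noteq> 0" if "l0 \<noteq> 0 \<or> l1 \<noteq> 0" for l0 l1 :: complex
      using that
    proof
      assume "l0 \<noteq> 0" then show ?thesis by (intro exI[of _ "\<lambda>i. if i = 0 then 1 else 0"]) simp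
    next
      assume "l1 \<noteq> 0" then show ?thesis by (intro exI[of _ "\<lambda>i. if i = 0 then 0 else 1"]) simp
    qed
    have "K = (kc 1 0 + kc 0 0) + (kc 1 1 + kc 0 1)" by (simp add: K_def)
    then have "kc 1 0 + kc 0 0 \<noteq> 0 \<or> kc 1 1 + kc 0 1 \<noteq> 0" using K_neq(1) by (metis add_0)
    from dT_ex[OF this]
    obtain dT where dT: "dT 0 + dT 1 \<noteq> 0" "(kc 1 0 + kc 0 0) * dT 0 - (kc 1 1 + kc 0 1) * dT (1::2) \<noteq> 0"
      by blast
    show "y \<in> zariski_closure blk3 W"
    proof (rule zariski_closure_limit[where g = "\<lambda>t. cpnt c (line T dT t)"])
      show "y \<in> mpoints blk3" using \<open>y \<in> conic\<close> by (simp add: conic_def)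
      have "((\<lambda>t. conic_param (line T dT t) i) \<longlongrightarrow> conic_param T i) (at 0)" for i
        using two_cases[of i] by (auto simp: conic_param_def intro!: tendsto_intros tendsto_line)
      then show "((\<lambda>t. cpnt c (line T dT t) l) \<longlongrightarrow> y l) (at 0)" for l
        unfolding y by (intro tendsto_pnt_FF tendsto_line tendsto_mult tendsto_const)
      have "eventually (\<lambda>t. (T 0 + T 1) + t * (dT 0 + dT 1) \<noteq> 0) (at 0)"
        "eventually (\<lambda>t. ((kc 1 0 + kc 0 0) * T 0 - (kc 1 1 + kc 0 1) * T 1) +
          t * ((kc 1 0 + kc 0 0) * dT 0 - (kc 1 1 + kc 0 1) * dT 1) \<noteq> 0) (at 0)"
        by (rule eventually_linear_neq_0[OF dT(1)], rule eventually_linear_neq_0[OF dT(2)])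
      then show "eventually (\<lambda>t. cpnt c (line T dT t) \<in> W) (at 0)"
      proof eventually_elim
        case (elim t)
        have 1: "line T dT t 0 + line T dT t 1 = (T 0 + T 1) + t * (dT 0 + dT 1)"
          by (simp add: line_def algebra_simps)
        have "conic_param (line T dT t) 0 + conic_param (line T dT t) 1 =
            ((kc 1 0 + kc 0 0) * T 0 - (kc 1 1 + kc 0 1) * T 1) +
            t * ((kc 1 0 + kc 0 0) * dT 0 - (kc 1 1 + kc 0 1) * dT 1)"
          by (simp add: line_def conic_param_def algebra_simps)
        moreover have "p0 (cpnt c (line T dT t)) = c * (conic_param (line T dT t) 0 + conic_param (line T dT t) 1) *
            (line T dT t 0 + line T dT t 1)"
          by (simp add: p0_FF algebra_simps)
        ultimately have "p0 (cpnt c (line T dT t)) \<noteq> 0" using elim c 1 by simp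
        moreover have "line T dT t 0 \<noteq> 0 \<or> line T dT t 1 \<noteq> 0" using elim(1) 1 by auto
        then have "cpnt c (line T dT t) \<in> conic" by (intro cpnt_conic c)
        ultimately show ?case unfolding assms by (simp add: conic_def)
      qed
    qed
  qed
qed

text \<open>Pulled back to the parameter T, the form \<open>v\<close> is a binary quadratic form
  that vanishes identically. T = (1, 0) and T = (0, 1) make its two columns multiples a and b of
  those of k, and T = (1, 1) gives (a - b) det k = 0.\<close>

lemma plane_of_conic:
  assumes "conic \<subseteq> plane v" "v \<noteq> 0"
  obtains a where "a \<noteq> 0" "v = a *\<^sub>R kvec"
proof -
  define p where "p i j = v \<bullet> e i j" for i j
  have v: "v = p 0 0 *\<^sub>R X 0 0 + p 0 1 *\<^sub>R X 0 1 + p 1 0 *\<^sub>R X 1 0 + p 1 1 *\<^sub>R X 1 1"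
    using vec_eq_dual[of v] by (simp add: sum_UNIV_2 p_def add.assoc)
  have rel: "of_real (p 0 0) * crd 0 0 y + of_real (p 0 1) * crd 0 1 y + of_real (p 1 0) * crd 1 0 y
      + of_real (p 1 1) * crd 1 1 y = 0" if "y \<in> conic" for y
  proof -
    have "clin v y = 0" using assms(1) that by (auto simp: mem_plane)
    then show ?thesis by (subst (asm) v) (simp add: crd_def clin_add clin_scaleR)
  qed
  have rel': "of_real (p 0 0) * (conic_param T 0 * T 0) + of_real (p 1 1) * (conic_param T 1 * T 1) =
      of_real (p 0 1) * (conic_param T 0 * T 1) + of_real (p 1 0) * (conic_param T 1 * T 0)"
    if "T 0 \<noteq> 0 \<or> T 1 \<noteq> 0" for T
    using rel[OF cpnt_conic[OF one_neq_zero that]] unfolding crd_cpnt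
    by (simp add: algebra_simps)
  have "complex_of_real (p 0 0 * k 1 0) = complex_of_real (p 1 0 * k 0 0)"
    using rel'[of "\<lambda>i. if i = 0 then 1 else 0"] by (simp add: conic_param_def)
  then have 1: "p 0 0 * k 1 0 = p 1 0 * k 0 0" by (simp only: of_real_eq_iff)
  have "complex_of_real (p 0 1 * k 1 1) = complex_of_real (p 1 1 * k 0 1)"
    using rel'[of "\<lambda>i. if i = 0 then 0 else 1"] by (simp add: conic_param_def)
  then have 2: "p 0 1 * k 1 1 = p 1 1 * k 0 1" by (simp only: of_real_eq_iff)
  have "complex_of_real ((p 0 0 - p 0 1) * (k 1 0 - k 1 1)) = complex_of_real ((p 1 0 - p 1 1) * (k 0 0 - k 0 1))"
    using rel'[of "\<lambda>i. 1"] by (simp add: conic_param_def algebra_simps)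
  then have 3: "(p 0 0 - p 0 1) * (k 1 0 - k 1 1) = (p 1 0 - p 1 1) * (k 0 0 - k 0 1)"
    by (simp only: of_real_eq_iff)
  define a b where "a = p 0 0 / k 0 0" and "b = p 0 1 / k 0 1"
  have p: "p 0 0 = a * k 0 0" "p 1 0 = a * k 1 0" "p 0 1 = b * k 0 1" "p 1 1 = b * k 1 1"
    using 1 2 k_nz by (simp_all add: a_def b_def field_simps)
  have "(a - b) * (k 0 0 * k 1 1 - k 0 1 * k 1 0) = 0"
    using 3 unfolding p by algebra
  then have "a = b" using det by simp
  then have "v = a *\<^sub>R kvec" by (subst v) (simp add: p kvec_def algebra_simps)
  then show ?thesis using assms(2) that by auto
qed

lemma plane_conic_conic:
  assumes "v = a *\<^sub>R kvec" "a \<noteq> 0"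
  shows "plane_conic v conic"
  unfolding plane_conic_def
proof (intro conjI exI)
  define qp where "qp = linear_form (X 0 0) * linear_form (X 1 1) - linear_form (X 0 1) * linear_form (X 1 0)"
  have qp: "peval y (cpx qp) = q0 y" for y
    unfolding ceval_def[symmetric] by (simp add: qp_def q0_def crd_def)
  have plane: "y \<in> plane v \<longleftrightarrow> y \<in> mpoints blk3 \<and> kk y = 0" for y
    using assms by (simp add: mem_plane clin_scaleR clin_kvec)
  \<comment> \<open>The matrix diag(k_11, - k_00) satisfies kk = 0 and has nonzero determinant, so
    the quadric cuts out a proper subset of the plane.\<close>
  define y where "y = pnt (\<lambda>i j. if i = 0 \<and> j = 0 then kc 1 1 else if i = 1 \<and> j = 1 then - kc 0 0 else 0)"
  have "q0 y = - kc 1 1 * kc 0 0" "kk y = 0" by (simp_all add: y_def q0_def kk_def)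
  then have y: "q0 y \<noteq> 0" "kk y = 0" by (auto simp: k_nz)
  from \<open>q0 y \<noteq> 0\<close> have "crd 0 0 y \<noteq> 0 \<or> crd 0 1 y \<noteq> 0" unfolding q0_def by auto
  then have "y \<in> mpoints blk3" unfolding mpoints_crd by blast
  with y show "\<exists>x\<in>plane v. peval x (cpx qp) \<noteq> 0" by (intro bexI[of _ y]) (simp_all add: qp plane)
  show "conic = {x \<in> plane v. peval x (cpx qp) = 0}" by (auto simp: qp plane conic_def)
  show "homogeneous blk3 (\<lambda>_. 2) (cpx qp)"
    unfolding qp_def homogeneous_cpx
    by (intro homogeneous_diff homogeneous_mult'[OF homogeneous_linear_form homogeneous_linear_form]) simp_all
  have "clin kvec (pnt (\<lambda>_ _. 1)) = K" by (simp add: clin_kvec kk_def K_def)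
  then have "kvec \<noteq> 0" using K_neq(1) by (auto simp: clin_def)
  then show "v \<noteq> 0" using assms by simp
qed

end

section \<open>Real forms and linear algebra\<close>

lemma clin_of_real: "clin v (\<lambda>l. of_real (u $ l)) = of_real (v \<bullet> u)"
  by (simp add: clin_def inner_vec_def)

lemma cquad_of_real: "cquad M (\<lambda>l. of_real (u $ l)) = of_real (u \<bullet> (M *v u))"
  by (simp add: cquad_def inner_vec_def matrix_vector_mult_def sum_distrib_left mult_ac)

lemma cquad_add: "cquad (M + N) y = cquad M y + cquad N y"
  and cquad_scaleR: "cquad (c *\<^sub>R M) y = of_real c * cquad M y"
  by (simp_all add: cquad_def distrib_left distrib_right sum.distrib sum_distrib_left mult_ac)

lemma symmetric_form:
  fixes M :: "real^4^4"
  assumes "transpose M = M"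
  shows "x \<bullet> (M *v y) = y \<bullet> (M *v x)"
  by (metis assms dot_lmul_matrix inner_commute transpose_matrix_vector)

text \<open>The image of \<open>M\<close> lies in the span of \<open>u\<close> and \<open>v\<close>.
  A pencil member that splits into two planes is thus excluded by rank three.\<close>

lemma rank_le_2:
  fixes M :: "real^4^4"
  assumes "\<And>x y. x \<bullet> (M *v y) = c * ((u \<bullet> x) * (v \<bullet> y) + (v \<bullet> x) * (u \<bullet> y))"
  shows "rank M \<le> 2"
proof -
  have "M *v y = (c * (v \<bullet> y)) *\<^sub>R u + (c * (u \<bullet> y)) *\<^sub>R v" for y
  proof -
    have "\<forall>x. x \<bullet> (M *v y) = x \<bullet> ((c * (v \<bullet> y)) *\<^sub>R u + (c * (u \<bullet> y)) *\<^sub>R v)"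
      by (simp add: assms inner_add_right inner_commute algebra_simps)
    then show ?thesis using vector_eq_ldot by blast
  qed
  then have "range (\<lambda>y. M *v y) \<subseteq> span {u, v}"
    by (auto intro!: span_add span_scale intro: span_base)
  then have "dim (range (\<lambda>y. M *v y)) \<le> dim {u, v}"
    by (metis dim_span dim_subset)
  also have "\<dots> \<le> card {u, v}" by (rule dim_le_card) (auto simp: span_base subset_iff)
  also have "\<dots> \<le> 2" by (simp add: card_insert_if)
  finally show ?thesis by (simp add: rank_dim_range)
qed

text \<open>Three of the vectors span at most dimension three, so some nonzero covector kills them;
  it cannot kill the fourth as well, and normalised it is a dual vector.\<close>

lemma dual_frame:
  fixes p :: "2 \<Rightarrow> 2 \<Rightarrow> real^4"
  assumes inj: "\<And>m. (\<And>i j. m \<bullet> p i j = 0) \<Longrightarrow> m = 0"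
  obtains X where "frame p X"
proof -
  have "\<exists>m. m \<bullet> p i j = 1 \<and> (\<forall>i' j'. (i', j') \<noteq> (i, j) \<longrightarrow> m \<bullet> p i' j' = 0)" for i j
  proof -
    let ?S = "(\<lambda>(i', j'). p i' j') ` (UNIV - {(i, j)})"
    have "card ?S \<le> card (UNIV - {(i, j)} :: (2 \<times> 2) set)" by (rule card_image_le) simp
    also have "\<dots> = 3" by (simp add: card_Diff_singleton)
    finally have "card ?S \<le> 3" .
    moreover have "dim ?S \<le> card ?S" by (rule dim_le_card') simp
    ultimately have dim: "dim ?S < DIM(real^4)" by simp
    obtain m where m: "m \<noteq> 0" "\<And>y. y \<in> span ?S \<Longrightarrow> orthogonal m y"
      using orthogonal_to_subspace_exists[OF dim] by metis
    have 0: "m \<bullet> p i' j' = 0" if "(i', j') \<noteq> (i, j)" for i' j'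
    proof -
      have "p i' j' \<in> ?S" using that by force
      then have "p i' j' \<in> span ?S" by (rule span_base)
      then have "orthogonal m (p i' j')" by (rule m(2))
      then show ?thesis by (simp only: orthogonal_def)
    qed
    have "m \<bullet> p i j \<noteq> 0" 
    proof
      assume "m \<bullet> p i j = 0"
      then have "m \<bullet> p i' j' = 0" for i' j' using 0[of i' j'] by (cases "(i', j') = (i, j)") auto
      then show False using inj[of m] m(1) by blast
    qed
    then show ?thesis using 0 by (intro exI[of _ "(1 / (m \<bullet> p i j)) *\<^sub>R m"]) auto
  qed
  then obtain X where X: "\<And>i j. X i j \<bullet> p i j = 1" "\<And>i j i' j'. (i', j') \<noteq> (i, j) \<Longrightarrow> X i j \<bullet> p i' j' = 0"
    by moura
  have dual: "X i j \<bullet> p i' j' = (if i = i' \<and> j = j' then 1 else 0)" for i j i' j'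
    using X by auto
  have m: "m = (\<Sum>i\<in>UNIV. \<Sum>j\<in>UNIV. (m \<bullet> p i j) *\<^sub>R X i j)" for m
  proof -
    have "(m - (\<Sum>i\<in>UNIV. \<Sum>j\<in>UNIV. (m \<bullet> p i j) *\<^sub>R X i j)) \<bullet> p i' j' = 0" for i' j'
      using two_cases[of i'] two_cases[of j']
      by (auto simp: sum_UNIV_2 inner_diff_left inner_add_left dual)
    from inj[OF this] show ?thesis by simp
  qed
  have "v = (\<Sum>i\<in>UNIV. \<Sum>j\<in>UNIV. (X i j \<bullet> v) *\<^sub>R p i j)" for v
  proof -
    have "m \<bullet> v = m \<bullet> (\<Sum>i\<in>UNIV. \<Sum>j\<in>UNIV. (X i j \<bullet> v) *\<^sub>R p i j)" for m
    proof -
      have "m \<bullet> v = (\<Sum>i\<in>UNIV. \<Sum>j\<in>UNIV. (m \<bullet> p i j) *\<^sub>R X i j) \<bullet> v" using m[of m] by simp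
      then show ?thesis by (simp add: inner_sum_right inner_sum_left mult.commute)
    qed
    then have "\<forall>m. m \<bullet> v = m \<bullet> (\<Sum>i\<in>UNIV. \<Sum>j\<in>UNIV. (X i j \<bullet> v) *\<^sub>R p i j)" ..
    from iffD1[OF vector_eq_ldot this] show ?thesis .
  qed
  with dual have "frame p X" by unfold_locales
  then show ?thesis by (rule that)
qed

section \<open>Quadratic forms that vanish on the Segre quadric\<close>

context frame
begin

text \<open>The polar form of \<open>q0\<close> on real vectors; on the diagonal it is twice the
  determinant, hence the factor 2 for \<open>cquad\<close> below.\<close>

definition b0 :: "real^4 \<Rightarrow> real^4 \<Rightarrow> real" where
  "b0 x y = (X 0 0 \<bullet> x) * (X 1 1 \<bullet> y) + (X 1 1 \<bullet> x) * (X 0 0 \<bullet> y)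
     - (X 0 1 \<bullet> x) * (X 1 0 \<bullet> y) - (X 1 0 \<bullet> x) * (X 0 1 \<bullet> y)"

text \<open>The quadric determines its equation up to a scalar. The four vertices kill the diagonal
  of the polar form, the rulings joining neighbouring vertices kill four mixed entries, and the
  point S = T = (1, 1) makes the last two entries opposite.\<close>

lemma form_vanishing_on_Segre:
  assumes sym: "transpose M = M"
    and zero: "\<And>S T. cquad M (pnt (\<lambda>i j. sg i j * S i * T j)) = 0"
  obtains \<rho> where "\<And>x y. x \<bullet> (M *v y) = \<rho> * b0 x y" "\<And>y. cquad M y = of_real (2 * \<rho>) * q0 y"
proof -
  define B where "B x y = x \<bullet> (M *v y)" for x y
  have B_sym: "B x y = B y x" for x y unfolding B_def by (rule symmetric_form[OF sym])
  have B_simps: "B (x + x') y = B x y + B x' y" "B x (y + y') = B x y + B x y'"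
    "B (c *\<^sub>R x) y = c * B x y" "B x (c *\<^sub>R y) = c * B x y" "B (- x) y = - B x y" "B x (- y) = - B x y"
    "B (x - x') y = B x y - B x' y" "B x (y - y') = B x y - B x y'" for x x' y y' c
    by (simp_all add: B_def inner_add_left inner_add_right inner_diff_left inner_diff_right
        matrix_vector_right_distrib matrix_vector_mult_scaleR matrix_vector_mult_diff_distrib
        linear_neg[OF matrix_vector_mul_linear])
  have B0: "B v v = 0" if "v = (S 0 * T 0) *\<^sub>R e 0 0 - (S 0 * T 1) *\<^sub>R e 0 1 - (S 1 * T 0) *\<^sub>R e 1 0 + (S 1 * T 1) *\<^sub>R e 1 1"
    for v and S T :: "2 \<Rightarrow> real"
  proof -
    have "pnt (\<lambda>i j. sg i j * of_real (S i) * of_real (T j)) = (\<lambda>l. of_real (v $ l))"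
      by (auto simp: that pnt_def sum_UNIV_2 sg_def)
    with zero[of "\<lambda>i. of_real (S i)" "\<lambda>i. of_real (T i)"] have "complex_of_real (B v v) = 0"
      by (simp add: B_def cquad_of_real)
    then show ?thesis by simp
  qed
  let ?v = "\<lambda>a b i. if i = (0::2) then a else b :: real"
  have d: "B (e 0 0) (e 0 0) = 0" "B (e 0 1) (e 0 1) = 0" "B (e 1 0) (e 1 0) = 0" "B (e 1 1) (e 1 1) = 0"
    using B0[OF refl, of "?v 1 0" "?v 1 0"] B0[OF refl, of "?v 1 0" "?v 0 1"]
      B0[OF refl, of "?v 0 1" "?v 1 0"] B0[OF refl, of "?v 0 1" "?v 0 1"]
    by (simp_all add: B_simps)
  have o: "B (e 0 0) (e 0 1) = 0" "B (e 0 0) (e 1 0) = 0" "B (e 0 1) (e 1 1) = 0" "B (e 1 0) (e 1 1) = 0"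
    using B0[OF refl, of "?v 1 0" "?v 1 1"] B0[OF refl, of "?v 1 1" "?v 1 0"]
      B0[OF refl, of "?v 1 1" "?v 0 1"] B0[OF refl, of "?v 0 1" "?v 1 1"] d
    by (simp_all add: B_simps B_sym[of "e 0 1" "e 0 0"] B_sym[of "e 1 0" "e 0 0"]
        B_sym[of "e 1 1" "e 0 1"] B_sym[of "e 1 1" "e 1 0"])
  note s = B_sym[of "e 0 1" "e 0 0"] B_sym[of "e 1 0" "e 0 0"] B_sym[of "e 1 1" "e 0 1"]
    B_sym[of "e 1 1" "e 1 0"] B_sym[of "e 1 1" "e 0 0"] B_sym[of "e 1 0" "e 0 1"]
  have m: "B (e 0 1) (e 1 0) = - B (e 0 0) (e 1 1)"
    using B0[OF refl, of "?v 1 1" "?v 1 1"] by (simp add: B_simps d o s)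
  define \<rho> where "\<rho> = B (e 0 0) (e 1 1)"
  have eq: "x \<bullet> (M *v y) = \<rho> * b0 x y" for x y
  proof -
    have x: "x = (X 0 0 \<bullet> x) *\<^sub>R e 0 0 + (X 0 1 \<bullet> x) *\<^sub>R e 0 1 + (X 1 0 \<bullet> x) *\<^sub>R e 1 0 + (X 1 1 \<bullet> x) *\<^sub>R e 1 1" for x
      using basis[of x] by (simp add: sum_UNIV_2 add.assoc)
    have "B x y = B ((X 0 0 \<bullet> x) *\<^sub>R e 0 0 + (X 0 1 \<bullet> x) *\<^sub>R e 0 1 + (X 1 0 \<bullet> x) *\<^sub>R e 1 0 + (X 1 1 \<bullet> x) *\<^sub>R e 1 1)
       ((X 0 0 \<bullet> y) *\<^sub>R e 0 0 + (X 0 1 \<bullet> y) *\<^sub>R e 0 1 + (X 1 0 \<bullet> y) *\<^sub>R e 1 0 + (X 1 1 \<bullet> y) *\<^sub>R e 1 1)"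
      using x[of x] x[of y] by simp
    also have "\<dots> = \<rho> * b0 x y"
      by (simp add: B_simps d o s m \<rho>_def[symmetric] b0_def algebra_simps)
    finally show ?thesis by (simp add: B_def)
  qed
  have M: "M $ l $ m = \<rho> * b0 (axis l 1) (axis m 1)" for l m
    unfolding eq[symmetric] by (simp add: inner_axis' matrix_vector_mul_component inner_axis)
  have "cquad M y = of_real (2 * \<rho>) * q0 y" for y
  proof -
    have prod: "crd i j y * crd i' j' y = (\<Sum>l\<in>UNIV. \<Sum>m\<in>UNIV. of_real (X i j $ l * X i' j' $ m) * y l * y m)" for i j i' j'
      unfolding crd_def clin_def sum_product by (intro sum.cong refl) simp
    have "cquad M y = (\<Sum>l\<in>UNIV. \<Sum>m\<in>UNIV. of_real \<rho> * (of_real (X 0 0 $ l * X 1 1 $ m) * y l * y m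
        + of_real (X 1 1 $ l * X 0 0 $ m) * y l * y m - of_real (X 0 1 $ l * X 1 0 $ m) * y l * y m
        - of_real (X 1 0 $ l * X 0 1 $ m) * y l * y m))"
      unfolding cquad_def M b0_def inner_axis by (intro sum.cong refl) (simp add: algebra_simps)
    also have "\<dots> = of_real \<rho> * (crd 0 0 y * crd 1 1 y + crd 1 1 y * crd 0 0 y
        - crd 0 1 y * crd 1 0 y - crd 1 0 y * crd 0 1 y)"
      unfolding prod by (simp only: sum_distrib_left[symmetric] sum.distrib sum_subtractf)
    finally show ?thesis by (simp add: q0_def algebra_simps)
  qed
  with eq show ?thesis by (rule that)
qed

end

section \<open>Boundary surfaces\<close>

lemma mapply_trilinear: "mapply (trilinear w P) x l = (\<Sum>i\<in>UNIV. \<Sum>j\<in>UNIV. \<Sum>k\<in>UNIV.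
    of_real (w i j k * P i j k $ l) * x (Par_s, i) * x (Par_t, j) * x (Par_u, k))"
  by (simp add: mapply_def ceval_def[symmetric] trilinear_def)

lemma image_in_boundary_surface:
  assumes "x \<in> mpoints blk111" "\<And>i'. i' \<noteq> i \<Longrightarrow> x (b, i') = 0" "mapply (trilinear w P) x \<in> mpoints blk3"
  shows "mapply (trilinear w P) x \<in> boundary_surface w P b i"
  unfolding boundary_surface_def using assms
  by (intro subsetD[OF subset_zariski_closure]) auto

text \<open>A covector that kills the four weighted control points puts the whole surface into a
  plane. Keeping the weights in the hypothesis yields later both the independence of the points and
  that no weight is zero.\<close>

lemma boundary_quadric_independent:
  assumes "smooth_surface 2 (boundary_surface w P Par_u k)" "\<And>i j. m \<bullet> (w i j k *\<^sub>R P i j k) = 0"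
  shows "m = 0"
proof (rule smooth_quadric_not_in_plane[OF assms(1)])
  have "clin m (mapply (trilinear w P) x) = 0" if "\<And>k'. k' \<noteq> k \<Longrightarrow> x (Par_u, k') = 0" for x
  proof -
    have mP: "(\<Sum>l\<in>UNIV. of_real (m $ l) * (of_real (w i j k * P i j k $ l) * c)) = 0" for i j c
    proof -
      have "(\<Sum>l\<in>UNIV. of_real (m $ l) * (of_real (w i j k * P i j k $ l) * c)) = of_real (m \<bullet> (w i j k *\<^sub>R P i j k)) * c"
        by (simp add: inner_vec_def sum_distrib_left sum_distrib_right mult_ac)
      then show ?thesis unfolding assms(2) by simp
    qed
    have "of_real (w i j k' * P i j k' $ l) * x (Par_s, i) * x (Par_t, j) * x (Par_u, k') =
        (if k' = k then of_real (w i j k * P i j k $ l) * (x (Par_s, i) * x (Par_t, j) * x (Par_u, k)) else 0)" for i j k' l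
      using that[of k'] by auto
    then have "mapply (trilinear w P) x l = (\<Sum>i\<in>UNIV. \<Sum>j\<in>UNIV.
        of_real (w i j k * P i j k $ l) * (x (Par_s, i) * x (Par_t, j) * x (Par_u, k)))" for l
      unfolding mapply_trilinear by simp
    then show ?thesis
      unfolding clin_def by (simp only: sum_UNIV_2 distrib_left sum.distrib mP add_0)
  qed
  then show "boundary_surface w P Par_u k \<subseteq> plane m"
    unfolding boundary_surface_def plane_def using homogeneous_linear_form
    by (intro zariski_closure_subset_zero_locus) (auto simp: zero_locus_def ceval_def[symmetric])
qed

lemma vertex_in_boundary_surfaces:
  assumes "w i j k \<noteq> 0" "P i j k \<noteq> 0" "boundary_surface w P b n = plane v"
    and "n = (case b of Par_s \<Rightarrow> i | Par_t \<Rightarrow> j | Par_u \<Rightarrow> k)"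
  shows "v \<bullet> P i j k = 0"
proof -
  \<comment> \<open>The vertex of the parameter cube that the map sends to w_ijk P_ijk.\<close>
  define x where "x = (\<lambda>(b, m). if m = (case b of Par_s \<Rightarrow> i | Par_t \<Rightarrow> j | Par_u \<Rightarrow> k) then 1 else 0 :: complex)"
  have fx: "mapply (trilinear w P) x = (\<lambda>l. of_real ((w i j k *\<^sub>R P i j k) $ l))"
  proof
    fix l
    show "mapply (trilinear w P) x l = of_real ((w i j k *\<^sub>R P i j k) $ l)"
      using two_cases[of i] two_cases[of j] two_cases[of k]
      by (auto simp: mapply_trilinear sum_UNIV_2 x_def)
  qed
  obtain l where "P i j k $ l \<noteq> 0" using assms(2) by (auto simp: vec_eq_iff)
  then have "mapply (trilinear w P) x l \<noteq> 0" using assms(1) by (simp add: fx)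
  then have "mapply (trilinear w P) x \<in> mpoints blk3" by (auto simp: mpoints_def)
  moreover have "x \<in> mpoints blk111"
    using two_cases[of i] two_cases[of j] two_cases[of k] by (auto simp: mpoints_blk111 all_param x_def)
  moreover have "x (b, i') = 0" if "i' \<noteq> n" for i' using that assms(4) by (simp add: x_def)
  ultimately have "mapply (trilinear w P) x \<in> plane v"
    using image_in_boundary_surface assms(3) by blast
  then have "complex_of_real (v \<bullet> (w i j k *\<^sub>R P i j k)) = 0" unfolding fx mem_plane clin_of_real by blast
  then show ?thesis using assms(1) by simp
qed

section \<open>Reduction to the normal form\<close>

lemma reduction_to_frame:
  fixes P :: "2 \<Rightarrow> 2 \<Rightarrow> 2 \<Rightarrow> real^4"
  assumes P0: "\<And>i j k. P i j k $ 0 = 1" and P_neq: "\<And>i j. P i j 0 \<noteq> P i j 1"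
    and indep: "\<And>m k. (\<And>i j. m \<bullet> P i j k = 0) \<Longrightarrow> m = 0"
    and \<sigma>: "\<And>i j k. \<sigma> i \<bullet> P i j k = 0" and \<tau>: "\<And>i j k. \<tau> j \<bullet> P i j k = 0"
    and \<pi>_\<sigma>: "\<pi> = lam $ 0 *\<^sub>R \<sigma> 0 + lam $ 1 *\<^sub>R \<sigma> 1" and \<pi>_\<tau>: "\<pi> = \<mu> $ 0 *\<^sub>R \<tau> 0 + \<mu> $ 1 *\<^sub>R \<tau> 1"
    and \<pi>: "\<And>i j k. \<pi> \<bullet> P i j k \<noteq> 0"
    and A: "\<And>i j. A \<in> proj_line (P i j 0) (P i j 1)"
  obtains e X k \<kappa> where "frame e X" "\<kappa> \<noteq> 0"
    "lam $ 1 *\<^sub>R \<sigma> 1 = X 0 0 - X 0 1" "lam $ 0 *\<^sub>R \<sigma> 0 = X 1 1 - X 1 0"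
    "\<mu> $ 1 *\<^sub>R \<tau> 1 = X 0 0 - X 1 0" "\<mu> $ 0 *\<^sub>R \<tau> 0 = X 1 1 - X 0 1"
    "A = (\<lambda>l. \<kappa> * of_real ((\<Sum>i\<in>UNIV. \<Sum>j\<in>UNIV. e i j) $ l))"
    "\<And>i j. (1 / (\<pi> \<bullet> P i j 0)) *\<^sub>R P i j 0 = (if i = j then 1 else - 1) *\<^sub>R e i j"
    "\<And>i j. (1 / (\<pi> \<bullet> P i j 1)) *\<^sub>R P i j 1 =
       (if i = j then 1 else - 1) *\<^sub>R (e i j - k i j *\<^sub>R (\<Sum>i\<in>UNIV. \<Sum>j\<in>UNIV. e i j))"
    "\<And>i j. k i j \<noteq> 0" "k 0 0 + k 0 1 + k 1 0 + k 1 1 \<noteq> 1"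
proof -
  define s where "s i j = (if i = j then 1 else - 1 :: real)" for i j :: 2
  have s [simp]: "s 0 0 = 1" "s 0 1 = - 1" "s 1 0 = - 1" "s 1 1 = 1" by (simp_all add: s_def)
  have s_nz: "s i j \<noteq> 0" and ss: "s i j * s i j = 1" for i j by (simp_all add: s_def)
  define e where "e i j = (s i j / (\<pi> \<bullet> P i j 0)) *\<^sub>R P i j 0" for i j
  obtain X where "frame e X"
  proof (rule dual_frame)
    fix m assume "\<And>i j. m \<bullet> e i j = 0"
    then show "m = 0" using indep[of m 0] \<pi> s_nz by (simp add: e_def)
  qed
  then interpret frame e X .
  define E where "E = (\<Sum>i\<in>UNIV. \<Sum>j\<in>UNIV. e i j)"
  have coeffs: "v = a *\<^sub>R X 0 0 + b *\<^sub>R X 0 1 + c *\<^sub>R X 1 0 + d *\<^sub>R X 1 1"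
    if "v \<bullet> e 0 0 = a" "v \<bullet> e 0 1 = b" "v \<bullet> e 1 0 = c" "v \<bullet> e 1 1 = d" for v a b c d
    using vec_eq_dual[of v] that by (simp add: sum_UNIV_2 add.assoc)
  have \<pi>e: "\<pi> \<bullet> e i j = s i j" for i j using \<pi> by (simp add: e_def)
  have \<sigma>e: "\<sigma> i \<bullet> e i j = 0" and \<tau>e: "\<tau> j \<bullet> e i j = 0" for i j by (simp_all add: e_def \<sigma> \<tau>)
  have "(lam $ 0 *\<^sub>R \<sigma> 0) \<bullet> e 1 j = \<pi> \<bullet> e 1 j" "(lam $ 1 *\<^sub>R \<sigma> 1) \<bullet> e 0 j = \<pi> \<bullet> e 0 j" for j
    unfolding \<pi>_\<sigma> inner_add_left by (simp_all add: \<sigma>e)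
  moreover have "(\<mu> $ 0 *\<^sub>R \<tau> 0) \<bullet> e i 1 = \<pi> \<bullet> e i 1" "(\<mu> $ 1 *\<^sub>R \<tau> 1) \<bullet> e i 0 = \<pi> \<bullet> e i 0" for i
    unfolding \<pi>_\<tau> inner_add_left by (simp_all add: \<tau>e)
  ultimately have l0: "(lam $ 0 *\<^sub>R \<sigma> 0) \<bullet> e 1 j = s 1 j" and l1: "(lam $ 1 *\<^sub>R \<sigma> 1) \<bullet> e 0 j = s 0 j"
    and m0: "(\<mu> $ 0 *\<^sub>R \<tau> 0) \<bullet> e i 1 = s i 1" and m1: "(\<mu> $ 1 *\<^sub>R \<tau> 1) \<bullet> e i 0 = s i 0" for i j
    by (simp_all only: \<pi>e)
  have z: "(lam $ 1 *\<^sub>R \<sigma> 1) \<bullet> e 1 j = 0" "(lam $ 0 *\<^sub>R \<sigma> 0) \<bullet> e 0 j = 0"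
    "(\<mu> $ 1 *\<^sub>R \<tau> 1) \<bullet> e i 1 = 0" "(\<mu> $ 0 *\<^sub>R \<tau> 0) \<bullet> e i 0 = 0" for i j
    by (simp_all add: \<sigma>e \<tau>e)
  have X_eqs: "lam $ 1 *\<^sub>R \<sigma> 1 = X 0 0 - X 0 1" "lam $ 0 *\<^sub>R \<sigma> 0 = X 1 1 - X 1 0"
    "\<mu> $ 1 *\<^sub>R \<tau> 1 = X 0 0 - X 1 0" "\<mu> $ 0 *\<^sub>R \<tau> 0 = X 1 1 - X 0 1"
    using coeffs[OF l1[of 0] l1[of 1] z(1)[of 0] z(1)[of 1]] coeffs[OF z(2)[of 0] z(2)[of 1] l0[of 0] l0[of 1]]
      coeffs[OF m1[of 0] z(3)[of 0] m1[of 1] z(3)[of 1]] coeffs[OF z(4)[of 0] m0[of 0] z(4)[of 1] m0[of 1]]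
    by (simp_all only: s scaleR_one scaleR_minus_left scaleR_zero_left) simp_all
  have "\<exists>a b. A = (\<lambda>l. a * of_real (P i j 0 $ l) + b * of_real (P i j 1 $ l))" for i j
    using A[of i j] by (auto simp: proj_line_def fun_eq_iff)
  then obtain a b where Aab: "\<And>i j. A = (\<lambda>l. a i j * of_real (P i j 0 $ l) + b i j * of_real (P i j 1 $ l))"
    by metis
  have A_nz: "A \<noteq> (\<lambda>_. 0)" using A[of 0 0] by (auto simp: proj_line_def mpoints_def)
  have clin_A: "clin v A = a i j * of_real (v \<bullet> P i j 0) + b i j * of_real (v \<bullet> P i j 1)" for v i j
    by (subst Aab[of i j]) (simp add: clin_def inner_vec_def distrib_left sum.distrib sum_distrib_left mult_ac)
  have "clin (\<sigma> i) A = 0" "clin (\<tau> i) A = 0" for i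
    unfolding clin_A[of "\<sigma> i" i 0] clin_A[of "\<tau> i" 0 i] by (simp_all add: \<sigma> \<tau>)
  then have "clin (lam $ 1 *\<^sub>R \<sigma> 1) A = 0" "clin (lam $ 0 *\<^sub>R \<sigma> 0) A = 0" "clin (\<mu> $ 1 *\<^sub>R \<tau> 1) A = 0"
    by (simp_all add: clin_scaleR)
  then have crd_A: "crd 0 1 A = crd 0 0 A" "crd 1 1 A = crd 0 0 A" "crd 1 0 A = crd 0 0 A"
    unfolding X_eqs clin_diff by (simp_all add: crd_def)
  define \<kappa> where "\<kappa> = crd 0 0 A"
  have "crd i j A = \<kappa>" for i j
    using two_cases[of i] two_cases[of j] crd_A by (auto simp: \<kappa>_def)
  then have "A = pnt (\<lambda>_ _. \<kappa>)" using pnt_crd[of A] by simp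
  then have A_E: "A = (\<lambda>l. \<kappa> * of_real (E $ l))"
    by (auto simp: pnt_def E_def sum_UNIV_2 algebra_simps)
  then have "\<kappa> \<noteq> 0" using A_nz by auto
  have "clin \<pi> A = 0"
    unfolding \<pi>_\<sigma> clin_add using \<open>clin (lam $ 1 *\<^sub>R \<sigma> 1) A = 0\<close> \<open>clin (lam $ 0 *\<^sub>R \<sigma> 0) A = 0\<close> by simp
  then have ab: "a i j * of_real (\<pi> \<bullet> P i j 0) + b i j * of_real (\<pi> \<bullet> P i j 1) = 0" for i j
    unfolding clin_A[of \<pi> i j] .
  have b_nz: "b i j \<noteq> 0" and a_nz: "a i j \<noteq> 0" for i j
  proof -
    have "a i j = 0 \<longleftrightarrow> b i j = 0" using ab[of i j] \<pi> by auto
    moreover have "\<not> (a i j = 0 \<and> b i j = 0)"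
    proof
      assume "a i j = 0 \<and> b i j = 0"
      then have "A = (\<lambda>_. 0)" by (subst Aab[of i j]) simp
      then show False using A_nz by simp
    qed
    ultimately show "b i j \<noteq> 0" "a i j \<noteq> 0" by auto
  qed
  \<comment> \<open>As A lies on Pi_0, the control points scaled to have \<open>\<pi>\<close>-value
    1 differ by a multiple of A, and z is this multiple in terms of \<open>E\<close>. It is complex
    a priori, but the vectors are real, so its real part serves.\<close>
  define z where "z i j = \<kappa> / (a i j * of_real (\<pi> \<bullet> P i j 0))" for i j
  define k where "k i j = s i j * Re (z i j)" for i j
  have P0_eq: "(1 / (\<pi> \<bullet> P i j 0)) *\<^sub>R P i j 0 = s i j *\<^sub>R e i j" for i j
    by (simp add: e_def ss)
  have P1_eq: "(1 / (\<pi> \<bullet> P i j 1)) *\<^sub>R P i j 1 = s i j *\<^sub>R (e i j - k i j *\<^sub>R E)" for i j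
  proof -
    have "P i j 1 $ l / (\<pi> \<bullet> P i j 1) = P i j 0 $ l / (\<pi> \<bullet> P i j 0) - Re (z i j) * E $ l" for l
    proof -
      let ?p0 = "complex_of_real (\<pi> \<bullet> P i j 0)" and ?p1 = "complex_of_real (\<pi> \<bullet> P i j 1)"
      have nz: "?p0 \<noteq> 0" "?p1 \<noteq> 0" using \<pi> by auto
      have b: "b i j = - a i j * ?p0 / ?p1" using ab[of i j] nz by (simp add: field_simps eq_neg_iff_add_eq_0)
      have "\<kappa> * of_real (E $ l) = a i j * of_real (P i j 0 $ l) + b i j * of_real (P i j 1 $ l)"
        using fun_cong[OF A_E, of l] fun_cong[OF Aab[of i j], of l] by simp
      then have "z i j * of_real (E $ l) = of_real (P i j 0 $ l) / ?p0 - of_real (P i j 1 $ l) / ?p1"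
        using a_nz[of i j] nz unfolding z_def b by (simp add: field_simps)
      then have "Re (z i j * of_real (E $ l)) = Re (of_real (P i j 0 $ l / (\<pi> \<bullet> P i j 0) - P i j 1 $ l / (\<pi> \<bullet> P i j 1)))"
        by simp
      then show ?thesis by simp
    qed
    note eq = this
    have "s i j * (e i j $ l - k i j * E $ l) = P i j 0 $ l / (\<pi> \<bullet> P i j 0) - Re (z i j) * E $ l" for l
      using two_cases[of i] two_cases[of j] by (auto simp: k_def e_def)
    then show ?thesis unfolding vec_eq_iff by (simp add: eq)
  qed
  have k_nz: "k i j \<noteq> 0" for i j
  proof
    assume "k i j = 0"
    then have "(1 / (\<pi> \<bullet> P i j 1)) *\<^sub>R P i j 1 = (1 / (\<pi> \<bullet> P i j 0)) *\<^sub>R P i j 0"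
      unfolding P0_eq P1_eq by simp
    \<comment> \<open>Both control points have first coordinate 1, so if they are proportional they
      are equal.\<close>
    moreover from arg_cong[OF this, of "\<lambda>v. v $ 0"] have "\<pi> \<bullet> P i j 1 = \<pi> \<bullet> P i j 0"
      using \<pi>[of i j 0] \<pi>[of i j 1] by (simp add: P0 field_simps)
    ultimately show False using \<pi>[of i j 0] P_neq[of i j] by simp
  qed
  have "k 0 0 + k 0 1 + k 1 0 + k 1 1 \<noteq> 1"
  proof
    assume K: "k 0 0 + k 0 1 + k 1 0 + k 1 1 = 1"
    \<comment> \<open>This covector has value k_ij at e_ij and, if the k_ij add up to 1, value 1 at
      \<open>E\<close>. It would kill all four e_ij - k_ij E and hence the control points of
      Y_1.\<close>
    define m where "m = k 0 0 *\<^sub>R X 0 0 + k 0 1 *\<^sub>R X 0 1 + k 1 0 *\<^sub>R X 1 0 + k 1 1 *\<^sub>R X 1 1"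
    have me: "m \<bullet> e i j = k i j" for i j
      using two_cases[of i] two_cases[of j] by (auto simp: m_def inner_add_left dual)
    then have "m \<bullet> E = 1" using K by (simp add: E_def sum_UNIV_2 inner_add_right)
    then have "m \<bullet> ((1 / (\<pi> \<bullet> P i j 1)) *\<^sub>R P i j 1) = 0" for i j
      unfolding P1_eq by (simp add: inner_diff_right me)
    then have "m \<bullet> P i j 1 = 0" for i j using \<pi> by simp
    then have "m = 0" by (rule indep)
    then show False using me[of 0 0] k_nz by simp
  qed
  with that[of e X \<kappa> k] \<open>frame e X\<close> \<open>\<kappa> \<noteq> 0\<close> X_eqs A_E P0_eq P1_eq k_nz show ?thesis
    unfolding E_def s_def by blast
qed

section \<open>The frame of the second quadric and the pencil\<close>

context pyramid_frame
begin

definition E :: "real^4" where "E = (\<Sum>i\<in>UNIV. \<Sum>j\<in>UNIV. e i j)"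
definition e1 :: "2 \<Rightarrow> 2 \<Rightarrow> real^4" where "e1 i j = e i j - k i j *\<^sub>R E"
text \<open>\<open>e1\<close> is a rank one perturbation of \<open>e\<close>, so its dual basis is a
  rank one perturbation of \<open>X\<close> (the Sherman-Morrison formula); this is where 1 - K has
  to be invertible.\<close>

definition X1 :: "2 \<Rightarrow> 2 \<Rightarrow> real^4" where "X1 i j = X i j + (1 / (1 - Kr)) *\<^sub>R kvec"
definition pvec :: "real^4" where "pvec = X 0 0 + X 1 1 - X 0 1 - X 1 0"

lemma X_E: "X i j \<bullet> E = 1"
  using two_cases[of i] two_cases[of j] by (auto simp: E_def sum_UNIV_2 inner_add_right dual)

lemma kvec_e: "kvec \<bullet> e i j = k i j"
  using two_cases[of i] two_cases[of j] by (auto simp: kvec_def inner_add_left dual)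

lemma kvec_E: "kvec \<bullet> E = Kr"
  by (simp add: kvec_def inner_add_left X_E)

lemma pvec_E: "pvec \<bullet> E = 0"
  by (simp add: pvec_def inner_add_left inner_diff_left X_E)

lemma clin_pvec: "clin pvec y = p0 y"
  by (simp add: pvec_def p0_def crd_def clin_def algebra_simps sum.distrib sum_subtractf)

lemma frame1: "frame e1 X1"
proof
  define r where "r = 1 / (1 - Kr)"
  have inv: "r * (1 - Kr) = 1" using K_neq_1 by (simp add: r_def)
  show "X1 i j \<bullet> e1 i' j' = (if i = i' \<and> j = j' then 1 else 0)" for i j i' j'
  proof -
    have "X1 i j \<bullet> e1 i' j' = X i j \<bullet> e i' j' - k i' j' + (r * (1 - Kr)) * k i' j'"
      unfolding X1_def e1_def r_def[symmetric]
      by (simp add: inner_add_left inner_diff_right X_E kvec_e kvec_E algebra_simps)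
    then show ?thesis unfolding inv by (simp add: dual)
  qed
  show "v = (\<Sum>i\<in>UNIV. \<Sum>j\<in>UNIV. (X1 i j \<bullet> v) *\<^sub>R e1 i j)" for v
  proof -
    define c where "c = (1 / (1 - Kr)) * (kvec \<bullet> v)"
    have X1v: "X1 i j \<bullet> v = X i j \<bullet> v + c" for i j by (simp add: X1_def inner_add_left c_def)
    have c: "kvec \<bullet> v = c * (1 - Kr)" using K_neq_1 by (simp add: c_def)
    have kv: "kvec \<bullet> v = k 0 0 * (X 0 0 \<bullet> v) + k 0 1 * (X 0 1 \<bullet> v) + k 1 0 * (X 1 0 \<bullet> v) + k 1 1 * (X 1 1 \<bullet> v)"
      by (simp add: kvec_def inner_add_left)
    have "(\<Sum>i\<in>UNIV. \<Sum>j\<in>UNIV. (X1 i j \<bullet> v) *\<^sub>R e1 i j) =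
        (\<Sum>i\<in>UNIV. \<Sum>j\<in>UNIV. (X i j \<bullet> v) *\<^sub>R e i j) + c *\<^sub>R E - (kvec \<bullet> v + c * Kr) *\<^sub>R E"
      unfolding kv X1v by (simp add: e1_def sum_UNIV_2 E_def algebra_simps)
    also have "\<dots> = (\<Sum>i\<in>UNIV. \<Sum>j\<in>UNIV. (X i j \<bullet> v) *\<^sub>R e i j)"
      unfolding c by (simp add: algebra_simps)
    finally show ?thesis using basis[of v] by simp
  qed
qed

lemma crd1: "frame.crd X1 i j y = crd i j y + kk y / (1 - K)"
proof -
  have "complex_of_real (1 / (1 - Kr)) = 1 / (1 - K)"
    unfolding of_real_divide of_real_K by simp
  then show ?thesis
    by (simp only: frame.crd_def[OF frame1] X1_def clin_add clin_scaleR clin_kvec crd_def) simp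
qed

lemma q0_frame1: "(1 - K) * frame.q0 X1 y = q1 y"
proof -
  define c where "c = kk y / (1 - K)"
  have c: "(1 - K) * c = kk y" using one_minus_K_nz by (simp add: c_def)
  have "(1 - K) * frame.q0 X1 y = (1 - K) * q0 y + ((1 - K) * c) * p0 y"
    unfolding frame.q0_def[OF frame1] crd1 c_def[symmetric] by (simp add: q0_def p0_def algebra_simps)
  then show ?thesis unfolding c by (simp add: q1_def)
qed

lemma b0_frame1: "(1 - Kr) * frame.b0 X1 x y = (1 - Kr) * b0 x y + (kvec \<bullet> x) * (pvec \<bullet> y) + (pvec \<bullet> x) * (kvec \<bullet> y)"
proof -
  define r where "r = 1 / (1 - Kr)"
  have r: "(1 - Kr) * r = 1" using K_neq_1 by (simp add: r_def)
  define a b where "a = kvec \<bullet> x" and "b = kvec \<bullet> y"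
  have X1: "X1 i j \<bullet> x = X i j \<bullet> x + r * a" "X1 i j \<bullet> y = X i j \<bullet> y + r * b" for i j
    by (simp_all add: X1_def inner_add_left r_def a_def b_def)
  have "(1 - Kr) * frame.b0 X1 x y = (1 - Kr) * b0 x y + ((1 - Kr) * r) * (a * (pvec \<bullet> y)) + ((1 - Kr) * r) * ((pvec \<bullet> x) * b)"
    unfolding frame.b0_def[OF frame1] X1 b0_def pvec_def inner_add_left inner_diff_left by algebra
  then show ?thesis unfolding r by (simp add: a_def b_def)
qed

text \<open>In the second frame the parametrisation of Y_1 is again that of the Segre quadric, so
  \<open>form_vanishing_on_Segre\<close> determines the form of Y_1 as well.\<close>

lemma pnt_frame1: "frame.pnt e1 (\<lambda>i j. sg i j * S i * T j) = pnt (FF S T (\<lambda>i. if i = 0 then 0 else 1))"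
  by (rule ext) (simp add: frame.pnt_def[OF frame1] pnt_def e1_def E_def sum_UNIV_2 FF_def LL_def algebra_simps)

lemma trilinear_eq_fp:
  assumes "\<And>i j. w i j 0 *\<^sub>R P i j 0 = (\<alpha> $ i * \<beta> $ j * \<gamma> $ 0 * sg i j) *\<^sub>R e i j"
    and "\<And>i j. w i j 1 *\<^sub>R P i j 1 = (\<alpha> $ i * \<beta> $ j * \<gamma> $ 1 * sg i j) *\<^sub>R (e i j - k i j *\<^sub>R E)"
  shows "trilinear w P = fp"
proof
  fix l
  have w0: "w i j 0 * P i j 0 $ l = \<alpha> $ i * \<beta> $ j * \<gamma> $ 0 * sg i j * e i j $ l" for i j
    using arg_cong[OF assms(1)[of i j], of "\<lambda>v. v $ l"] by simp
  have w1: "w i j 1 * P i j 1 $ l = \<alpha> $ i * \<beta> $ j * \<gamma> $ 1 * sg i j *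
      (e i j $ l - k i j * (e 0 0 $ l + e 0 1 $ l + e 1 0 $ l + e 1 1 $ l))" for i j
    using arg_cong[OF assms(2)[of i j], of "\<lambda>v. v $ l"] by (simp add: E_def sum_UNIV_2 add_ac)
  show "trilinear w P l = fp l"
    unfolding trilinear_def fp_def sum_UNIV_2 w0 w1 Fp_def Lp_def Sp_def Tp_def Up_def
    by (simp add: pconst_mult pconst_add pconst_diff pconst_minus algebra_simps)
qed

lemma boundary_quadric_vanishes:
  assumes "trilinear w P = fp" "boundary_surface w P Par_u n = quadric M"
    and U: "U n \<noteq> 0" "\<And>n'. n' \<noteq> n \<Longrightarrow> U n' = 0"
  shows "cquad M (pnt (FF S T U)) = 0"
proof (cases "pnt (FF S T U) \<in> mpoints blk3")
  case False
  then show ?thesis by (simp add: mpoints_blk3 cquad_def)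
next
  case True
  have "S 0 \<noteq> 0 \<or> S 1 \<noteq> 0" "T 0 \<noteq> 0 \<or> T 1 \<noteq> 0"
  proof -
    obtain i j where "FF S T U i j \<noteq> 0" using True unfolding mpoints_crd crd_pnt by blast
    then show "S 0 \<noteq> 0 \<or> S 1 \<noteq> 0" "T 0 \<noteq> 0 \<or> T 1 \<noteq> 0"
      using two_cases[of i] two_cases[of j] by (auto simp: FF_def LL_def)
  qed
  then have "cpt S T U \<in> mpoints blk111" using U two_cases[of n] by (auto simp: mpoints_SS)
  moreover have "cpt S T U (Par_u, n') = 0" if "n' \<noteq> n" for n' using U(2)[OF that] by (simp add: cpt_def)
  ultimately have "mapply (trilinear w P) (cpt S T U) \<in> boundary_surface w P Par_u n"
    using True by (intro image_in_boundary_surface) (simp_all add: assms(1) mapply_fp)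
  then show ?thesis by (simp add: assms mapply_fp mem_quadric)
qed

text \<open>If m = q v is nonzero, there is a real point x of the quadric with m x nonzero. The
  point v + x of the cone then has the value 2 m x instead of 0.\<close>

lemma apex_in_kernel:
  assumes sym: "transpose q = q" and cone: "cone_with_apex (\<lambda>l. \<kappa> * of_real (v $ l)) (quadric q)" and "\<kappa> \<noteq> 0"
  shows "q *v v = 0"
proof (rule ccontr)
  define m where "m = q *v v"
  assume "q *v v \<noteq> 0"
  then have mm: "m \<bullet> m \<noteq> 0" by (simp add: m_def)
  have "cquad q (\<lambda>l. \<kappa> * of_real (v $ l)) = 0" using cone by (simp add: cone_with_apex_def mem_quadric)
  moreover have "cquad q (\<lambda>l. \<kappa> * of_real (v $ l)) = \<kappa> * \<kappa> * cquad q (\<lambda>l. of_real (v $ l))"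
    by (simp add: cquad_def sum_distrib_left mult_ac)
  ultimately have vv: "v \<bullet> m = 0" using \<open>\<kappa> \<noteq> 0\<close> by (simp add: cquad_of_real m_def)
  have xm: "v \<bullet> (q *v x) = m \<bullet> x" for x using symmetric_form[OF sym, of v x] by (simp add: m_def inner_commute)
  \<comment> \<open>Since v is isotropic, the condition that m - r v lies on the quadric is linear
    in r.\<close>
  define r where "r = (m \<bullet> (q *v m)) / (2 * (m \<bullet> m))"
  have r: "2 * r * (m \<bullet> m) = m \<bullet> (q *v m)" using mm by (simp add: r_def)
  define x where "x = m - r *\<^sub>R v"
  have mx: "m \<bullet> x = m \<bullet> m" using vv by (simp add: x_def inner_diff_right inner_commute)
  have "x \<bullet> (q *v x) = 0"
  proof -
    have qx: "q *v x = q *v m - r *\<^sub>R m"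
      unfolding x_def matrix_vector_mult_diff_distrib matrix_vector_mult_scaleR m_def ..
    have "x \<bullet> (q *v x) = m \<bullet> (q *v m) - r * (m \<bullet> m) - r * (v \<bullet> (q *v m)) + r * r * (v \<bullet> m)"
      unfolding qx unfolding x_def by (simp add: inner_diff_left inner_diff_right algebra_simps)
    then show ?thesis using r unfolding xm vv by simp
  qed
  moreover have nz: "(\<lambda>l. complex_of_real (z $ l)) \<in> mpoints blk3" if "m \<bullet> z \<noteq> 0" for z
  proof -
    have "z \<noteq> 0" using that by auto
    then show ?thesis by (auto simp: mpoints_def vec_eq_iff)
  qed
  ultimately have x: "(\<lambda>l. complex_of_real (x $ l)) \<in> quadric q"
    using mm mx by (simp add: mem_quadric cquad_of_real)
  have "(\<lambda>l. (1 / \<kappa>) * (\<kappa> * of_real (v $ l)) + 1 * of_real (x $ l)) = (\<lambda>l. complex_of_real ((v + x) $ l))"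
    using \<open>\<kappa> \<noteq> 0\<close> by auto
  moreover have "m \<bullet> (v + x) \<noteq> 0" using vv mx mm by (simp add: inner_add_right inner_commute)
  ultimately have "(\<lambda>l. complex_of_real ((v + x) $ l)) \<in> quadric q"
    using cone[unfolded cone_with_apex_def, THEN conjunct2, rule_format, OF x, of "1 / \<kappa>" 1] nz[of "v + x"] by simp
  then have "(v + x) \<bullet> (q *v (v + x)) = 0"
    unfolding mem_quadric cquad_of_real of_real_eq_0_iff by (rule conjunct2)
  moreover have "(v + x) \<bullet> (q *v (v + x)) = 2 * (m \<bullet> x)"
    using vv \<open>x \<bullet> (q *v x) = 0\<close>
    by (simp add: matrix_vector_right_distrib inner_add_left inner_add_right xm m_def[symmetric] inner_commute[of x m])
  ultimately show False using mx mm by simp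
qed

text \<open>The cone is the member of the pencil that is singular at \<open>E\<close>; that it has rank three excludes
  the degenerate values of the parameters \<open>k\<close>.\<close>

lemma pencil:
  assumes sym: "transpose u0 = u0" "transpose u1 = u1"
    and u0: "\<And>S T. cquad u0 (pnt (FF S T (\<lambda>i. if i = 0 then 1 else 0))) = 0"
    and u1: "\<And>S T. cquad u1 (pnt (FF S T (\<lambda>i. if i = 0 then 0 else 1))) = 0"
    and q: "q = n0 *\<^sub>R u0 + n1 *\<^sub>R u1" "rank q = 3" "cone_with_apex (\<lambda>l. \<kappa> * of_real (E $ l)) (quadric q)" "\<kappa> \<noteq> 0"
  obtains t where "t \<noteq> 0" "Kr \<noteq> 0" "k 0 0 * k 1 1 - k 0 1 * k 1 0 \<noteq> 0" "n0 \<noteq> 0" "n1 \<noteq> 0"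
    "\<And>y. of_real n0 * cquad u0 y = of_real t * q0 y" "\<And>y. of_real n1 * cquad u1 y = - of_real t * q1 y"
proof -
  have "pnt (FF S T (\<lambda>i. if i = 0 then 1 else 0)) = pnt (\<lambda>i j. sg i j * S i * T j)" for S T
    by (rule arg_cong[of _ _ pnt]) (simp add: fun_eq_iff FF_def)
  with u0 have "cquad u0 (pnt (\<lambda>i j. sg i j * S i * T j)) = 0" for S T by metis
  from form_vanishing_on_Segre[OF sym(1) this] obtain r0
    where r0: "\<And>x y. x \<bullet> (u0 *v y) = r0 * b0 x y" "\<And>y. cquad u0 y = of_real (2 * r0) * q0 y" by blast
  have "cquad u1 (frame.pnt e1 (\<lambda>i j. sg i j * S i * T j)) = 0" for S T
    unfolding pnt_frame1 by (rule u1)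
  from frame.form_vanishing_on_Segre[OF frame1 sym(2) this] obtain r1
    where r1: "\<And>x y. x \<bullet> (u1 *v y) = r1 * frame.b0 X1 x y" "\<And>y. cquad u1 y = of_real (2 * r1) * frame.q0 X1 y"
    by blast
  \<comment> \<open>The coefficients of \<open>q\<close> with respect to the polar form of q0 and to
    that of q1 = (1 - K) q0 + kk p0.\<close>
  define a b where "a = n0 * r0" and "b = n1 * r1 / (1 - Kr)"
  have K1: "1 - Kr \<noteq> 0" using K_neq_1 by simp
  have bK: "b * (1 - Kr) = n1 * r1" using K1 by (simp add: b_def)
  have q_form: "x \<bullet> (q *v y) = (a + b * (1 - Kr)) * b0 x y + b * ((kvec \<bullet> x) * (pvec \<bullet> y) + (pvec \<bullet> x) * (kvec \<bullet> y))" for x y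
  proof -
    have "x \<bullet> (q *v y) = n0 * (r0 * b0 x y) + n1 * (r1 * frame.b0 X1 x y)"
      by (simp add: q(1) matrix_vector_mult_add_rdistrib scaleR_matrix_vector_assoc[symmetric] inner_add_right r0 r1)
    also have "\<dots> = a * b0 x y + b * ((1 - Kr) * frame.b0 X1 x y)"
      unfolding a_def by (simp only: mult.assoc[symmetric] bK)
    finally show ?thesis unfolding b0_frame1 by (simp add: algebra_simps)
  qed
  have q_sym: "transpose q = q"
    using sym by (simp add: q(1) transpose_def vec_eq_iff)
  have qE: "q *v E = 0" by (rule apex_in_kernel[OF q_sym q(3,4)])
  \<comment> \<open>Pairing q E = 0 with \<open>e 0 0\<close> gives a + b (1 - K) + b K = 0, which
    matches the scalars of the two quadrics.\<close>
  have "pvec \<bullet> e 0 0 = 1" by (simp add: pvec_def inner_add_left inner_diff_left dual)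
  moreover have "b0 (e 0 0) E = 1" by (simp add: b0_def X_E dual)
  ultimately have "(a + b * (1 - Kr)) + b * Kr = 0"
    using q_form[of "e 0 0" E] unfolding qE by (simp add: kvec_E pvec_E)
  then have ab: "a = - b" by (simp add: algebra_simps)
  have form: "x \<bullet> (q *v y) = a * (Kr * b0 x y - (kvec \<bullet> x) * (pvec \<bullet> y) - (pvec \<bullet> x) * (kvec \<bullet> y))" for x y
    unfolding q_form ab by (simp add: algebra_simps)
  have "a \<noteq> 0"
  proof
    assume "a = 0"
    then have "x \<bullet> (q *v y) = 0 * ((0 \<bullet> x) * (0 \<bullet> y) + (0 \<bullet> x) * (0 \<bullet> y))" for x y unfolding form by simp
    from rank_le_2[OF this] q(2) show False by simp
  qed
  have "Kr \<noteq> 0"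
  proof
    assume K0: "Kr = 0"
    \<comment> \<open>For K = 0 the cone degenerates to the planes kk = 0 and p0 = 0.\<close>
    have "x \<bullet> (q *v y) = - a * ((kvec \<bullet> x) * (pvec \<bullet> y) + (pvec \<bullet> x) * (kvec \<bullet> y))" for x y
      unfolding form K0 by (simp add: algebra_simps)
    from rank_le_2[OF this] q(2) show False by simp
  qed
  have det: "k 0 0 * k 1 1 - k 0 1 * k 1 0 \<noteq> 0"
  proof
    assume "k 0 0 * k 1 1 - k 0 1 * k 1 0 = 0"
    define n where "n = k 0 1 / k 0 0"
    have k01: "k 0 1 = k 0 0 * n" using k_nz by (simp add: n_def)
    have k11: "k 1 1 = k 1 0 * n"
      using \<open>k 0 0 * k 1 1 - k 0 1 * k 1 0 = 0\<close> k_nz by (simp add: n_def field_simps)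
    \<comment> \<open>For k of rank one L splits as (k_00 S_0 - k_10 S_1)(T_0 - n T_1). With
      \<open>S'\<close> and \<open>T'\<close> inserted, these factors give the two planes of the
      degenerate cone.\<close>
    define u where "u = k 0 0 *\<^sub>R (X 0 0 - X 0 1) - k 1 0 *\<^sub>R (X 1 1 - X 1 0)"
    define v where "v = (X 0 0 - X 1 0) - n *\<^sub>R (X 1 1 - X 0 1)"
    have "x \<bullet> (q *v y) = - a * ((u \<bullet> x) * (v \<bullet> y) + (v \<bullet> x) * (u \<bullet> y))" for x y
      unfolding form b0_def kvec_def pvec_def u_def v_def k01 k11 inner_add_left inner_diff_left inner_scaleR_left
      by algebra
    from rank_le_2[OF this] q(2) show False by simp
  qed
  have "n0 \<noteq> 0" "n1 \<noteq> 0" using \<open>a \<noteq> 0\<close> ab K1 by (auto simp: a_def b_def)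
  moreover have "of_real n0 * cquad u0 y = of_real (2 * a) * q0 y" for y
    by (simp add: r0 a_def)
  moreover have "of_real n1 * cquad u1 y = - of_real (2 * a) * q1 y" for y
  proof -
    have "complex_of_real n1 * cquad u1 y = of_real (2 * (b * (1 - Kr))) * frame.q0 X1 y"
      unfolding bK by (simp add: r1)
    also have "\<dots> = of_real (2 * b) * ((1 - K) * frame.q0 X1 y)"
      unfolding of_real_K[symmetric] by simp
    finally show ?thesis unfolding q0_frame1 ab by simp
  qed
  ultimately show ?thesis using that[of "2 * a"] \<open>a \<noteq> 0\<close> \<open>Kr \<noteq> 0\<close> det by simp
qed

end

text \<open>This exhibits the factorization that defines h and c_0: up to constants they are
  \<open>Lp\<close> and \<open>c0p\<close>.\<close>

lemma (in pyramid) pullback_kvec: "(\<Sum>l\<in>UNIV. pconst (kvec $ l) * fp l) = Lp * c0p"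
proof -
  have "(\<Sum>l\<in>UNIV. pconst (kvec $ l) * fp l) =
      pconst (k 0 0) * Fp 0 0 + pconst (k 0 1) * Fp 0 1 + pconst (k 1 0) * Fp 1 0 + pconst (k 1 1) * Fp 1 1"
    by (simp add: Fp_fp kvec_def pconst_add pconst_mult distrib_right sum.distrib sum_distrib_left mult.assoc)
  also have "\<dots> = Lp * c0p"
    unfolding Fp_def c0p_eq Kp_eq Lp_def by (simp add: algebra_simps)
  finally show ?thesis .
qed

section \<open>Transfer of the normal form to the pyramidal map\<close>

theorem theorem4p10:
  fixes P :: "2 \<Rightarrow> 2 \<Rightarrow> 2 \<Rightarrow> real^4"
    and w :: "2 \<Rightarrow> 2 \<Rightarrow> 2 \<Rightarrow> real"
    and A :: "4 \<Rightarrow> complex"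
    and \<sigma> \<tau> :: "2 \<Rightarrow> real^4"
    and \<upsilon> :: "2 \<Rightarrow> real^4^4"
    and \<pi>\<^sub>0 \<pi>\<^sub>1 :: "real^4"
    and q :: "real^4^4"
    and \<alpha> \<beta> \<gamma> lam \<mu> \<nu> :: "real^2"
    and h c\<^sub>0 :: ring_R
    and f :: "4 \<Rightarrow> ring_R"
    and \<Sigma> T Y :: "2 \<Rightarrow> (4 \<Rightarrow> complex) set"
    and s t C :: "(4 \<Rightarrow> complex) set"
    and a\<^sub>0 b\<^sub>0 c\<^sub>1 :: ring_R
    and \<psi> :: "param \<times> 2 \<Rightarrow> (4, real) mpoly"
  assumes f_def: "f = trilinear w P"
    and \<Sigma>_def: "\<Sigma> = boundary_surface w P Par_s"
    and T_def: "T = boundary_surface w P Par_t"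
    and Y_def: "Y = boundary_surface w P Par_u"
    and s_def: "s = \<Sigma> 0 \<inter> \<Sigma> 1"
    and t_def: "t = T 0 \<inter> T 1"
    and C_def: "C = zariski_closure blk3 ((Y 0 \<inter> Y 1) - (s \<union> t))"
    and a\<^sub>0_def: "a\<^sub>0 = param_form Par_s \<alpha>"
    and b\<^sub>0_def: "b\<^sub>0 = param_form Par_t \<beta>"
    and c\<^sub>1_def: "c\<^sub>1 = param_form Par_u \<gamma>"
    and \<psi>_def: "\<psi> = to_P1_cubed
      (pconst (\<alpha>$1 * lam$1) * linear_form (\<sigma> 1), pconst (\<alpha>$0 * lam$0) * linear_form (\<sigma> 0))
      (pconst (\<beta>$1 * \<mu>$1) * linear_form (\<tau> 1), pconst (\<beta>$0 * \<mu>$0) * linear_form (\<tau> 0))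
      (pconst (\<gamma>$1 * \<nu>$1) * quadratic_form (\<upsilon> 1), pconst (\<gamma>$0 * \<nu>$0) * quadratic_form (\<upsilon> 0))"
    and control_points: "\<And>i j k. P i j k $ 0 = 1"
    and nondegenerate: "nondegenerate w P"
    and pyramidal: "pyramidal_at w P Par_u A"
    and forms_\<sigma>: "\<And>i. \<Sigma> i = plane (\<sigma> i)"
    and forms_\<tau>: "\<And>j. T j = plane (\<tau> j)"
    and forms_\<upsilon>: "\<And>k. Y k = quadric (\<upsilon> k)" "\<And>k. transpose (\<upsilon> k) = \<upsilon> k"
    and plane_\<pi>\<^sub>0: "\<pi>\<^sub>0 \<noteq> 0" "s \<union> t \<subseteq> plane \<pi>\<^sub>0"
    and lam: "lam \<noteq> 0" "\<pi>\<^sub>0 = lam$0 *\<^sub>R \<sigma> 0 + lam$1 *\<^sub>R \<sigma> 1"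
    and \<mu>: "\<mu> \<noteq> 0" "\<pi>\<^sub>0 = \<mu>$0 *\<^sub>R \<tau> 0 + \<mu>$1 *\<^sub>R \<tau> 1"
    and weights: "\<alpha> \<noteq> 0" "\<beta> \<noteq> 0" "\<gamma> \<noteq> 0"
      "\<And>i j k. w i j k = \<alpha>$i * \<beta>$j * \<gamma>$k * (1 / (\<pi>\<^sub>0 \<bullet> P i j k))"
    and plane_\<pi>\<^sub>1: "\<pi>\<^sub>1 \<noteq> 0" "C \<subseteq> plane \<pi>\<^sub>1"
    and cone: "\<nu> \<noteq> 0" "q = \<nu>$0 *\<^sub>R \<upsilon> 0 + \<nu>$1 *\<^sub>R \<upsilon> 1" "rank q = 3"
      "cone_with_apex A (quadric q)" "C \<subseteq> quadric q"
    and factorization: "(\<Sum>l\<in>UNIV. pconst (\<pi>\<^sub>1 $ l) * f l) = h * c\<^sub>0"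
      "homogeneous blk111 (\<lambda>b. if b = Par_u then 0 else 1) h" "irreducible h"
      "homogeneous blk111 (\<lambda>b. if b = Par_u then 1 else 0) c\<^sub>0"
  shows "inverse_ratmap blk111 blk3 f \<psi> \<and>
    same_subscheme blk111 (ideal_gen (range f)) (ideal_gen {a\<^sub>0, b\<^sub>0, c\<^sub>0} \<inter> ideal_gen {h, c\<^sub>1}) \<and>
    base_locus blk3 blk111 \<psi> = Y 0 \<inter> Y 1 \<and>
    Y 0 \<inter> Y 1 = s \<union> t \<union> C \<and> plane_conic \<pi>\<^sub>1 C \<and>
    blows_up blk111 blk3 f (ideal_gen {a\<^sub>0, b\<^sub>0, c\<^sub>0}) (plane \<pi>\<^sub>0) \<and>
    blows_up blk111 blk3 f (ideal_gen {h, c\<^sub>1}) (quadric q)"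
proof -
  have smooth: "smooth_surface 2 (boundary_surface w P Par_u k)" for k
    using pyramidal by (simp add: pyramidal_at_def)
  have indep: "m = 0" if "\<And>i j. m \<bullet> (w i j k *\<^sub>R P i j k) = 0" for m k
    using boundary_quadric_independent[OF smooth that] .
  have w_nz: "w i j k \<noteq> 0" for i j k
  proof -
    \<comment> \<open>The four weighted control points of a boundary quadric form a basis, so none
      of them is zero.\<close>
    obtain X where "frame (\<lambda>i j. w i j k *\<^sub>R P i j k) X" by (rule dual_frame) (rule indep)
    from frame.dual[OF this, of i j i j] show ?thesis by auto
  qed
  \<comment> \<open>Division by zero yields zero, so a nonzero weight also forces its denominator to
    be nonzero.\<close>
  have \<pi>P: "\<pi>\<^sub>0 \<bullet> P i j k \<noteq> 0" and \<alpha>: "\<alpha> $ i \<noteq> 0" and \<beta>: "\<beta> $ j \<noteq> 0" and \<gamma>: "\<gamma> $ k \<noteq> 0" for i j k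
    using w_nz[of i j k] by (auto simp: weights(4))
  have P_nz: "P i j k \<noteq> 0" for i j k
    using control_points[of i j k] by auto
  have \<sigma>P: "\<sigma> i \<bullet> P i j k = 0" for i j k
    by (rule vertex_in_boundary_surfaces[where b = Par_s and n = i, OF w_nz P_nz])
      (use forms_\<sigma>[of i] in \<open>simp_all add: \<Sigma>_def\<close>)
  have \<tau>P: "\<tau> j \<bullet> P i j k = 0" for i j k
    by (rule vertex_in_boundary_surfaces[where b = Par_t and n = j, OF w_nz P_nz])
      (use forms_\<tau>[of j] in \<open>simp_all add: T_def\<close>)
  have P_neq: "P i j 0 \<noteq> P i j 1" for i j
    using nondegenerate unfolding nondegenerate_def by (metis boundary_point.simps(3))
  have A: "A \<in> proj_line (P i j 0) (P i j 1)" for i j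
    using pyramidal unfolding pyramidal_at_def boundary_line_def by (metis boundary_point.simps(3))
  have indep_P: "m = 0" if "\<And>i j. m \<bullet> P i j k = 0" for m k
    by (rule indep[of m k]) (simp add: that)
  obtain e X k \<kappa> where fr: "frame e X" and \<kappa>: "\<kappa> \<noteq> 0"
    and \<sigma>X: "lam $ 1 *\<^sub>R \<sigma> 1 = X 0 0 - X 0 1" "lam $ 0 *\<^sub>R \<sigma> 0 = X 1 1 - X 1 0"
    and \<tau>X: "\<mu> $ 1 *\<^sub>R \<tau> 1 = X 0 0 - X 1 0" "\<mu> $ 0 *\<^sub>R \<tau> 0 = X 1 1 - X 0 1"
    and A_E: "A = (\<lambda>l. \<kappa> * of_real ((\<Sum>i\<in>UNIV. \<Sum>j\<in>UNIV. e i j) $ l))"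
    and P0: "\<And>i j. (1 / (\<pi>\<^sub>0 \<bullet> P i j 0)) *\<^sub>R P i j 0 = (if i = j then 1 else - 1) *\<^sub>R e i j"
    and P1: "\<And>i j. (1 / (\<pi>\<^sub>0 \<bullet> P i j 1)) *\<^sub>R P i j 1 =
       (if i = j then 1 else - 1) *\<^sub>R (e i j - k i j *\<^sub>R (\<Sum>i\<in>UNIV. \<Sum>j\<in>UNIV. e i j))"
    and k: "\<And>i j. k i j \<noteq> 0" "k 0 0 + k 0 1 + k 1 0 + k 1 1 \<noteq> 1"
  proof (rule reduction_to_frame[OF control_points P_neq _ \<sigma>P \<tau>P lam(2) \<mu>(2) \<pi>P A])
    show "m = 0" if "\<And>i j. m \<bullet> P i j k = 0" for m k using that by (rule indep_P)
  qed (rule that; assumption)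
  interpret pyramid_frame e X k \<alpha> \<beta> \<gamma>
    by (intro pyramid_frame.intro pyramid_frame_axioms.intro fr \<alpha> \<beta> \<gamma> k)
  have f: "trilinear w P = fp"
  proof (rule trilinear_eq_fp)
    show "w i j 0 *\<^sub>R P i j 0 = (\<alpha> $ i * \<beta> $ j * \<gamma> $ 0 * sg i j) *\<^sub>R e i j" for i j
      using arg_cong[OF P0[of i j], of "\<lambda>v. (\<alpha> $ i * \<beta> $ j * \<gamma> $ 0) *\<^sub>R v"] by (simp add: weights(4) sg_def)
    show "w i j 1 *\<^sub>R P i j 1 = (\<alpha> $ i * \<beta> $ j * \<gamma> $ 1 * sg i j) *\<^sub>R (e i j - k i j *\<^sub>R E)" for i j
      using arg_cong[OF P1[of i j], of "\<lambda>v. (\<alpha> $ i * \<beta> $ j * \<gamma> $ 1) *\<^sub>R v"]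
      by (simp only: weights(4) sg_def E_def scaleR_scaleR times_divide_eq_right mult_1_right)
  qed
  have Y_0: "cquad (\<upsilon> 0) (pnt (FF S T (\<lambda>i. if i = 0 then 1 else 0))) = 0" for S T
    using forms_\<upsilon>(1)[of 0] by (intro boundary_quadric_vanishes[OF f, of 0]) (simp_all add: Y_def)
  have Y_1: "cquad (\<upsilon> 1) (pnt (FF S T (\<lambda>i. if i = 0 then 0 else 1))) = 0" for S T
    using forms_\<upsilon>(1)[of 1] two_cases by (intro boundary_quadric_vanishes[OF f, of 1]) (auto simp: Y_def)
  obtain \<theta> where \<theta>: "\<theta> \<noteq> 0" and K_nz: "Kr \<noteq> 0" and det: "k 0 0 * k 1 1 - k 0 1 * k 1 0 \<noteq> 0"
    and \<nu>: "\<nu> $ 0 \<noteq> 0" "\<nu> $ 1 \<noteq> 0"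
    and \<upsilon>: "\<And>y. of_real (\<nu> $ 0) * cquad (\<upsilon> 0) y = of_real \<theta> * q0 y"
      "\<And>y. of_real (\<nu> $ 1) * cquad (\<upsilon> 1) y = - of_real \<theta> * q1 y"
    by (rule pencil[OF forms_\<upsilon>(2) forms_\<upsilon>(2) Y_0 Y_1 cone(2,3) _ \<kappa>])
      (use cone(4) in \<open>simp_all add: A_E E_def\<close>)
  interpret pyramid e X k \<alpha> \<beta> \<gamma>
    by unfold_locales (fact K_nz det)+
  have \<sigma>_clin: "of_real (lam $ 1) * clin (\<sigma> 1) y = S' y 0" "of_real (lam $ 0) * clin (\<sigma> 0) y = S' y 1"
    and \<tau>_clin: "of_real (\<mu> $ 1) * clin (\<tau> 1) y = T' y 0" "of_real (\<mu> $ 0) * clin (\<tau> 0) y = T' y 1" for y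
    unfolding clin_scaleR[symmetric] \<sigma>X \<tau>X S'_clin T'_clin by (rule refl)+
  interpret pyramid_inverse e X k \<alpha> \<beta> \<gamma> \<psi> \<theta>
  proof
    show "\<theta> \<noteq> 0" by (rule \<theta>)
    show "mapply \<psi> y (Par_s, 0) = of_real (\<alpha> $ 1) * S' y 0" "mapply \<psi> y (Par_s, 1) = of_real (\<alpha> $ 0) * S' y 1"
      "mapply \<psi> y (Par_t, 0) = of_real (\<beta> $ 1) * T' y 0" "mapply \<psi> y (Par_t, 1) = of_real (\<beta> $ 0) * T' y 1" for y
      by (simp_all add: mapply_def ceval_def[symmetric] \<psi>_def \<sigma>_clin[symmetric] \<tau>_clin[symmetric])
    show "mapply \<psi> y (Par_u, 0) = of_real (\<gamma> $ 1 * \<theta>) * U' y 0" "mapply \<psi> y (Par_u, 1) = of_real (\<gamma> $ 0 * \<theta>) * U' y 1" for y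
      using \<upsilon>[of y] by (simp_all add: mapply_def ceval_def[symmetric] \<psi>_def U'_def mult.assoc)
    show "homogeneous blk3 (\<lambda>_. if b = Par_u then 2 else 1) (\<psi> (b, i))" for b i
      using homogeneous_linear_form homogeneous_quadratic_form
      by (cases b) (auto simp: \<psi>_def intro!: homogeneous_pconst_mult)
  qed
  \<comment> \<open>A zero coefficient would make two vectors of the dual basis equal.\<close>
  have nz: "lam $ 0 \<noteq> 0" "lam $ 1 \<noteq> 0" "\<mu> $ 0 \<noteq> 0" "\<mu> $ 1 \<noteq> 0"
  proof -
    have "X 1 1 - X 1 0 \<noteq> 0" "X 0 0 - X 0 1 \<noteq> 0" "X 1 1 - X 0 1 \<noteq> 0" "X 0 0 - X 1 0 \<noteq> 0"
      using dual[of 1 1 1 1] dual[of 1 0 1 1] dual[of 0 0 0 0] dual[of 0 1 0 0] dual[of 0 1 1 1] dual[of 1 0 0 0]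
      by auto
    then show "lam $ 0 \<noteq> 0" "lam $ 1 \<noteq> 0" "\<mu> $ 0 \<noteq> 0" "\<mu> $ 1 \<noteq> 0"
      unfolding \<sigma>X[symmetric] \<tau>X[symmetric] by auto
  qed
  have \<pi>\<^sub>0: "\<pi>\<^sub>0 = pvec" unfolding lam(2) \<sigma>X pvec_def by simp
  have \<Sigma>: "\<Sigma> 0 = {y \<in> mpoints blk3. S' y 1 = 0}" "\<Sigma> 1 = {y \<in> mpoints blk3. S' y 0 = 0}"
    and T: "T 0 = {y \<in> mpoints blk3. T' y 1 = 0}" "T 1 = {y \<in> mpoints blk3. T' y 0 = 0}"
    unfolding forms_\<sigma> forms_\<tau> \<sigma>_clin[symmetric] \<tau>_clin[symmetric] using nz by (auto simp: mem_plane)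
  have Y0: "Y 0 = {y \<in> mpoints blk3. q0 y = 0}"
  proof -
    have "cquad (\<upsilon> 0) y = 0 \<longleftrightarrow> q0 y = 0" for y
      using \<upsilon>(1)[of y] \<nu>(1) \<theta> by (metis mult_eq_0_iff neg_equal_0_iff_equal of_real_eq_0_iff)
    then show ?thesis unfolding forms_\<upsilon>(1) set_eq_iff mem_quadric mem_Collect_eq by presburger
  qed
  have Y1: "Y 1 = {y \<in> mpoints blk3. q1 y = 0}"
  proof -
    have "cquad (\<upsilon> 1) y = 0 \<longleftrightarrow> q1 y = 0" for y
      using \<upsilon>(2)[of y] \<nu>(2) \<theta> by (metis mult_eq_0_iff neg_equal_0_iff_equal of_real_eq_0_iff)
    then show ?thesis unfolding forms_\<upsilon>(1) set_eq_iff mem_quadric mem_Collect_eq by presburger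
  qed
  have Y: "Y 0 \<inter> Y 1 = {y \<in> mpoints blk3. q0 y = 0 \<and> kk y * p0 y = 0}"
    unfolding Y0 Y1 by (auto simp: q1_def)
  have st: "s \<union> t = {y \<in> mpoints blk3. q0 y = 0 \<and> p0 y = 0}"
    unfolding s_def t_def \<Sigma> T S'_T'_zero by auto
  have C: "C = conic"
    unfolding C_def by (rule conic_closure) (auto simp: Y st)
  obtain a where a: "a \<noteq> 0" "\<pi>\<^sub>1 = a *\<^sub>R kvec"
    using plane_of_conic plane_\<pi>\<^sub>1 unfolding C by blast
  have "(\<Sum>l\<in>UNIV. pconst (\<pi>\<^sub>1 $ l) * f l) = pconst a * (\<Sum>l\<in>UNIV. pconst (kvec $ l) * fp l)"
    by (simp add: f_def f a(2) pconst_mult sum_distrib_left mult.assoc)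
  then have hc: "h * c\<^sub>0 = pconst a * (Lp * c0p)"
    unfolding factorization(1) pullback_kvec .
  obtain d d' where d: "d \<noteq> 0" "d' \<noteq> 0" "h = pconst d * Lp" "c\<^sub>0 = pconst d' * c0p"
    by (rule factors[OF hc a(1) factorization(2,4)])
  have ab: "a\<^sub>0 = ap" "b\<^sub>0 = bp" "c\<^sub>1 = c1p"
    by (simp_all add: a\<^sub>0_def b\<^sub>0_def c\<^sub>1_def param_form_def sum_UNIV_2 Sp_def Tp_def Up_def)
  have unit: "pconst d * pconst (1 / d) = (1 :: ring_R)" "pconst d' * pconst (1 / d') = (1 :: ring_R)"
    using d(1,2) by (simp_all flip: pconst_mult)
  have "ideal_gen {c\<^sub>0, a\<^sub>0, b\<^sub>0} = ideal_gen {c0p, ap, bp}" "ideal_gen {h, c\<^sub>1} = ideal_gen {Lp, c1p}"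
    unfolding d(3,4) ab by (rule ideal_gen_unit_mult, rule unit)+
  then have ideals: "ideal_gen {a\<^sub>0, b\<^sub>0, c\<^sub>0} = ideal_gen {ap, bp, c0p}" "ideal_gen {h, c\<^sub>1} = ideal_gen {Lp, c1p}"
    by (simp_all add: insert_commute)
  \<comment> \<open>Here qc = q0 - q1.\<close>
  have q_eq: "cquad q y = of_real \<theta> * qc y" for y
    using \<upsilon>[of y] by (simp add: cone(2) cquad_add cquad_scaleR q1_def qc_def algebra_simps)
  have "quadric q = {y \<in> mpoints blk3. qc y = 0}"
    using \<theta> by (auto simp: mem_quadric q_eq)
  moreover have "plane \<pi>\<^sub>0 = {y \<in> mpoints blk3. p0 y = 0}"
    by (auto simp: mem_plane \<pi>\<^sub>0 clin_pvec)
  moreover have "blows_up blk111 blk3 fp (ideal_gen {a\<^sub>0, b\<^sub>0, c\<^sub>0}) {y \<in> mpoints blk3. p0 y = 0}"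
    by (rule blows_up_point[where d = "of_real d'"]) (use d(2) in \<open>simp_all add: d(4) ab K_def\<close>)
  moreover have "blows_up blk111 blk3 fp (ideal_gen {h, c\<^sub>1}) {y \<in> mpoints blk3. qc y = 0}"
    by (rule blows_up_curve[where d = d]) (use d(1) in \<open>simp_all add: d(3) ab\<close>)
  moreover have "Y 0 \<inter> Y 1 = s \<union> t \<union> C"
    unfolding Y st C by (auto simp: conic_def)
  moreover have "base_locus blk3 blk111 \<psi> = Y 0 \<inter> Y 1"
    unfolding base_locus_\<psi> Y0 Y1 by auto
  moreover have "same_subscheme blk111 (ideal_gen (range fp)) (ideal_gen {a\<^sub>0, b\<^sub>0, c\<^sub>0} \<inter> ideal_gen {h, c\<^sub>1})"
    unfolding ideals by (rule base_scheme)
  moreover have "plane_conic \<pi>\<^sub>1 C" unfolding C by (rule plane_conic_conic[OF a(2,1)])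
  ultimately show ?thesis using inverse unfolding f_def f by simp
qed

end
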